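(* Let $\mathcal{S}\subset\mathbb{R}^{\ast}$ be a measurable set which is translation congruent to $(0,1]$, and let $f\in\mathbf{H}_{\mathcal{S}}$. If $\tau(\Lambda)f=\{\tau(\gamma,\eta)f:(\gamma,\eta)\in\Lambda\}$ is a Parseval frame in $\mathbf{H}_{\mathcal{S}}$, then $$\left\{\left[\pi_{\lambda}(\kappa)\otimes\overline{\pi}_{\lambda}(\eta)\right](\mathbf{P}f)(\lambda)\,|\lambda|^{1/2}:(\kappa,\eta)\in\Lambda_{1}\right\}$$ is a Parseval frame in $L^{2}(\mathbb{R})\otimes L^{2}(\mathbb{R})$ for $d\lambda$-almost every $\lambda\in\mathcal{S}$.
   Context: **Heisenberg group.** For $x,y,z\in\mathbb{R}$ put $$M(x,y,z)=\begin{bmatrix}1&x&-y&z\\0&1&0&y\\0&0&1&0\\0&0&0&1\end{bmatrix},\qquad \mathbb{H}=\{M(x,y,z):x,y,z\in\mathbb{R}\}\subset GL(4,\mathbb{R}),$$ a realization of the three-dimensional Heisenberg group, with $M(x,y,z)M(w,v,u)=M(x+w,y+v,z+u+xv)$. It is endowed with the Haar measure $dx\,dy\,dz$ (Lebesgue measure on $\mathbb{R}^3$). **Biregular representation.** $\tau:\mathbb{H}\times\mathbb{H}\to\mathcal{U}(L^2(\mathbb{H}))$ is $\tau(u,v)f=L(u)R(v)f$, where $L(u)f(x)=f(u^{-1}x)$ and $R(v)f(x)=f(xv)$. **Index sets.** $\Lambda=\{(M(k_3,k_2,k_1),M(m_3,m_2,0)):k_1,k_2,k_3,m_2,m_3\in\mathbb{Z}\}$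 and $\Lambda_1=\{(M(k_3,k_2,0),M(m_3,m_2,0)):k_2,k_3,m_2,m_3\in\mathbb{Z}\}$, subsets of $\mathbb{H}\times\mathbb{H}$. **Plancherel transform.** $\mathbb{R}^{\ast}=\mathbb{R}\setminus\{0\}$. For $\lambda\in\mathbb{R}^{\ast}$, $\pi_\lambda$ is the irreducible unitary representation of $\mathbb{H}$ on $L^2(\mathbb{R})$ given by $\pi_\lambda(M(x,y,z))\phi(t)=e^{2\pi i\lambda z}e^{-2\pi i\lambda yt}\phi(t-x)$. For $f\in L^1(\mathbb{H})\cap L^2(\mathbb{H})$ the Fourier transform is $\mathcal{F}f(\lambda)=\int_{\mathbb{H}}f(n)\pi_\lambda(n)\,dn$ (weakly defined). It is a Hilbert-Schmidt operator on $L^2(\mathbb{R})$ for almost every $\lambda$, and $\mathcal{F}$ extends to a unitary operator, the Plancherel transform, $$\mathbf{P}:L^2(\mathbb{H})\to\int_{\mathbb{R}^{\ast}}^{\oplus}L^2(\mathbb{R})\otimes L^2(\mathbb{R})\,|\lambda|d\lambda,\qquad \|f\|^2_{L^2(\mathbb{H})}=\int_{\mathbb{R}^{\ast}}\|\mathbf{P}f(\lambda)\|^2_{\mathcal{HS}}\,|\lambda|d\lambda,$$ where $L^2(\mathbb{R})\otimes L^2(\mathbb{R})$ denotes the Hilbert space of Hilbert-Schmidt operators on $L^2(\mathbb{R})$ with norm $\|\cdot\|_{\mathcal{HS}}$ and $d\lambda$ is Lebesgue measure. The contragredient representation of $\pi_\lambda$ is denoted $\overline{\pi}_\lambda$, and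 $\pi_\lambda(x)\otimes\overline{\pi}_\lambda(y)$ acts on a Hilbert-Schmidt operator $T$ by $[\pi_\lambda(x)\otimes\overline{\pi}_\lambda(y)]T=\pi_\lambda(x)\,T\,\pi_\lambda(y)^{\ast}$; with this, $\mathbf{P}(\tau(x,y)\phi)(\lambda)=[\pi_\lambda(x)\otimes\overline{\pi}_\lambda(y)](\mathbf{P}\phi)(\lambda)$. For measurable $\mathcal{S}\subset\mathbb{R}^{\ast}$, $\mathbf{H}_{\mathcal{S}}=\mathbf{P}^{-1}\left(\int_{\mathcal{S}}^{\oplus}L^2(\mathbb{R})\otimes L^2(\mathbb{R})\,|\lambda|d\lambda\right)$, i.e. the closed $\tau$-invariant subspace of those $f\in L^2(\mathbb{H})$ with $\mathbf{P}f(\lambda)=0$ for a.e. $\lambda\notin\mathcal{S}$. **Translation congruence.** Measurable sets $I,J\subset\mathbb{R}$ are translation congruent if there is a bijection $\rho:I\to J$ and an integer-valued (measurable) function $k$ on $I$ with $\rho(\lambda)=\lambda+k(\lambda)$. All sets and functions are measurable and sets are identified when their symmetric difference has Lebesgue measure zero. **Parseval frame.** A countable family $\{f_i\}_{i\in I}$ in a Hilbert space $\mathbf{H}$ is a Parseval frame in $\mathbf{H}$ if $\sum_{i\in I}|\langle h,f_i\rangle|^2=\|h\|^2$ for all $h\in\mathbf{H}$. *)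

theory Defs
  imports "HOL-Analysis.Analysis"
begin

section \<open>Square-integrable functions\<close>

text \<open>Elements of L2 are represented by functions; two functions that agree almost everywhere
  represent the same element.\<close>

definition L2 :: "'a measure \<Rightarrow> ('a \<Rightarrow> complex) set" where
  "L2 M = {f. f \<in> borel_measurable M \<and> integrable M (\<lambda>x. (cmod (f x))\<^sup>2)}"

definition L2_inner :: "'a measure \<Rightarrow> ('a \<Rightarrow> complex) \<Rightarrow> ('a \<Rightarrow> complex) \<Rightarrow> complex" where
  "L2_inner M f g = (\<integral>x. f x * cnj (g x) \<partial>M)"

definition L2_norm :: "'a measure \<Rightarrow> ('a \<Rightarrow> complex) \<Rightarrow> real" where
  "L2_norm M f = sqrt (\<integral>x. (cmod (f x))\<^sup>2 \<partial>M)"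

section \<open>Parseval frames\<close>

text \<open>A Hilbert space enters through a carrier \<open>H\<close> of representatives and its inner product
  \<open>ip\<close>, so that the squared norm of \<open>h\<close> is \<open>Re (ip h h)\<close>.\<close>

definition parseval_frame ::
    "'h set \<Rightarrow> ('h \<Rightarrow> 'h \<Rightarrow> complex) \<Rightarrow> 'i set \<Rightarrow> ('i \<Rightarrow> 'h) \<Rightarrow> bool" where
  "parseval_frame H ip I F \<longleftrightarrow> countable I \<and> (\<forall>i\<in>I. F i \<in> H) \<and>
     (\<forall>h\<in>H. ((\<lambda>i. (cmod (ip h (F i)))\<^sup>2) has_sum Re (ip h h)) I)"

section \<open>Operators on L2 of the real line\<close>

type_synonym l2_op = "(real \<Rightarrow> complex) \<Rightarrow> real \<Rightarrow> complex"

text \<open>Bounded linear operators. Compatibility with almost everywhere equality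
  follows from linearity and boundedness.\<close>

definition l2_operator :: "l2_op \<Rightarrow> bool" where
  "l2_operator T \<longleftrightarrow>
     (\<forall>\<phi>\<in>L2 lborel. T \<phi> \<in> L2 lborel) \<and>
     (\<forall>\<phi>\<in>L2 lborel. \<forall>\<psi>\<in>L2 lborel. AE t in lborel. T (\<lambda>s. \<phi> s + \<psi> s) t = T \<phi> t + T \<psi> t) \<and>
     (\<forall>c. \<forall>\<phi>\<in>L2 lborel. AE t in lborel. T (\<lambda>s. c * \<phi> s) t = c * T \<phi> t) \<and>
     (\<exists>C. \<forall>\<phi>\<in>L2 lborel. L2_norm lborel (T \<phi>) \<le> C * L2_norm lborel \<phi>)"

definition op_eq :: "l2_op \<Rightarrow> l2_op \<Rightarrow> bool" where
  "op_eq S T \<longleftrightarrow> (\<forall>\<phi>\<in>L2 lborel. AE t in lborel. S \<phi> t = T \<phi> t)"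

definition op_zero :: l2_op where
  "op_zero = (\<lambda>\<phi> t. 0)"

definition op_add :: "l2_op \<Rightarrow> l2_op \<Rightarrow> l2_op" where
  "op_add S T = (\<lambda>\<phi> t. S \<phi> t + T \<phi> t)"

definition op_scale :: "complex \<Rightarrow> l2_op \<Rightarrow> l2_op" where
  "op_scale c T = (\<lambda>\<phi> t. c * T \<phi> t)"

text \<open>The adjoint, unique up to \<^const>\<open>op_eq\<close>.\<close>

definition l2_adjoint :: "l2_op \<Rightarrow> l2_op" where
  "l2_adjoint T = (SOME S. l2_operator S \<and>
     (\<forall>\<phi>\<in>L2 lborel. \<forall>\<psi>\<in>L2 lborel. L2_inner lborel (T \<phi>) \<psi> = L2_inner lborel \<phi> (S \<psi>)))"

section \<open>Hilbert-Schmidt operators\<close>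

definition l2_orthonormal_basis :: "(nat \<Rightarrow> real \<Rightarrow> complex) \<Rightarrow> bool" where
  "l2_orthonormal_basis e \<longleftrightarrow>
     (\<forall>n. e n \<in> L2 lborel) \<and>
     (\<forall>m n. L2_inner lborel (e m) (e n) = (if m = n then 1 else 0)) \<and>
     (\<forall>\<phi>\<in>L2 lborel. (\<forall>n. L2_inner lborel \<phi> (e n) = 0) \<longrightarrow> (AE t in lborel. \<phi> t = 0))"

text \<open>The notions below do not depend on the choice of the basis.\<close>

definition l2_basis :: "nat \<Rightarrow> real \<Rightarrow> complex" where
  "l2_basis = (SOME e. l2_orthonormal_basis e)"

definition hs_ops :: "l2_op set" where
  "hs_ops = {T. l2_operator T \<and> summable (\<lambda>n. (L2_norm lborel (T (l2_basis n)))\<^sup>2)}"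

definition hs_inner :: "l2_op \<Rightarrow> l2_op \<Rightarrow> complex" where
  "hs_inner S T = (\<Sum>n. L2_inner lborel (S (l2_basis n)) (T (l2_basis n)))"

definition hs_norm :: "l2_op \<Rightarrow> real" where
  "hs_norm T = sqrt (\<Sum>n. (L2_norm lborel (T (l2_basis n)))\<^sup>2)"

section \<open>The Heisenberg group\<close>

type_synonym mat4 = "real ^ 4 ^ 4"

definition heis_mat :: "real \<Rightarrow> real \<Rightarrow> real \<Rightarrow> mat4" where
  "heis_mat x y z = vector [
     vector [1, x, - y, z],
     vector [0, 1, 0, y],
     vector [0, 0, 1, 0],
     vector [0, 0, 0, 1]]"

definition heis :: "mat4 set" where
  "heis = {heis_mat x y z | x y z. True}"

definition haar :: "mat4 measure" where
  "haar = distr (lborel :: (real \<times> real \<times> real) measure) (restrict_space borel heis)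
     (\<lambda>(x, y, z). heis_mat x y z)"

lemma vector_4:
  "(vector [a, b, c, d] :: ('a::zero) ^ 4) $ 1 = a"
  "(vector [a, b, c, d] :: ('a::zero) ^ 4) $ 2 = b"
  "(vector [a, b, c, d] :: ('a::zero) ^ 4) $ 3 = c"
  "(vector [a, b, c, d] :: ('a::zero) ^ 4) $ 4 = d"
  unfolding vector_def by simp_all

lemma heis_mat_mult:
  "heis_mat x y z ** heis_mat w v u = heis_mat (x + w) (y + v) (z + u + x * v)"
  by (simp add: heis_mat_def matrix_matrix_mult_def vec_eq_iff forall_4 sum_4 vector_4)

lemma heis_mat_0: "heis_mat 0 0 0 = mat 1"
  by (simp add: heis_mat_def mat_def vec_eq_iff forall_4 vector_4)

lemma heis_mat_measurable:
  "(\<lambda>(x, y, z). heis_mat x y z) \<in> (lborel :: (real \<times> real \<times> real) measure) \<rightarrow>\<^sub>M restrict_space borel heis"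
proof (rule measurable_restrict_space2)
  show "(\<lambda>(x, y, z). heis_mat x y z) \<in> space lborel \<rightarrow> heis"
    by (auto simp: heis_def)
  have "continuous_on UNIV (\<lambda>(x, y, z). heis_mat x y z $ i $ j)" for i j
    using exhaust_4[of i] exhaust_4[of j]
    by (elim disjE; simp add: heis_mat_def vector_4 case_prod_beta)
      (intro continuous_intros)+
  then have "continuous_on UNIV (\<lambda>p. (\<chi> i. \<chi> j. (\<lambda>(x, y, z). heis_mat x y z $ i $ j) p) :: mat4)"
    by (intro continuous_on_vec_lambda)
  moreover have "(\<lambda>p. (\<chi> i. \<chi> j. (\<lambda>(x, y, z). heis_mat x y z $ i $ j) p) :: mat4)
      = (\<lambda>(x, y, z). heis_mat x y z)"
    by (simp add: fun_eq_iff vec_eq_iff)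
  ultimately have "continuous_on UNIV (\<lambda>(x, y, z). heis_mat x y z)"
    by (simp only:)
  then show "(\<lambda>(x, y, z). heis_mat x y z) \<in> (lborel :: (real \<times> real \<times> real) measure) \<rightarrow>\<^sub>M borel"
    by (auto dest: borel_measurable_continuous_onI)
qed

section \<open>The biregular representation\<close>

definition left_reg :: "mat4 \<Rightarrow> (mat4 \<Rightarrow> complex) \<Rightarrow> mat4 \<Rightarrow> complex" where
  "left_reg u f = (\<lambda>x. f (matrix_inv u ** x))"

definition right_reg :: "mat4 \<Rightarrow> (mat4 \<Rightarrow> complex) \<Rightarrow> mat4 \<Rightarrow> complex" where
  "right_reg v f = (\<lambda>x. f (x ** v))"

definition biregular :: "mat4 \<Rightarrow> mat4 \<Rightarrow> (mat4 \<Rightarrow> complex) \<Rightarrow> mat4 \<Rightarrow> complex" where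
  "biregular u v f = left_reg u (right_reg v f)"

definition Lambda :: "(mat4 \<times> mat4) set" where
  "Lambda = {(heis_mat (of_int k3) (of_int k2) (of_int k1), heis_mat (of_int m3) (of_int m2) 0)
     | (k1::int) (k2::int) (k3::int) (m2::int) (m3::int). True}"

definition Lambda1 :: "(mat4 \<times> mat4) set" where
  "Lambda1 = {(heis_mat (of_int k3) (of_int k2) 0, heis_mat (of_int m3) (of_int m2) 0)
     | (k2::int) (k3::int) (m2::int) (m3::int). True}"

section \<open>The representations indexed by the dual and the Plancherel transform\<close>

text \<open>For \<open>n = heis_mat x y z\<close> the coordinates are read off the matrix entries,
  \<open>x = n $ 1 $ 2\<close>, \<open>y = n $ 2 $ 4\<close> and \<open>z = n $ 1 $ 4\<close>; see the next lemma.\<close>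

definition heis_rep :: "real \<Rightarrow> mat4 \<Rightarrow> l2_op" where
  "heis_rep l n \<phi> = (\<lambda>t. cis (2 * pi * l * (n $ 1 $ 4)) * cis (- 2 * pi * l * (n $ 2 $ 4) * t)
     * \<phi> (t - n $ 1 $ 2))"

lemma heis_rep_heis_mat:
  "heis_rep l (heis_mat x y z) \<phi> t = cis (2 * pi * l * z) * cis (- 2 * pi * l * y * t) * \<phi> (t - x)"
  by (simp add: heis_rep_def heis_mat_def vector_4)

definition rep_tensor :: "real \<Rightarrow> mat4 \<Rightarrow> mat4 \<Rightarrow> l2_op \<Rightarrow> l2_op" where
  "rep_tensor l x y T = heis_rep l x \<circ> T \<circ> l2_adjoint (heis_rep l y)"

text \<open>\<open>T\<close> is the weakly defined integral of \<open>f n\<close> times \<open>heis_rep l n\<close> over the group.\<close>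

definition has_heis_fourier :: "(mat4 \<Rightarrow> complex) \<Rightarrow> real \<Rightarrow> l2_op \<Rightarrow> bool" where
  "has_heis_fourier f l T \<longleftrightarrow> l2_operator T \<and>
     (\<forall>\<phi>\<in>L2 lborel. \<forall>\<psi>\<in>L2 lborel.
        L2_inner lborel (T \<phi>) \<psi> = (\<integral>n. f n * L2_inner lborel (heis_rep l n \<phi>) \<psi> \<partial>haar))"

text \<open>The point 0 is a null set of this measure.\<close>

definition plancherel_measure :: "real measure" where
  "plancherel_measure = density lborel (\<lambda>l. ennreal \<bar>l\<bar>)"

text \<open>The direct integral over the nonzero reals of the constant field of Hilbert-Schmidt operators:
  square-integrable fields, measurable in the sense that the inner product with every fixed
  vector of the (separable) fibre is measurable. The value at 0 is irrelevant.\<close>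

definition hs_direct_integral :: "(real \<Rightarrow> l2_op) set" where
  "hs_direct_integral = {G.
     (\<forall>l. l \<noteq> 0 \<longrightarrow> G l \<in> hs_ops) \<and>
     (\<forall>T\<in>hs_ops. (\<lambda>l. hs_inner (G l) T) \<in> borel_measurable borel) \<and>
     integrable plancherel_measure (\<lambda>l. (hs_norm (G l))\<^sup>2)}"

text \<open>\<open>P\<close> is the unitary (linear, isometric, surjective) extension of the Fourier transform to
  all of L2. These conditions determine \<open>P f l\<close> up to \<^const>\<open>op_eq\<close> for almost every \<open>l\<close>.\<close>

definition plancherel_transform :: "((mat4 \<Rightarrow> complex) \<Rightarrow> real \<Rightarrow> l2_op) \<Rightarrow> bool" where
  "plancherel_transform P \<longleftrightarrow>
     (\<forall>f\<in>L2 haar. P f \<in> hs_direct_integral) \<and>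
     (\<forall>f\<in>L2 haar. \<forall>g\<in>L2 haar. AE l in lborel.
        op_eq (P (\<lambda>n. f n + g n) l) (op_add (P f l) (P g l))) \<and>
     (\<forall>c. \<forall>f\<in>L2 haar. AE l in lborel. op_eq (P (\<lambda>n. c * f n) l) (op_scale c (P f l))) \<and>
     (\<forall>f\<in>L2 haar. (L2_norm haar f)\<^sup>2 = (\<integral>l. (hs_norm (P f l))\<^sup>2 \<partial>plancherel_measure)) \<and>
     (\<forall>G\<in>hs_direct_integral. \<exists>f\<in>L2 haar. AE l in lborel. op_eq (P f l) (G l)) \<and>
     (\<forall>f\<in>L2 haar. integrable haar f \<longrightarrow> (AE l in lborel. has_heis_fourier f l (P f l)))"

definition spectral_subspace ::
    "((mat4 \<Rightarrow> complex) \<Rightarrow> real \<Rightarrow> l2_op) \<Rightarrow> real set \<Rightarrow> (mat4 \<Rightarrow> complex) set" where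
  "spectral_subspace P S =
     {f \<in> L2 haar. AE l in lborel. l \<notin> S \<longrightarrow> op_eq (P f l) op_zero}"

section \<open>Translation congruence\<close>

text \<open>Sets are identified when their symmetric difference is a null set, so the bijection is
  required only between representatives \<open>I'\<close> and \<open>J'\<close> of \<open>I\<close> and \<open>J\<close>.\<close>

definition translation_congruent :: "real set \<Rightarrow> real set \<Rightarrow> bool" where
  "translation_congruent I J \<longleftrightarrow> (\<exists>I' J' \<rho>. \<exists>k :: real \<Rightarrow> int.
     I' \<in> sets lebesgue \<and> J' \<in> sets lebesgue \<and>
     (I - I') \<union> (I' - I) \<in> null_sets lebesgue \<and> (J - J') \<union> (J' - J) \<in> null_sets lebesgue \<and>
     k \<in> restrict_space lebesgue I' \<rightarrow>\<^sub>M count_space UNIV \<and>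
     bij_betw \<rho> I' J' \<and> (\<forall>l\<in>I'. \<rho> l = l + of_int (k l)))"

end

theory Submission
  imports Defs "HOL-Library.Function_Algebras" "HOL-Library.Nat_Bijection"
begin

text \<open>
  The family indexed by \<open>Lambda\<close> is the family indexed by \<open>Lambda1\<close> translated by the integer points
  of the centre, and on the fibre over \<open>l\<close> the central element with coordinate \<open>k\<close> acts by the scalar
  \<open>cis (2 * pi * l * k)\<close>. Since \<open>S\<close> is translation congruent to \<open>(0, 1]\<close>, its integer translates are
  disjoint up to null sets, so these characters satisfy Parseval's identity on bounded Borel subsets
  \<open>A\<close> of \<open>S\<close>. Testing the frame identity on the vectors of the spectral subspace whose Plancherel
  transform is \<open>1\<^sub>A T\<close>, for a fixed Hilbert-Schmidt operator \<open>T\<close>, and summing over the centre gives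
  the fibrewise frame identity for \<open>T\<close> integrated over \<open>A\<close>. As \<open>A\<close> is arbitrary, it holds at almost
  every \<open>l\<close>; running \<open>T\<close> through a countable dense set and using continuity gives it for all \<open>T\<close> at
  once.
\<close>

text \<open>Two obstacles shape the details. The Plancherel transform is characterised through norms
  and, on integrable functions, through a weak integral; its covariance under
  \<open>biregular\<close>, the preservation of fibre norms and the formula for inner products have
  to be derived from that. The factor |l|^(1/2) balances two occurrences of the Plancherel weight.
  In the inner product with a test vector the weight is part of the function whose Fourier
  coefficients are taken, and Parseval squares it; in the norm of the test vector it occurs once.
  Dividing leaves |l|. Both S and the fibre norms of f may be unbounded, so A is chosen where l and
  these norms are bounded; this makes the function to be expanded square-integrable.\<close>

section \<open>Semi-inner product spaces given by representatives\<close>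

text \<open>Representatives that agree almost everywhere stay distinct, so the form is only positive
  semidefinite and \<open>nrm x = 0\<close> does not give \<open>x = 0\<close>. Scalar
  multiplication is a parameter because functions and operators, both additive groups pointwise,
  carry different scalings.\<close>

locale semi_inner =
  fixes H :: "'h::ab_group_add set"
    and sc :: "complex \<Rightarrow> 'h \<Rightarrow> 'h"
    and ip :: "'h \<Rightarrow> 'h \<Rightarrow> complex"
  assumes zero_mem: "0 \<in> H"
    and add_mem: "x \<in> H \<Longrightarrow> y \<in> H \<Longrightarrow> x + y \<in> H"
    and sc_mem: "x \<in> H \<Longrightarrow> sc c x \<in> H"
    and sc_zero: "sc 0 x = 0"
    and sc_minus_one: "sc (-1) x = - x"
    and ip_add_left: "x \<in> H \<Longrightarrow> y \<in> H \<Longrightarrow> z \<in> H \<Longrightarrow> ip (x + y) z = ip x z + ip y z"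
    and ip_sc_left: "x \<in> H \<Longrightarrow> z \<in> H \<Longrightarrow> ip (sc c x) z = c * ip x z"
    and ip_cnj: "x \<in> H \<Longrightarrow> y \<in> H \<Longrightarrow> cnj (ip x y) = ip y x"
    and ip_pos: "x \<in> H \<Longrightarrow> 0 \<le> Re (ip x x)"
begin

definition nrm :: "'h \<Rightarrow> real" where
  "nrm x = sqrt (Re (ip x x))"

lemma minus_mem: "x \<in> H \<Longrightarrow> - x \<in> H"
  using sc_mem[of x "-1"] by (simp add: sc_minus_one)

lemma diff_mem: "x \<in> H \<Longrightarrow> y \<in> H \<Longrightarrow> x - y \<in> H"
  using add_mem[of x "- y"] minus_mem by simp

lemma sum_mem: "(\<And>i. i \<in> A \<Longrightarrow> f i \<in> H) \<Longrightarrow> sum f A \<in> H"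
  by (induction A rule: infinite_finite_induct) (auto intro: add_mem zero_mem)

lemma ip_minus_left: "x \<in> H \<Longrightarrow> z \<in> H \<Longrightarrow> ip (- x) z = - ip x z"
  using ip_sc_left[of x z "-1"] by (simp add: sc_minus_one)

lemma ip_diff_left: "x \<in> H \<Longrightarrow> y \<in> H \<Longrightarrow> z \<in> H \<Longrightarrow> ip (x - y) z = ip x z - ip y z"
  using ip_add_left[of x "- y" z] by (simp add: minus_mem ip_minus_left)

lemma ip_zero_left: "z \<in> H \<Longrightarrow> ip 0 z = 0"
  using ip_diff_left[of z z z] by simp

lemma ip_add_right:
  assumes "x \<in> H" "y \<in> H" "z \<in> H"
  shows "ip z (x + y) = ip z x + ip z y"
proof -
  have "cnj (ip (x + y) z) = cnj (ip x z) + cnj (ip y z)"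
    using assms by (simp add: ip_add_left)
  then show ?thesis
    using assms by (simp add: ip_cnj add_mem)
qed

lemma ip_sc_right:
  assumes "x \<in> H" "z \<in> H"
  shows "ip z (sc c x) = cnj c * ip z x"
proof -
  have "cnj (ip (sc c x) z) = cnj c * cnj (ip x z)"
    using assms by (simp add: ip_sc_left)
  then show ?thesis
    using assms by (simp add: ip_cnj sc_mem)
qed

lemma ip_minus_right: "x \<in> H \<Longrightarrow> z \<in> H \<Longrightarrow> ip z (- x) = - ip z x"
  using ip_sc_right[of x z "-1"] by (simp add: sc_minus_one)

lemma ip_diff_right: "x \<in> H \<Longrightarrow> y \<in> H \<Longrightarrow> z \<in> H \<Longrightarrow> ip z (x - y) = ip z x - ip z y"
  using ip_add_right[of x "- y" z] by (simp add: minus_mem ip_minus_right)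

lemma ip_sum_left:
  assumes "\<And>i. i \<in> A \<Longrightarrow> f i \<in> H" "z \<in> H"
  shows "ip (sum f A) z = (\<Sum>i\<in>A. ip (f i) z)"
  using assms
proof (induction A rule: infinite_finite_induct)
  case (insert a A)
  then show ?case
    by (simp add: ip_add_left sum_mem)
qed (simp_all add: ip_zero_left)

lemma nrm_nonneg: "x \<in> H \<Longrightarrow> 0 \<le> nrm x"
  by (simp add: nrm_def ip_pos)

lemma nrm_sq: "x \<in> H \<Longrightarrow> (nrm x)\<^sup>2 = Re (ip x x)"
  by (simp add: nrm_def ip_pos)

lemma ip_self: "x \<in> H \<Longrightarrow> ip x x = of_real ((nrm x)\<^sup>2)"
  using ip_cnj[of x x] by (simp add: complex_eq_iff nrm_sq)

lemma nrm_zero: "nrm 0 = 0"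
  by (simp add: nrm_def ip_zero_left zero_mem)

lemma nrm_sq_sc: "x \<in> H \<Longrightarrow> (nrm (sc c x))\<^sup>2 = (cmod c)\<^sup>2 * (nrm x)\<^sup>2"
proof -
  assume x: "x \<in> H"
  have "ip (sc c x) (sc c x) = (c * cnj c) * ip x x"
    using x by (simp add: ip_sc_left ip_sc_right sc_mem)
  also have "\<dots> = of_real ((cmod c)\<^sup>2 * (nrm x)\<^sup>2)"
    using x by (simp add: ip_self complex_norm_square[symmetric])
  finally show ?thesis
    using x by (simp add: nrm_sq sc_mem)
qed

lemma nrm_sc: "x \<in> H \<Longrightarrow> nrm (sc c x) = cmod c * nrm x"
  using nrm_sq_sc[of x c] nrm_nonneg[of x] nrm_nonneg[of "sc c x"] sc_mem[of x c]
  by (metis norm_ge_zero power2_eq_iff_nonneg power_mult_distrib zero_le_mult_iff)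

lemma nrm_minus: "x \<in> H \<Longrightarrow> nrm (- x) = nrm x"
  using nrm_sc[of x "-1"] by (simp add: sc_minus_one)

lemma nrm_diff_commute: "x \<in> H \<Longrightarrow> y \<in> H \<Longrightarrow> nrm (x - y) = nrm (y - x)"
  using nrm_minus[of "x - y"] diff_mem[of x y] by simp

lemma nrm_sq_add:
  assumes "x \<in> H" "y \<in> H"
  shows "(nrm (x + y))\<^sup>2 = (nrm x)\<^sup>2 + (nrm y)\<^sup>2 + 2 * Re (ip x y)"
proof -
  have "Re (ip y x) = Re (ip x y)"
    using assms ip_cnj[of x y] by (metis complex_cnj(1) complex_surj complex.sel(1))
  then show ?thesis
    using assms by (simp add: nrm_sq add_mem ip_add_left ip_add_right)
qed

text \<open>For the Plancherel transform, where an isometry known for norms has to be turned into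
  one for inner products.\<close>

lemma Re_ip_polarization:
  assumes "x \<in> H" "y \<in> H"
  shows "Re (ip x y) = ((nrm (x + y))\<^sup>2 - (nrm x)\<^sup>2 - (nrm y)\<^sup>2) / 2"
  using nrm_sq_add[OF assms] by simp

lemma Im_ip_polarization:
  assumes "x \<in> H" "y \<in> H"
  shows "Im (ip x y) = ((nrm (x + sc \<i> y))\<^sup>2 - (nrm x)\<^sup>2 - (nrm y)\<^sup>2) / 2"
  using nrm_sq_add[OF assms(1) sc_mem[OF assms(2)], of \<i>] assms
  by (simp add: nrm_sq_sc ip_sc_right)

lemma Cauchy_Schwarz:
  assumes "x \<in> H" "y \<in> H"
  shows "cmod (ip x y) \<le> nrm x * nrm y"
proof -
  define c where "c = ip x y"
  have quad: "0 \<le> (nrm x)\<^sup>2 - 2 * t * (cmod c)\<^sup>2 + t\<^sup>2 * (cmod c)\<^sup>2 * (nrm y)\<^sup>2" for t :: real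
  proof -
    have "Re (ip x (sc (of_real (- t) * c) y)) = - t * (cmod c)\<^sup>2"
    proof -
      have "ip x (sc (of_real (- t) * c) y) = of_real (- t) * (c * cnj c)"
        using assms by (simp add: ip_sc_right c_def)
      then show ?thesis
        by (simp add: complex_norm_square[symmetric])
    qed
    then have "(nrm (x + sc (of_real (- t) * c) y))\<^sup>2
        = (nrm x)\<^sup>2 + (t * cmod c)\<^sup>2 * (nrm y)\<^sup>2 - 2 * t * (cmod c)\<^sup>2"
      using assms by (simp add: nrm_sq_add sc_mem nrm_sq_sc norm_mult power_mult_distrib)
    moreover have "0 \<le> (nrm (x + sc (of_real (- t) * c) y))\<^sup>2"
      by simp
    ultimately show ?thesis
      by (simp add: power_mult_distrib)
  qed
  have "(cmod c)\<^sup>2 \<le> (nrm x)\<^sup>2 * (nrm y)\<^sup>2"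
  proof (cases "nrm y = 0")
    case True
    have "cmod c = 0"
    proof (rule ccontr)
      assume "cmod c \<noteq> 0"
      \<comment> \<open>With \<open>nrm y = 0\<close> the quadratic is linear in t, and this t gives
        it the value -1.\<close>
      then show False
        using quad[of "((nrm x)\<^sup>2 + 1) / (2 * (cmod c)\<^sup>2)"] True by simp
    qed
    then show ?thesis by simp
  next
    case False
    \<comment> \<open>The value of t used here minimises the quadratic.\<close>
    then show ?thesis
      using quad[of "1 / (nrm y)\<^sup>2"]
      by (simp add: field_simps power2_eq_square zero_le_divide_iff mult_le_0_iff not_less[symmetric] flip: power2_eq_square)
  qed
  then show ?thesis
    using assms nrm_nonneg by (simp add: c_def power_mult_distrib[symmetric] abs_le_square_iff[symmetric])
qed

lemma nrm_triangle:
  assumes "x \<in> H" "y \<in> H"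
  shows "nrm (x + y) \<le> nrm x + nrm y"
proof (rule power2_le_imp_le)
  show "(nrm (x + y))\<^sup>2 \<le> (nrm x + nrm y)\<^sup>2"
    using Cauchy_Schwarz[OF assms] complex_Re_le_cmod[of "ip x y"] assms
    by (simp add: nrm_sq_add power2_sum)
qed (use assms nrm_nonneg in auto)

lemma nrm_triangle_diff:
  assumes "x \<in> H" "y \<in> H" "z \<in> H"
  shows "nrm (x - z) \<le> nrm (x - y) + nrm (y - z)"
  using nrm_triangle[of "x - y" "y - z"] assms by (simp add: diff_mem)

lemma nrm_diff_ge:
  assumes "x \<in> H" "y \<in> H"
  shows "nrm y - nrm x \<le> nrm (x - y)"
  using nrm_triangle[of "y - x" x] assms by (simp add: diff_mem nrm_diff_commute)

lemma nrm_sum_le: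
  assumes "\<And>i. i \<in> A \<Longrightarrow> f i \<in> H"
  shows "nrm (sum f A) \<le> (\<Sum>i\<in>A. nrm (f i))"
  using assms
proof (induction A rule: infinite_finite_induct)
  case (insert a A)
  then show ?case
    using nrm_triangle[of "f a" "sum f A"] by (simp add: sum_mem)
qed (simp_all add: nrm_zero)

section \<open>Passing from a dense subset to the whole space\<close>

definition nrm_dense :: "'h set \<Rightarrow> bool" where
  "nrm_dense D \<longleftrightarrow> D \<subseteq> H \<and> (\<forall>x\<in>H. \<forall>\<epsilon>>0. \<exists>d\<in>D. nrm (x - d) < \<epsilon>)"

text \<open>For finite J both sides are continuous in the vector, so the bound survives the limit
  along a sequence in D. It is wanted on all of H because it is later applied to differences
  \<open>d - x\<close>, which need not lie in D.\<close>

lemma Bessel_dense: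
  assumes D: "nrm_dense D" and F: "\<And>i. i \<in> J \<Longrightarrow> F i \<in> H" and "finite J"
    and bd: "\<And>d. d \<in> D \<Longrightarrow> (\<Sum>i\<in>J. (cmod (ip d (F i)))\<^sup>2) \<le> (nrm d)\<^sup>2"
    and x: "x \<in> H"
  shows "(\<Sum>i\<in>J. (cmod (ip x (F i)))\<^sup>2) \<le> (nrm x)\<^sup>2"
proof -
  have "\<exists>d. \<forall>n::nat. d n \<in> D \<and> nrm (x - d n) < 1 / real (Suc n)"
    using D x unfolding nrm_dense_def by (intro choice allI) (simp add: Bex_def)
  then obtain d where d: "\<And>n. d n \<in> D" "\<And>n::nat. nrm (x - d n) < 1 / real (Suc n)"
    by blast
  have dH: "d n \<in> H" for n
    using d(1) D by (auto simp: nrm_dense_def)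
  have lim0: "(\<lambda>n. nrm (x - d n)) \<longlonglongrightarrow> 0"
    using d(2) x dH
    by (intro tendsto_sandwich[OF _ _ tendsto_const lim_1_over_n[THEN LIMSEQ_Suc]])
       (auto simp: nrm_nonneg diff_mem intro!: always_eventually less_imp_le)
  have "(\<lambda>n. ip (d n) (F i)) \<longlonglongrightarrow> ip x (F i)" if "i \<in> J" for i
  proof (rule LIM_zero_cancel, rule Lim_null_comparison)
    show "\<forall>\<^sub>F n in sequentially. norm (ip (d n) (F i) - ip x (F i)) \<le> nrm (x - d n) * nrm (F i)"
      using Cauchy_Schwarz[of "d _ - x" "F i"] x dH F[OF that]
      by (auto simp: ip_diff_left diff_mem nrm_diff_commute[of x])
    show "(\<lambda>n. nrm (x - d n) * nrm (F i)) \<longlonglongrightarrow> 0"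
      using tendsto_mult_right[OF lim0, of "nrm (F i)"] by simp
  qed
  then have 1: "(\<lambda>n. \<Sum>i\<in>J. (cmod (ip (d n) (F i)))\<^sup>2) \<longlonglongrightarrow> (\<Sum>i\<in>J. (cmod (ip x (F i)))\<^sup>2)"
    by (intro tendsto_intros)
  have "(\<lambda>n. nrm (d n)) \<longlonglongrightarrow> nrm x"
  proof (rule LIM_zero_cancel, rule Lim_null_comparison[OF _ lim0])
    show "\<forall>\<^sub>F n in sequentially. norm (nrm (d n) - nrm x) \<le> nrm (x - d n)"
      using nrm_diff_ge[of x "d _"] nrm_diff_ge[of "d _" x] x dH
      by (auto simp: nrm_diff_commute[of x] abs_le_iff)
  qed
  then have 2: "(\<lambda>n. (nrm (d n))\<^sup>2) \<longlonglongrightarrow> (nrm x)\<^sup>2"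
    by (intro tendsto_intros)
  show ?thesis
    using bd[OF d(1)] by (intro LIMSEQ_le[OF 1 2]) auto
qed

text \<open>The Bessel bound makes the map from vectors to coefficient families a contraction into
  the square-summable families. This bounds the sum above by the squared norm of x, and it makes the
  cost of replacing x by a nearby d in D at most \<open>nrm (d - x)\<close>, so the identity at d
  yields the reverse inequality.\<close>

lemma parseval_frame_dense:
  assumes D: "nrm_dense D" and F: "\<And>i. i \<in> I \<Longrightarrow> F i \<in> H" and I: "countable I"
    and pars: "\<And>d. d \<in> D \<Longrightarrow> ((\<lambda>i. (cmod (ip d (F i)))\<^sup>2) has_sum Re (ip d d)) I"
  shows "parseval_frame H ip I F"
proof -
  have DH: "d \<in> H" if "d \<in> D" for d
    using D that by (auto simp: nrm_dense_def)
  have bess: "(\<Sum>i\<in>J. (cmod (ip x (F i)))\<^sup>2) \<le> (nrm x)\<^sup>2" if J: "finite J" "J \<subseteq> I" and x: "x \<in> H" for J x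
  proof (rule Bessel_dense[OF D _ J(1) _ x])
    show "(\<Sum>i\<in>J. (cmod (ip d (F i)))\<^sup>2) \<le> (nrm d)\<^sup>2" if "d \<in> D" for d
      using finite_sum_le_has_sum[OF pars[OF that] J] DH[OF that] by (simp add: nrm_sq)
  qed (use F J in auto)
  have "((\<lambda>i. (cmod (ip x (F i)))\<^sup>2) has_sum (nrm x)\<^sup>2) I" if x: "x \<in> H" for x
  proof -
    define f where "f = (\<lambda>i. (cmod (ip x (F i)))\<^sup>2)"
    have f0: "0 \<le> f i" for i by (simp add: f_def)
    have summ: "f summable_on I"
      using bess x by (intro nonneg_bdd_above_summable_on bdd_aboveI2) (auto simp: f_def)
    have le: "infsum f I \<le> (nrm x)\<^sup>2"
      using bess x summ by (intro infsum_le_finite_sums) (auto simp: f_def)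
    have "nrm x \<le> sqrt (infsum f I) + \<epsilon>" if e: "0 < \<epsilon>" for \<epsilon>
    proof -
      \<comment> \<open>Three errors of a third of epsilon: from x to d in the norm, from I to a
        finite J at d, and from d back to x in the coefficients over J.\<close>
      obtain d where d: "d \<in> D" "nrm (x - d) < \<epsilon> / 3"
        using D x e unfolding nrm_dense_def by (metis divide_pos_pos zero_less_numeral)
      have dH: "d \<in> H" using DH d by blast
      define g where "g = (\<lambda>i. (cmod (ip d (F i)))\<^sup>2)"
      have g: "(g has_sum (nrm d)\<^sup>2) I"
        using pars[OF d(1)] dH by (simp add: g_def nrm_sq)
      have "\<exists>J. finite J \<and> J \<subseteq> I \<and> nrm d - \<epsilon> / 3 < sqrt (sum g J)"
      proof -
        have "(sum g \<longlongrightarrow> (nrm d)\<^sup>2) (finite_subsets_at_top I)"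
          using g by (simp add: has_sum_def)
        then have "((\<lambda>J. sqrt (sum g J)) \<longlongrightarrow> sqrt ((nrm d)\<^sup>2)) (finite_subsets_at_top I)"
          by (intro tendsto_intros)
        then have "((\<lambda>J. sqrt (sum g J)) \<longlongrightarrow> nrm d) (finite_subsets_at_top I)"
          using dH by (simp add: nrm_nonneg)
        then have "\<forall>\<^sub>F J in finite_subsets_at_top I. nrm d - \<epsilon> / 3 < sqrt (sum g J)"
          using e by (intro order_tendstoD(1)) auto
        then show ?thesis
          unfolding eventually_finite_subsets_at_top by blast
      qed
      then obtain J where J: "finite J" "J \<subseteq> I" "nrm d - \<epsilon> / 3 < sqrt (sum g J)"
        by blast
      have "sqrt (sum g J) = L2_set (\<lambda>i. cmod (ip d (F i))) J"
        by (simp add: L2_set_def g_def)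
      also have "\<dots> \<le> L2_set (\<lambda>i. cmod (ip x (F i)) + cmod (ip (d - x) (F i))) J"
      proof (rule L2_set_mono)
        fix i assume "i \<in> J"
        then have "ip d (F i) = ip x (F i) + ip (d - x) (F i)"
          using F J(2) dH x by (auto simp: ip_diff_left)
        then show "cmod (ip d (F i)) \<le> cmod (ip x (F i)) + cmod (ip (d - x) (F i))"
          by (simp add: norm_triangle_ineq)
      qed simp
      also have "\<dots> \<le> L2_set (\<lambda>i. cmod (ip x (F i))) J + L2_set (\<lambda>i. cmod (ip (d - x) (F i))) J"
        by (rule L2_set_triangle_ineq)
      also have "L2_set (\<lambda>i. cmod (ip x (F i))) J \<le> sqrt (infsum f I)"
        unfolding L2_set_def using finite_sum_le_infsum[OF summ J(1,2)] f0 by (simp add: f_def)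
      also have "L2_set (\<lambda>i. cmod (ip (d - x) (F i))) J \<le> nrm (d - x)"
        unfolding L2_set_def using bess[OF J(1,2), of "d - x"] dH x
        by (intro real_le_lsqrt) (auto simp: nrm_nonneg diff_mem intro: sum_nonneg)
      finally have "sqrt (sum g J) \<le> sqrt (infsum f I) + nrm (d - x)" by simp
      moreover have "nrm x - nrm d \<le> nrm (d - x)"
        using nrm_diff_ge[of d x] dH x by simp
      moreover have "nrm (d - x) < \<epsilon> / 3"
        using d dH x by (simp add: nrm_diff_commute)
      ultimately show ?thesis using J(3) by linarith
    qed
    then have "nrm x \<le> sqrt (infsum f I)"
      by (rule field_le_epsilon)
    then have "(nrm x)\<^sup>2 \<le> infsum f I"
      using x infsum_nonneg[of I f] f0
      by (metis nrm_nonneg power_mono real_sqrt_pow2)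
    with le have "infsum f I = (nrm x)\<^sup>2" by simp
    then show ?thesis
      using summ unfolding f_def[symmetric] by (metis has_sum_infsum)
  qed
  then show ?thesis
    using I F by (auto simp: parseval_frame_def nrm_sq)
qed

end

section \<open>Orthonormal sequences\<close>

locale orthonormal_sequence = semi_inner +
  fixes e :: "nat \<Rightarrow> 'a"
  assumes e_mem: "e n \<in> H"
    and e_ip: "ip (e m) (e n) = (if m = n then 1 else 0)"
begin

definition psum :: "'a \<Rightarrow> nat \<Rightarrow> 'a" where
  "psum x N = (\<Sum>n<N. sc (ip x (e n)) (e n))"

lemma lincomb_mem: "(\<Sum>n<N. sc (c n) (e n)) \<in> H"
  by (intro sum_mem sc_mem e_mem)

lemma psum_mem: "psum x N \<in> H"
  unfolding psum_def by (rule lincomb_mem)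

lemma ip_lincomb_e: "ip (\<Sum>n<N. sc (c n) (e n)) (e k) = (if k < N then c k else 0)"
  by (simp add: ip_sum_left sc_mem e_mem ip_sc_left e_ip if_distrib cong: if_cong)

lemma ip_lincomb_right:
  assumes "x \<in> H"
  shows "ip (\<Sum>n<N. sc (c n) (e n)) x = (\<Sum>n<N. c n * ip (e n) x)"
  using assms by (simp add: ip_sum_left sc_mem e_mem ip_sc_left)

lemma nrm_sq_lincomb: "(nrm (\<Sum>n<N. sc (c n) (e n)))\<^sup>2 = (\<Sum>n<N. (cmod (c n))\<^sup>2)"
proof -
  define s where "s = (\<Sum>n<N. sc (c n) (e n))"
  have sH: "s \<in> H" unfolding s_def by (rule lincomb_mem)
  have "ip s s = (\<Sum>n<N. c n * ip (e n) s)"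
    using ip_lincomb_right[OF sH, where c = c and N = N] unfolding s_def .
  also have "\<dots> = (\<Sum>n<N. c n * cnj (c n))"
  proof (intro sum.cong refl)
    fix n assume "n \<in> {..<N}"
    then have "ip s (e n) = c n" unfolding s_def by (simp add: ip_lincomb_e)
    then show "c n * ip (e n) s = c n * cnj (c n)"
      using ip_cnj[OF sH e_mem[of n]] by simp
  qed
  also have "\<dots> = of_real (\<Sum>n<N. (cmod (c n))\<^sup>2)"
    by (simp add: complex_norm_square[symmetric])
  finally show ?thesis
    using sH unfolding s_def by (simp add: nrm_sq)
qed

lemma residual_nrm_sq:
  assumes x: "x \<in> H"
  shows "(nrm (x - psum x N))\<^sup>2 = (nrm x)\<^sup>2 - (\<Sum>n<N. (cmod (ip x (e n)))\<^sup>2)"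
proof -
  have "ip (psum x N) (x - psum x N) = 0"
  proof -
    have "ip (psum x N) (x - psum x N) = (\<Sum>n<N. ip x (e n) * ip (e n) (x - psum x N))"
      unfolding psum_def[of x N]
      by (rule ip_lincomb_right) (simp add: diff_mem x lincomb_mem)
    also have "\<dots> = 0"
    proof (intro sum.neutral ballI)
      fix n assume "n \<in> {..<N}"
      then have "ip (x - psum x N) (e n) = 0"
        using x by (simp add: ip_diff_left psum_mem e_mem) (simp add: psum_def ip_lincomb_e)
      then show "ip x (e n) * ip (e n) (x - psum x N) = 0"
        using ip_cnj[OF diff_mem[OF x psum_mem] e_mem, of x N n] by simp
    qed
    finally show ?thesis .
  qed
  then have "(nrm x)\<^sup>2 = (nrm (psum x N))\<^sup>2 + (nrm (x - psum x N))\<^sup>2"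
    using nrm_sq_add[OF psum_mem diff_mem[OF x psum_mem], of x N x N] by simp
  moreover have "(nrm (psum x N))\<^sup>2 = (\<Sum>n<N. (cmod (ip x (e n)))\<^sup>2)"
    unfolding psum_def by (rule nrm_sq_lincomb)
  ultimately show ?thesis by simp
qed

lemma Bessel:
  assumes x: "x \<in> H"
  shows "(\<Sum>n<N. (cmod (ip x (e n)))\<^sup>2) \<le> (nrm x)\<^sup>2"
  using residual_nrm_sq[OF x, of N] zero_le_power2[of "nrm (x - psum x N)"] by linarith

lemma Bessel_summable:
  assumes x: "x \<in> H"
  shows "summable (\<lambda>n. (cmod (ip x (e n)))\<^sup>2)"
  using Bessel[OF x] by (intro summableI_nonneg_bounded[of _ "(nrm x)\<^sup>2"]) auto

end

text \<open>Completeness is stated for sequences whose steps have squared norm at most 4^-n: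
  \<open>L2_complete\<close> delivers this form, and the partial sums of an expansion can be thinned
  out to satisfy it. Totality can only conclude \<open>nrm x = 0\<close>, as the form is
  semidefinite.\<close>

locale orthonormal_basis = orthonormal_sequence +
  assumes total: "x \<in> H \<Longrightarrow> (\<And>n. ip x (e n) = 0) \<Longrightarrow> nrm x = 0"
    and complete: "(\<And>n. X n \<in> H) \<Longrightarrow> (\<And>n::nat. (nrm (X (Suc n) - X n))\<^sup>2 \<le> (1/4)^n) \<Longrightarrow>
      \<exists>x\<in>H. (\<lambda>n. nrm (X n - x)) \<longlonglongrightarrow> 0"
begin

text \<open>A thinned-out sequence of partial sums converges to some y by completeness. All
  coefficients of x - y vanish, so y has distance 0 from x; as the residuals decrease with the
  number of terms, the full sequence of partial sums converges too.\<close>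

lemma psum_tendsto:
  assumes x: "x \<in> H"
  shows "(\<lambda>N. nrm (x - psum x N)) \<longlonglongrightarrow> 0"
proof -
  define a where "a = (\<lambda>n. (cmod (ip x (e n)))\<^sup>2)"
  have a: "summable a" unfolding a_def by (rule Bessel_summable[OF x])
  have tail: "\<exists>N. \<forall>n. (\<Sum>i\<in>{N..<n}. a i) \<le> (1/4)^k" for k :: nat
    using suminf_exist_split[OF _ a, of "(1/4)^k"]
  proof -
    have "\<exists>N. \<forall>m\<ge>N. \<forall>n. norm (\<Sum>i\<in>{m..<n}. a i) < (1/4)^k"
      using a unfolding summable_Cauchy by (simp add: power_one_over)
    then show ?thesis by (metis abs_le_D1 less_imp_le order_refl real_norm_def)
  qed
  then obtain M where M: "\<And>k n. (\<Sum>i\<in>{M k..<n}. a i) \<le> (1/4)^k" by metis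
  \<comment> \<open>Summing all M j up to k makes N monotone and at least M k; the summand k sends N
    k to infinity, so every coefficient eventually enters X k.\<close>
  define N where "N = (\<lambda>k. k + (\<Sum>j\<le>k. M j))"
  have NM: "M k \<le> N k" for k
    unfolding N_def by (intro trans_le_add2 member_le_sum) auto
  have Nk: "k \<le> N k" for k by (simp add: N_def)
  have NS: "N k \<le> N (Suc k)" for k by (simp add: N_def)
  define X where "X = (\<lambda>k. psum x (N k))"
  have "\<exists>y\<in>H. (\<lambda>n. nrm (X n - y)) \<longlonglongrightarrow> 0"
  proof (rule complete)
    show "X n \<in> H" for n by (simp add: X_def psum_mem)
    show "(nrm (X (Suc k) - X k))\<^sup>2 \<le> (1/4)^k" for k
    proof -
      \<comment> \<open>Padding with zeros turns the block between N k and N (Suc k) into an initial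
        segment, the shape of \<open>nrm_sq_lincomb\<close>.\<close>
      define c where "c = (\<lambda>n. if n < N k then 0 else ip x (e n))"
      have "X (Suc k) - X k = (\<Sum>n\<in>{N k..<N (Suc k)}. sc (ip x (e n)) (e n))"
        unfolding X_def psum_def lessThan_atLeast0 using NS[of k]
        by (simp add: sum_diff_nat_ivl)
      also have "\<dots> = (\<Sum>n\<in>{N k..<N (Suc k)}. sc (c n) (e n))"
        by (intro sum.cong) (auto simp: c_def)
      also have "\<dots> = (\<Sum>n<N (Suc k). sc (c n) (e n))"
        by (intro sum.mono_neutral_left) (auto simp: c_def sc_zero)
      finally have "(nrm (X (Suc k) - X k))\<^sup>2 = (\<Sum>n<N (Suc k). (cmod (c n))\<^sup>2)"
        by (simp add: nrm_sq_lincomb)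
      also have "\<dots> = (\<Sum>n\<in>{N k..<N (Suc k)}. a n)"
        by (intro sum.mono_neutral_cong_right) (auto simp: c_def a_def)
      also have "\<dots> \<le> (\<Sum>n\<in>{M k..<N (Suc k)}. a n)"
        using NM[of k] by (intro sum_mono2) (auto simp: a_def)
      also have "\<dots> \<le> (1/4)^k" by (rule M)
      finally show ?thesis .
    qed
  qed
  then obtain y where y: "y \<in> H" and lim: "(\<lambda>n. nrm (X n - y)) \<longlonglongrightarrow> 0" by blast
  have XH: "X n \<in> H" for n by (simp add: X_def psum_mem)
  have "ip (x - y) (e n) = 0" for n
  proof -
    have en: "nrm (e n) = 1"
      by (simp add: nrm_def e_ip)
    have "(\<lambda>k. ip (X k - y) (e n)) \<longlonglongrightarrow> 0"
      using Cauchy_Schwarz[of "X _ - y" "e n"] XH y en e_mem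
      by (intro Lim_null_comparison[OF _ lim]) (auto simp: diff_mem)
    moreover have "\<forall>\<^sub>F k in sequentially. ip (X k - y) (e n) = ip (x - y) (e n)"
      using eventually_gt_at_top[of n]
    proof eventually_elim
      case (elim k)
      then have "n < N k" using Nk[of k] by simp
      then have "ip (X k) (e n) = ip x (e n)"
        unfolding X_def psum_def by (simp add: ip_lincomb_e)
      then show ?case using XH x y e_mem by (simp add: ip_diff_left)
    qed
    ultimately have "(\<lambda>k. ip (x - y) (e n)) \<longlonglongrightarrow> 0"
      using tendsto_cong by force
    then show ?thesis by (simp add: LIMSEQ_const_iff)
  qed
  then have xy: "nrm (x - y) = 0"
    using total x y by (simp add: diff_mem)
  have resid: "(\<lambda>k. nrm (x - X k)) \<longlonglongrightarrow> 0"
  proof (rule Lim_null_comparison[OF _ lim])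
    show "\<forall>\<^sub>F k in sequentially. norm (nrm (x - X k)) \<le> nrm (X k - y)"
      using nrm_triangle_diff[OF x y XH] xy x y XH
      by (auto simp: nrm_nonneg diff_mem nrm_diff_commute[of y])
  qed
  have mono: "nrm (x - psum x n) \<le> nrm (x - psum x m)" if "m \<le> n" for m n
  proof (rule power2_le_imp_le)
    show "(nrm (x - psum x n))\<^sup>2 \<le> (nrm (x - psum x m))\<^sup>2"
      using that by (auto simp: residual_nrm_sq[OF x] intro!: sum_mono2)
  qed (simp add: nrm_nonneg diff_mem x psum_mem)
  show ?thesis
  proof (rule LIMSEQ_I)
    fix r :: real assume "0 < r"
    then obtain k where "nrm (x - X k) < r"
      using order_tendstoD(2)[OF resid, of r] by (auto simp: eventually_sequentially)
    then show "\<exists>no. \<forall>n\<ge>no. norm (nrm (x - psum x n) - 0) < r"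
      using mono[of "N k"] x unfolding X_def
      by (intro exI[of _ "N k"]) (auto simp: nrm_nonneg diff_mem psum_mem intro: order_le_less_trans)
  qed
qed

lemma Parseval_sums:
  assumes x: "x \<in> H"
  shows "(\<lambda>n. (cmod (ip x (e n)))\<^sup>2) sums (nrm x)\<^sup>2"
proof -
  have "(\<lambda>N. (nrm x)\<^sup>2 - (nrm (x - psum x N))\<^sup>2) \<longlonglongrightarrow> (nrm x)\<^sup>2 - 0\<^sup>2"
    by (intro tendsto_intros psum_tendsto x)
  then show ?thesis
    by (simp add: sums_def residual_nrm_sq[OF x])
qed

text \<open>The witnesses are the finite linear combinations of basis vectors with coefficients in a
  countable dense set of complex numbers, coded by lists.\<close>

lemma countable_dense:
  "\<exists>D. countable D \<and> nrm_dense D"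
proof -
  obtain Q :: "complex set" where Q: "countable Q" "\<And>X. open X \<Longrightarrow> X \<noteq> {} \<Longrightarrow> \<exists>d\<in>Q. d \<in> X"
    using countable_dense_setE by blast
  define D where "D = (\<lambda>qs. \<Sum>n<length qs. sc (qs ! n) (e n)) ` lists Q"
  have "countable D" unfolding D_def using Q(1) by auto
  moreover have "nrm_dense D"
    unfolding nrm_dense_def
  proof (intro conjI ballI allI impI)
    show "D \<subseteq> H" by (auto simp: D_def intro: lincomb_mem)
    fix x and r :: real assume x: "x \<in> H" and r: "0 < r"
    obtain N where N: "nrm (x - psum x N) < r / 2"
      using order_tendstoD(2)[OF psum_tendsto[OF x], of "r/2"] r
      by (auto simp: eventually_sequentially)
    \<comment> \<open>N coefficient errors have to add up to at most r / 2. The 1 added to N keeps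
      the radius positive for N = 0, where division by 0 would give 0.\<close>
    have "\<exists>q\<in>Q. q \<in> ball (ip x (e n)) (r / (2 * (real N + 1)))" for n
      using r by (intro Q(2)) (auto simp: not_le simp del: distrib_left_numeral)
    then obtain q where q: "\<And>n. q n \<in> Q" "\<And>n. cmod (ip x (e n) - q n) < r / (2 * (real N + 1))"
      by (auto simp: dist_norm) metis
    define d where "d = (\<Sum>n<N. sc (q n) (e n))"
    have dD: "d \<in> D"
      unfolding D_def d_def using q(1)
      by (intro image_eqI[of _ _ "map q [0..<N]"]) auto
    have dH: "d \<in> H" unfolding d_def by (rule lincomb_mem)
    have "(nrm (psum x N - d)) \<le> (\<Sum>n<N. cmod (ip x (e n) - q n))"
    proof -
      have "psum x N - d = (\<Sum>n<N. sc (ip x (e n)) (e n) - sc (q n) (e n))"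
        by (simp add: psum_def d_def sum_subtractf)
      also have "nrm \<dots> \<le> (\<Sum>n<N. nrm (sc (ip x (e n)) (e n) - sc (q n) (e n)))"
        by (intro nrm_sum_le diff_mem sc_mem e_mem)
      also have "\<dots> = (\<Sum>n<N. cmod (ip x (e n) - q n))"
      proof (intro sum.cong refl)
        fix n
        have "ip (sc a (e n) - sc b (e n)) (sc a (e n) - sc b (e n)) = (a - b) * cnj (a - b)" for a b
          by (simp add: ip_diff_left ip_diff_right sc_mem diff_mem e_mem ip_sc_left ip_sc_right e_ip algebra_simps)
        then show "nrm (sc (ip x (e n)) (e n) - sc (q n) (e n)) = cmod (ip x (e n) - q n)"
          by (simp only: nrm_def complex_norm_square[symmetric]) simp
      qed
      finally show ?thesis .
    qed
    also have "\<dots> \<le> (\<Sum>n<N. r / (2 * (real N + 1)))"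
      using q(2) by (intro sum_mono less_imp_le) auto
    also have "\<dots> \<le> r / 2"
      using r by (simp add: field_simps)
    finally have "nrm (x - d) < r"
      using N nrm_triangle_diff[OF x psum_mem dH, of x N] by linarith
    then show "\<exists>d\<in>D. nrm (x - d) < r" using dD by blast
  qed
  ultimately show ?thesis by blast
qed

end

section \<open>Square-integrable functions\<close>

lemma borel_measurable_cnj [measurable]:
  assumes "f \<in> borel_measurable M"
  shows "(\<lambda>x. cnj (f x)) \<in> borel_measurable M"
  using measurable_compose[OF assms borel_measurable_continuous_onI[of cnj]]
  by (auto intro: continuous_intros)

lemma borel_measurable_cis [measurable]:
  assumes "g \<in> borel_measurable M"
  shows "(\<lambda>t. cis (g t)) \<in> borel_measurable M"
  using assms unfolding cis_conv_exp by measurable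

lemma L2_integrable_mult:
  assumes "f \<in> L2 M" "g \<in> L2 M"
  shows "integrable M (\<lambda>x. f x * cnj (g x))"
proof (rule Bochner_Integration.integrable_bound)
  show "integrable M (\<lambda>x. (cmod (f x))\<^sup>2 + (cmod (g x))\<^sup>2)"
    using assms by (simp add: L2_def)
  show "(\<lambda>x. f x * cnj (g x)) \<in> borel_measurable M"
    using assms by (auto simp: L2_def)
  have "a * b \<le> a\<^sup>2 + b\<^sup>2" if "0 \<le> a" "0 \<le> b" for a b :: real
    using that sum_squares_bound[of a b] mult_nonneg_nonneg[OF that] by linarith
  then show "AE x in M. norm (f x * cnj (g x)) \<le> norm ((cmod (f x))\<^sup>2 + (cmod (g x))\<^sup>2)"
    by (simp add: norm_mult)
qed

lemma L2_add:
  assumes "f \<in> L2 M" "g \<in> L2 M"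
  shows "(\<lambda>x. f x + g x) \<in> L2 M"
proof -
  have "integrable M (\<lambda>x. (cmod (f x + g x))\<^sup>2)"
  proof (rule Bochner_Integration.integrable_bound)
    show "integrable M (\<lambda>x. 2 * (cmod (f x))\<^sup>2 + 2 * (cmod (g x))\<^sup>2)"
      using assms by (simp add: L2_def)
    have "(cmod (a + b))\<^sup>2 \<le> 2 * (cmod a)\<^sup>2 + 2 * (cmod b)\<^sup>2" for a b :: complex
    proof -
      have "(cmod (a + b))\<^sup>2 \<le> (cmod a + cmod b)\<^sup>2"
        by (intro power_mono norm_triangle_ineq) simp
      then show ?thesis
        using sum_squares_bound[of "cmod a" "cmod b"] by (simp add: power2_sum)
    qed
    then show "AE x in M. norm ((cmod (f x + g x))\<^sup>2) \<le> norm (2 * (cmod (f x))\<^sup>2 + 2 * (cmod (g x))\<^sup>2)"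
      by simp
  qed (use assms in \<open>auto simp: L2_def\<close>)
  then show ?thesis
    using assms by (auto simp: L2_def)
qed

lemma L2_scale:
  assumes "f \<in> L2 M"
  shows "(\<lambda>x. c * f x) \<in> L2 M"
  using assms by (auto simp: L2_def norm_mult power_mult_distrib)

lemma semi_inner_L2: "semi_inner (L2 M) (\<lambda>c f x. c * f x) (L2_inner M)"
proof
  fix f g h :: "'a \<Rightarrow> complex" and c :: complex
  show "0 \<in> L2 M"
    by (simp add: L2_def zero_fun_def)
  show "f + g \<in> L2 M" if "f \<in> L2 M" "g \<in> L2 M"
    using L2_add[OF that] by (simp add: plus_fun_def)
  show "(\<lambda>x. c * f x) \<in> L2 M" if "f \<in> L2 M"
    using that by (rule L2_scale)
  show "(\<lambda>x. 0 * f x) = 0" "(\<lambda>x. - 1 * f x) = - f"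
    by (auto simp: fun_eq_iff)
  show "L2_inner M (f + g) h = L2_inner M f h + L2_inner M g h"
    if "f \<in> L2 M" "g \<in> L2 M" "h \<in> L2 M"
    using L2_integrable_mult[OF that(1,3)] L2_integrable_mult[OF that(2,3)]
    by (simp add: L2_inner_def distrib_right)
  show "L2_inner M (\<lambda>x. c * f x) h = c * L2_inner M f h"
    by (simp add: L2_inner_def mult.assoc)
  show "cnj (L2_inner M f g) = L2_inner M g f"
    by (simp add: L2_inner_def mult.commute flip: Bochner_Integration.integral_cnj)
  show "0 \<le> Re (L2_inner M f f)"
    by (simp add: L2_inner_def flip: complex_norm_square of_real_power)
qed

interpretation L2sp: semi_inner "L2 M" "\<lambda>c f x. c * f x" "L2_inner M" for M
  by (rule semi_inner_L2)

lemma L2_inner_self: "L2_inner M f f = of_real (\<integral>x. (cmod (f x))\<^sup>2 \<partial>M)"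
  by (simp add: L2_inner_def flip: complex_norm_square of_real_power)

lemma L2sp_nrm: "L2sp.nrm M f = L2_norm M f"
  by (simp add: L2sp.nrm_def L2_norm_def L2_inner_self)

lemma L2_norm_sq: "(L2_norm M f)\<^sup>2 = (\<integral>x. (cmod (f x))\<^sup>2 \<partial>M)"
  by (simp add: L2_norm_def)

lemma L2_norm_nonneg [simp]: "0 \<le> L2_norm M f"
  by (simp add: L2_norm_def)

lemma L2_norm_eq_0_imp_AE:
  assumes "f \<in> L2 M" "L2_norm M f = 0"
  shows "AE x in M. f x = 0"
proof -
  have "(\<integral>x. (cmod (f x))\<^sup>2 \<partial>M) = 0"
    using assms(2) by (simp add: L2_norm_def)
  then have "AE x in M. (cmod (f x))\<^sup>2 = 0"
    using assms(1) by (subst (asm) integral_nonneg_eq_0_iff_AE) (auto simp: L2_def)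
  then show ?thesis by simp
qed

lemma L2_norm_cong_AE:
  assumes "f \<in> L2 M" "g \<in> L2 M" "AE x in M. g x = f x"
  shows "L2_norm M g = L2_norm M f"
proof -
  have "(\<integral>x. (cmod (g x))\<^sup>2 \<partial>M) = (\<integral>x. (cmod (f x))\<^sup>2 \<partial>M)"
    using assms by (intro integral_cong_AE) (auto simp: L2_def)
  then show ?thesis by (simp add: L2_norm_def)
qed

lemma L2_inner_cong_AE:
  assumes "f \<in> L2 M" "f' \<in> L2 M" "g \<in> L2 M" "g' \<in> L2 M"
    and "AE x in M. f x = f' x" "AE x in M. g x = g' x"
  shows "L2_inner M f g = L2_inner M f' g'"
  unfolding L2_inner_def using assms
  by (intro integral_cong_AE) (auto simp: L2_def)

text \<open>Riesz--Fischer. With \<open>d n = X (n + 1) - X n\<close>, the Cauchy-Schwarz inequality with the weights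
  \<open>2 ^ n\<close> bounds the square of every tail of \<open>\<Sum>n. \<bar>d n\<bar>\<close> by the integrable function
  \<open>\<Sum>n. 2 ^ n * \<bar>d n\<bar>\<^sup>2\<close>.\<close>

lemma weighted_Cauchy_Schwarz:
  fixes d :: "nat \<Rightarrow> complex"
  assumes s: "summable (\<lambda>n. 2 ^ n * (cmod (d n))\<^sup>2)"
  shows "(cmod (\<Sum>i\<in>{m..<n}. d i))\<^sup>2 \<le> 2 * (1/2) ^ m * (\<Sum>n. 2 ^ n * (cmod (d n))\<^sup>2)"
proof -
  have "(cmod (\<Sum>i\<in>{m..<n}. d i))\<^sup>2 \<le> (\<Sum>i\<in>{m..<n}. cmod (d i))\<^sup>2"
    by (intro power_mono norm_sum) simp
  also have "\<dots> = (\<Sum>i\<in>{m..<n}. sqrt ((1/2)^i) * (sqrt (2^i) * cmod (d i)))\<^sup>2"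
    by (simp add: mult.assoc[symmetric] flip: real_sqrt_mult power_mult_distrib)
  also have "\<dots> \<le> (\<Sum>i\<in>{m..<n}. (sqrt ((1/2)^i))\<^sup>2) * (\<Sum>i\<in>{m..<n}. (sqrt (2^i) * cmod (d i))\<^sup>2)"
    by (rule Cauchy_Schwarz_ineq_sum)
  also have "\<dots> = (\<Sum>i\<in>{m..<n}. (1/2)^i) * (\<Sum>i\<in>{m..<n}. 2^i * (cmod (d i))\<^sup>2)"
    by (simp add: power_mult_distrib)
  also have "\<dots> \<le> (2 * (1/2)^m) * (\<Sum>n. 2 ^ n * (cmod (d n))\<^sup>2)"
  proof (intro mult_mono)
    have "(\<Sum>i\<in>{m..<n}. (1/2)^i) \<le> (2::real) * (1/2)^m"
    proof (cases "m \<le> n")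
      case True
      have "(\<Sum>i\<in>{m..<n}. (1/2)^i) = (2::real) * ((1/2)^m - (1/2)^n)"
        using True by (induction n rule: dec_induct) (simp_all add: right_diff_distrib)
      then show ?thesis by simp
    qed simp
    then show "(\<Sum>i\<in>{m..<n}. (1/2)^i) \<le> (2::real) * (1/2)^m" .
    show "(\<Sum>i\<in>{m..<n}. 2^i * (cmod (d i))\<^sup>2) \<le> (\<Sum>n. 2 ^ n * (cmod (d n))\<^sup>2)"
      by (intro sum_le_suminf s) auto
  qed (auto intro: sum_nonneg)
  finally show ?thesis .
qed

lemma L2_complete:
  assumes X: "\<And>n. X n \<in> L2 M"
    and fast: "\<And>n::nat. (L2_norm M (X (Suc n) - X n))\<^sup>2 \<le> (1/4)^n"
  shows "\<exists>x\<in>L2 M. (\<lambda>n. L2_norm M (X n - x)) \<longlonglongrightarrow> 0"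
proof -
  have Xm[measurable]: "X n \<in> borel_measurable M" for n
    using X by (simp add: L2_def)
  define d where "d = (\<lambda>t n. X (Suc n) t - X n t)"
  have dint: "integrable M (\<lambda>t. (cmod (d t n))\<^sup>2)" for n
    using L2sp.diff_mem[OF X[of "Suc n"] X[of n]] by (simp add: L2_def d_def)
  have dle: "(\<integral>t. (cmod (d t n))\<^sup>2 \<partial>M) \<le> (1/4)^n" for n
    using fast[of n] by (simp add: L2_norm_sq d_def)
  have si: "integrable M (\<lambda>t. 2 ^ n * (cmod (d t n))\<^sup>2)" for n
    using dint by simp
  \<comment> \<open>The bound 4^-n of the hypothesis against the weight 2^n leaves 2^-n, which is
    summable.\<close>
  have fin: "(\<Sum>n. (\<integral>\<^sup>+t. ennreal (2 ^ n * (cmod (d t n))\<^sup>2) \<partial>M)) < \<infinity>"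
  proof -
    have "(\<integral>\<^sup>+t. ennreal (2 ^ n * (cmod (d t n))\<^sup>2) \<partial>M) \<le> ennreal ((1/2)^n)" for n
    proof -
      have "(\<integral>\<^sup>+t. ennreal (2 ^ n * (cmod (d t n))\<^sup>2) \<partial>M) = ennreal (2 ^ n * (\<integral>t. (cmod (d t n))\<^sup>2 \<partial>M))"
        using si[of n] by (simp add: nn_integral_eq_integral)
      also have "\<dots> \<le> ennreal (2 ^ n * (1/4)^n)"
        by (intro ennreal_leI mult_left_mono dle) simp
      also have "(2::real) ^ n * (1/4)^n = (1/2)^n"
        by (simp flip: power_mult_distrib)
      finally show ?thesis .
    qed
    then have "(\<Sum>n. (\<integral>\<^sup>+t. ennreal (2 ^ n * (cmod (d t n))\<^sup>2) \<partial>M)) \<le> (\<Sum>n. ennreal ((1/2)^n))"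
      by (intro suminf_le) auto
    also have "\<dots> = ennreal (\<Sum>n. (1/2)^n)"
      by (intro suminf_ennreal2) auto
    finally show ?thesis by (simp add: order_le_less_trans)
  qed
  have dm[measurable]: "(\<lambda>t. d t n) \<in> borel_measurable M" for n
    unfolding d_def by measurable
  have fin': "(\<integral>\<^sup>+t. (\<Sum>n. ennreal (2 ^ n * (cmod (d t n))\<^sup>2)) \<partial>M) < \<infinity>"
    using fin by (subst nn_integral_suminf) auto
  then have "AE t in M. (\<Sum>n. ennreal (2 ^ n * (cmod (d t n))\<^sup>2)) \<noteq> \<infinity>"
    by (intro nn_integral_PInf_AE) auto
  then have aes: "AE t in M. summable (\<lambda>n. 2 ^ n * (cmod (d t n))\<^sup>2)"
    by eventually_elim (intro summable_suminf_not_top; auto)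
  define G where "G = (\<lambda>t. \<Sum>n. 2 ^ n * (cmod (d t n))\<^sup>2)"
  have Gm[measurable]: "G \<in> borel_measurable M"
    unfolding G_def by measurable
  have Gint: "integrable M G"
  proof (rule integrableI_nonneg)
    show "AE t in M. 0 \<le> G t"
      using aes by eventually_elim (auto simp: G_def intro: suminf_nonneg)
    have "(\<integral>\<^sup>+t. ennreal (G t) \<partial>M) = (\<integral>\<^sup>+t. (\<Sum>n. ennreal (2 ^ n * (cmod (d t n))\<^sup>2)) \<partial>M)"
      using aes by (intro nn_integral_cong_AE, eventually_elim)
        (auto simp: G_def suminf_ennreal2)
    then show "(\<integral>\<^sup>+t. ennreal (G t) \<partial>M) < \<infinity>" using fin' by simp
  qed simp
  \<comment> \<open>\<open>lim\<close> is total, so x is defined and measurable everywhere; that it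
    is the limit almost everywhere is part of the proof of \<open>bound\<close>.\<close>
  define x where "x = (\<lambda>t. lim (\<lambda>n. X n t))"
  have xm[measurable]: "x \<in> borel_measurable M"
    unfolding x_def by (rule borel_measurable_lim_metric) measurable
  have bound: "AE t in M. \<forall>n. (cmod (X n t - x t))\<^sup>2 \<le> 2 * (1/2)^n * G t"
    using aes
  proof eventually_elim
    case (elim t)
    have tele: "X n t - X m t = (\<Sum>i\<in>{m..<n}. d t i)" if "m \<le> n" for m n
      using that sum_Suc_diff'[of m n "\<lambda>i. X i t"] by (simp add: d_def)
    have le: "(cmod (X n t - X m t))\<^sup>2 \<le> 2 * (1/2)^m * G t" if "m \<le> n" for m n
      using weighted_Cauchy_Schwarz[OF elim, of m n] by (simp add: tele[OF that] G_def)
    have G0: "0 \<le> G t"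
      unfolding G_def by (intro suminf_nonneg elim) auto
    have "Cauchy (\<lambda>n. X n t)"
    proof (rule CauchyI')
      fix r :: real assume r: "0 < r"
      have "(\<lambda>m. 2 * (1/2)^m * G t) \<longlonglongrightarrow> 2 * 0 * G t"
        by (intro tendsto_intros LIMSEQ_realpow_zero) auto
      then have "\<forall>\<^sub>F m in sequentially. 2 * (1/2)^m * G t < r\<^sup>2"
        using r by (intro order_tendstoD(2)[of _ 0]) auto
      then obtain N where N: "\<And>m. N \<le> m \<Longrightarrow> 2 * (1/2)^m * G t < r\<^sup>2"
        by (auto simp: eventually_sequentially)
      show "\<exists>M. \<forall>m\<ge>M. \<forall>n>m. dist (X m t) (X n t) < r"
      proof (intro exI[of _ N] allI impI)
        fix m n assume "N \<le> m" "m < n"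
        then have "(cmod (X n t - X m t))\<^sup>2 < r\<^sup>2"
          using le[of m n] N[of m] by simp
        then have "cmod (X n t - X m t) < r"
          using r by (intro power2_less_imp_less[of _ r]) auto
        then show "dist (X m t) (X n t) < r"
          by (simp add: dist_norm norm_minus_commute)
      qed
    qed
    then have lim: "(\<lambda>n. X n t) \<longlonglongrightarrow> x t"
      unfolding x_def by (simp add: Cauchy_convergent_iff convergent_LIMSEQ_iff)
    show ?case
    proof
      fix m
      have "(\<lambda>n. (cmod (X n t - X m t))\<^sup>2) \<longlonglongrightarrow> (cmod (x t - X m t))\<^sup>2"
        by (intro tendsto_intros lim)
      then have "(cmod (x t - X m t))\<^sup>2 \<le> 2 * (1/2)^m * G t"
        by (rule LIMSEQ_le_const2) (use le in blast)
      then show "(cmod (X m t - x t))\<^sup>2 \<le> 2 * (1/2)^m * G t"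
        by (simp add: norm_minus_commute)
    qed
  qed
  \<comment> \<open>The squared difference is dominated by a multiple of G. Membership of x itself
    is then read off from \<open>X 0\<close> and \<open>X 0 - x\<close>.\<close>
  have diffL2: "X n - x \<in> L2 M" for n
    unfolding L2_def
  proof (intro CollectI conjI)
    show "X n - x \<in> borel_measurable M" by (simp add: fun_diff_def)
    show "integrable M (\<lambda>t. (cmod ((X n - x) t))\<^sup>2)"
      by (rule Bochner_Integration.integrable_bound[OF integrable_mult_right[OF Gint, of "2 * (1/2)^n"]])
        (use bound in \<open>auto elim!: eventually_mono simp: fun_diff_def abs_mult intro: order_trans\<close>)
  qed
  have xL2: "x \<in> L2 M"
    using L2sp.diff_mem[OF X[of 0] diffL2[of 0]] by simp
  have "(\<lambda>n. (L2_norm M (X n - x))\<^sup>2) \<longlonglongrightarrow> 0"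
  proof (rule Lim_null_comparison)
    have "(L2_norm M (X n - x))\<^sup>2 \<le> (1/2)^n * (2 * (\<integral>t. G t \<partial>M))" for n
    proof -
      have "(L2_norm M (X n - x))\<^sup>2 \<le> (\<integral>t. 2 * (1/2)^n * G t \<partial>M)"
        unfolding L2_norm_sq using diffL2[of n] Gint bound
        by (intro integral_mono_AE) (auto simp: L2_def elim!: eventually_mono)
      then show ?thesis using Gint by (simp add: mult_ac)
    qed
    then show "\<forall>\<^sub>F n in sequentially. norm ((L2_norm M (X n - x))\<^sup>2) \<le> (1/2)^n * (2 * (\<integral>t. G t \<partial>M))"
      by simp
    show "(\<lambda>n. (1/2)^n * (2 * (\<integral>t. G t \<partial>M))) \<longlonglongrightarrow> 0"
      by (intro tendsto_mult_left_zero LIMSEQ_realpow_zero) auto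
  qed
  then have "(\<lambda>n. sqrt ((L2_norm M (X n - x))\<^sup>2)) \<longlonglongrightarrow> sqrt 0"
    by (intro tendsto_intros)
  then show ?thesis using xL2 by auto
qed

lemma orthonormal_basis_L2:
  assumes "\<And>n. e n \<in> L2 M"
    and "\<And>m n. L2_inner M (e m) (e n) = (if m = n then 1 else 0)"
    and "\<And>f. f \<in> L2 M \<Longrightarrow> (\<And>n. L2_inner M f (e n) = 0) \<Longrightarrow> AE x in M. f x = 0"
  shows "orthonormal_basis (L2 M) (\<lambda>c f x. c * f x) (L2_inner M) e"
proof
  show "L2sp.nrm M f = 0" if "f \<in> L2 M" "\<And>n. L2_inner M f (e n) = 0" for f
  proof -
    have "L2_norm M f = L2_norm M (\<lambda>_. 0)"
      using assms(3)[OF that] that(1) by (intro L2_norm_cong_AE) (auto simp: L2_def)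
    then show ?thesis by (simp add: L2sp_nrm L2_norm_def)
  qed
  show "\<exists>x\<in>L2 M. (\<lambda>n. L2sp.nrm M (X n - x)) \<longlonglongrightarrow> 0"
    if "\<And>n. X n \<in> L2 M" "\<And>n::nat. (L2sp.nrm M (X (Suc n) - X n))\<^sup>2 \<le> (1 / 4) ^ n" for X
    using L2_complete[of X M] that by (simp add: L2sp_nrm)
qed (use assms in auto)

section \<open>The trigonometric basis\<close>

text \<open>A function supported in one period all of whose Fourier coefficients vanish is annihilated by
  real polynomials on the circle, hence by continuous functions (Stone--Weierstrass), hence by
  indicators of closed sets; inner regularity of Lebesgue measure then shows that it is null.\<close>

definition fourier_null :: "(real \<Rightarrow> complex) set" where
  "fourier_null = {w. integrable lborel w \<and> (\<forall>k::int. (\<integral>t. w t * cis (2 * pi * k * t) \<partial>lborel) = 0)}"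

lemma integrable_mult_cis:
  fixes w :: "'a \<Rightarrow> complex"
  assumes "integrable M w" "g \<in> borel_measurable M"
  shows "integrable M (\<lambda>t. w t * cis (g t))"
  using assms(2) borel_measurable_integrable[OF assms(1)]
  by (intro Bochner_Integration.integrable_bound[OF assms(1)]) (auto simp: norm_mult)

lemma fourier_null_cis:
  assumes "w \<in> fourier_null"
  shows "(\<lambda>t. w t * cis (2 * pi * of_int j * t)) \<in> fourier_null"
proof -
  have "(\<integral>t. w t * cis (2 * pi * of_int j * t) * cis (2 * pi * of_int k * t) \<partial>lborel)
      = (\<integral>t. w t * cis (2 * pi * of_int (j + k) * t) \<partial>lborel)" for k
    by (simp add: mult.assoc cis_mult algebra_simps)
  moreover have "(\<integral>t. w t * cis (2 * pi * of_int (j + k) * t) \<partial>lborel) = 0" for k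
    using assms unfolding fourier_null_def by blast
  ultimately show ?thesis
    using assms unfolding fourier_null_def
    by (auto intro!: integrable_mult_cis simp del: of_int_add)
qed

lemma fourier_null_add:
  assumes "v \<in> fourier_null" "w \<in> fourier_null"
  shows "(\<lambda>t. v t + w t) \<in> fourier_null"
  using assms unfolding fourier_null_def
  by (auto simp: distrib_right Bochner_Integration.integral_add integrable_mult_cis)

lemma fourier_null_scale:
  assumes "w \<in> fourier_null"
  shows "(\<lambda>t. c * w t) \<in> fourier_null"
  using assms unfolding fourier_null_def by (auto simp: mult.assoc)

text \<open>The induction keeps w general, so that a product of polynomials is handled by
  multiplying with one factor and applying the other hypothesis to the result.\<close>

lemma fourier_null_polynomial:
  assumes "real_polynomial_function p" "w \<in> fourier_null"
  shows "(\<lambda>t. w t * of_real (p (cis (2 * pi * t)))) \<in> fourier_null"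
  using assms
proof (induction p arbitrary: w rule: real_polynomial_function.induct)
  case (linear p)
  have p: "p z = Re z * p 1 + Im z * p \<i>" for z :: complex
  proof -
    have "p z = p (Re z *\<^sub>R 1 + Im z *\<^sub>R \<i>)"
      by (rule arg_cong[of _ _ p]) (simp add: complex_eq_iff)
    then show ?thesis
      using linear(1) by (simp add: linear_simps)
  qed
  \<comment> \<open>On the circle a real linear form is a combination of \<open>cis s\<close> and
    \<open>cis (- s)\<close>, and multiplication by either only shifts the Fourier
    coefficients.\<close>
  have pcis: "of_real (p (cis s)) = (of_real (p 1) - \<i> * of_real (p \<i>)) / 2 * cis s
      + (of_real (p 1) + \<i> * of_real (p \<i>)) / 2 * cis (- s)" for s
    unfolding p[of "cis s"] by (simp add: complex_eq_iff field_simps)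
  have "w t * of_real (p (cis (2 * pi * t)))
      = (of_real (p 1) - \<i> * of_real (p \<i>)) / 2 * (w t * cis (2 * pi * of_int 1 * t))
        + (of_real (p 1) + \<i> * of_real (p \<i>)) / 2 * (w t * cis (2 * pi * of_int (-1) * t))" for t
    unfolding pcis by (simp add: distrib_left mult_ac)
  then show ?case
    using linear(2) by (simp only: fourier_null_add fourier_null_scale fourier_null_cis)
next
  case (const c)
  then show ?case using fourier_null_scale[of w "of_real c"] by (simp add: mult.commute)
next
  case (add f g)
  then show ?case
    using fourier_null_add[OF add.IH[OF add.prems]] by (simp add: distrib_left)
next
  case (mult f g)
  then show ?case
    using mult.IH(2)[OF mult.IH(1)[OF mult.prems]] by (simp add: mult.assoc)
qed

lemma integrable_mult_bounded:
  fixes w b :: "'a \<Rightarrow> complex"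
  assumes "integrable M w" "b \<in> borel_measurable M" "\<And>t. cmod (b t) \<le> C"
  shows "integrable M (\<lambda>t. w t * b t)"
proof (rule Bochner_Integration.integrable_bound[OF integrable_mult_right[OF assms(1), of "of_real C"]])
  have "norm (w t * b t) \<le> norm (complex_of_real C * w t)" for t
    using assms(3)[of t] norm_ge_zero[of "b t"]
    by (simp add: norm_mult mult.commute mult_right_mono)
  then show "AE t in M. norm (w t * b t) \<le> norm (complex_of_real C * w t)" by simp
qed (use assms in auto)

lemma circle_measurable:
  fixes c :: "complex \<Rightarrow> 'b::topological_space"
  assumes "continuous_on UNIV c"
  shows "(\<lambda>t. c (cis (2 * pi * t))) \<in> borel_measurable borel"
  by (rule borel_measurable_continuous_onI)
     (intro continuous_on_compose2[OF assms] continuous_intros, auto)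

text \<open>A polynomial uniformly within epsilon of c on the circle changes the integral by at most
  epsilon times the integral of |w|, and the integral against the polynomial is the zeroth Fourier
  coefficient of a member of \<open>fourier_null\<close>.\<close>

lemma fourier_null_continuous:
  assumes w: "w \<in> fourier_null" and c: "continuous_on UNIV c"
  shows "(\<integral>t. w t * of_real (c (cis (2 * pi * t))) \<partial>lborel) = 0"
proof -
  have wint: "integrable lborel w"
    using w by (simp add: fourier_null_def)
  have S: "compact (sphere (0::complex) 1)" by simp
  obtain C where C: "\<And>z. z \<in> sphere (0::complex) 1 \<Longrightarrow> \<bar>c z\<bar> \<le> C"
    using compact_imp_bounded[OF compact_continuous_image[OF continuous_on_subset[OF c] S]]
    unfolding bounded_iff by (metis image_eqI real_norm_def subset_UNIV)
  have cis: "cis s \<in> sphere 0 1" for s by simp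
  have cint: "integrable lborel (\<lambda>t. w t * of_real (c (cis (2 * pi * t))))"
    using C[OF cis] circle_measurable[OF c]
    by (intro integrable_mult_bounded[OF wint]) auto
  define I where "I = (\<integral>t. w t * of_real (c (cis (2 * pi * t))) \<partial>lborel)"
  have "cmod I \<le> 0 + \<epsilon> * (\<integral>t. cmod (w t) \<partial>lborel)" if \<epsilon>: "0 < \<epsilon>" for \<epsilon>
  proof -
    obtain p where p: "real_polynomial_function p"
      and pc: "\<And>z. z \<in> sphere 0 1 \<Longrightarrow> \<bar>c z - p z\<bar> < \<epsilon>"
      using Stone_Weierstrass_real_polynomial_function[OF S continuous_on_subset[OF c] \<epsilon>] by auto
    have "(\<lambda>t. w t * of_real (p (cis (2 * pi * t)))) \<in> fourier_null"
      by (rule fourier_null_polynomial[OF p w])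
    then have pint: "integrable lborel (\<lambda>t. w t * of_real (p (cis (2 * pi * t))))"
      and p0: "(\<integral>t. w t * of_real (p (cis (2 * pi * t))) \<partial>lborel) = 0"
      unfolding fourier_null_def by (auto dest: spec[of _ 0])
    have "I = (\<integral>t. w t * of_real (c (cis (2 * pi * t)) - p (cis (2 * pi * t))) \<partial>lborel)"
      using cint pint p0 by (simp add: I_def right_diff_distrib)
    also have "cmod \<dots> \<le> (\<integral>t. cmod (w t * of_real (c (cis (2 * pi * t)) - p (cis (2 * pi * t)))) \<partial>lborel)"
      by (rule integral_norm_bound)
    also have "\<dots> \<le> (\<integral>t. \<epsilon> * cmod (w t) \<partial>lborel)"
    proof (rule integral_mono)
      show "integrable lborel (\<lambda>t. cmod (w t * of_real (c (cis (2 * pi * t)) - p (cis (2 * pi * t)))))"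
        using cint pint by (intro integrable_norm) (simp add: right_diff_distrib)
      show "cmod (w t * of_real (c (cis (2 * pi * t)) - p (cis (2 * pi * t)))) \<le> \<epsilon> * cmod (w t)" for t
        using mult_right_mono[OF less_imp_le[OF pc[OF cis[of "2 * pi * t"]]] norm_ge_zero[of "w t"]]
        by (simp add: norm_mult mult.commute flip: of_real_diff)
    qed (use wint in simp)
    also have "\<dots> = \<epsilon> * (\<integral>t. cmod (w t) \<partial>lborel)" by simp
    finally show ?thesis by simp
  qed
  then have "cmod I \<le> 0"
  proof (cases "(\<integral>t. cmod (w t) \<partial>lborel) = 0")
    case False
    then have pos: "0 < (\<integral>t. cmod (w t) \<partial>lborel)"
      by (simp add: order_less_le)
    show ?thesis
    proof (rule field_le_epsilon)
      fix r :: real assume "0 < r"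
      then show "cmod I \<le> 0 + r"
        using \<open>\<And>\<epsilon>. 0 < \<epsilon> \<Longrightarrow> cmod I \<le> 0 + \<epsilon> * (\<integral>t. cmod (w t) \<partial>lborel)\<close>[of "r / (\<integral>t. cmod (w t) \<partial>lborel)"] pos
        by simp
    qed
  qed (use \<open>\<And>\<epsilon>. 0 < \<epsilon> \<Longrightarrow> cmod I \<le> 0 + \<epsilon> * (\<integral>t. cmod (w t) \<partial>lborel)\<close>[of 1] in simp)
  then show ?thesis by (simp add: I_def)
qed

lemma fourier_null_closed:
  assumes w: "w \<in> fourier_null" and B: "closed (B :: complex set)"
  shows "(\<integral>t. w t * of_real (indicator B (cis (2 * pi * t))) \<partial>lborel) = 0"
\<comment> \<open>\<open>infdist\<close> to the empty set is 0 by convention, which would make the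
  approximating functions below constantly 1.\<close>
proof (cases "B = {}")
  case False
  \<comment> \<open>Continuous cut-offs with values in [0, 1] that equal 1 on B. Off the closed set
    B they vanish as soon as n exceeds the reciprocal of the distance.\<close>
  define c where "c = (\<lambda>(n::nat) z. max 0 (1 - real n * infdist z B))"
  have cc: "continuous_on UNIV (c n)" for n
    unfolding c_def by (intro continuous_intros)
  have cb: "\<bar>c n z\<bar> \<le> 1" for n z
    using infdist_nonneg[of z B] by (auto simp: c_def)
  have clim: "(\<lambda>n. c n z) \<longlonglongrightarrow> indicator B z" for z
  proof (cases "z \<in> B")
    case True
    then show ?thesis by (simp add: c_def)
  next
    case zB: False
    then have pos: "0 < infdist z B"
      using in_closed_iff_infdist_zero[OF B False, of z] infdist_nonneg[of z B] by linarith
    obtain N :: nat where N: "1 / infdist z B < real N"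
      using reals_Archimedean2 by blast
    have "\<forall>\<^sub>F n in sequentially. c n z = indicator B z"
      using eventually_ge_at_top[of N]
    proof eventually_elim
      case (elim n)
      then have "1 < real n * infdist z B"
        using N pos by (meson divide_less_eq less_le_trans of_nat_mono)
      then show ?case using zB by (simp add: c_def)
    qed
    then show ?thesis by (rule tendsto_eventually)
  qed
  have wint: "integrable lborel w"
    using w by (simp add: fourier_null_def)
  have "(\<lambda>n. \<integral>t. w t * of_real (c n (cis (2 * pi * t))) \<partial>lborel)
      \<longlonglongrightarrow> (\<integral>t. w t * of_real (indicator B (cis (2 * pi * t))) \<partial>lborel)"
  proof (rule integral_dominated_convergence[where w = "\<lambda>t. cmod (w t)"])
    have [measurable]: "(\<lambda>t. cis (2 * pi * t)) \<in> borel_measurable borel"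
      using circle_measurable[of "\<lambda>z. z"] by simp
    have [measurable]: "B \<in> sets borel" using B by simp
    have "(\<lambda>t. indicator B (cis (2 * pi * t)) :: real) \<in> borel_measurable borel"
      by measurable
    then show "(\<lambda>t. w t * complex_of_real (indicator B (cis (2 * pi * t)))) \<in> borel_measurable lborel"
      using wint by simp
    show "(\<lambda>t. w t * complex_of_real (c n (cis (2 * pi * t)))) \<in> borel_measurable lborel" for n
      using wint circle_measurable[OF cc] by simp
    show "AE t in lborel. (\<lambda>n. w t * complex_of_real (c n (cis (2 * pi * t))))
        \<longlonglongrightarrow> w t * complex_of_real (indicator B (cis (2 * pi * t)))"
      by (intro AE_I2 tendsto_intros clim)
    show "AE t in lborel. norm (w t * complex_of_real (c n (cis (2 * pi * t)))) \<le> cmod (w t)" for n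
      using cb by (simp add: norm_mult mult_left_le)
  qed (use wint in simp)
  then show ?thesis
    by (simp add: fourier_null_continuous[OF w cc] LIMSEQ_const_iff)
qed simp

text \<open>A closed T inside the set where u is positive must be null, since u integrates to 0 over
  it, and inner regularity leaves arbitrarily little measure outside T. The bounded interval makes T
  compact. Only one sign is treated, so that the integrand over T is nonnegative; the other sign is
  the case of -u.\<close>

lemma compact_integrals_zero_imp_AE:
  fixes u :: "real \<Rightarrow> real"
  assumes u: "integrable lborel u"
    and K: "\<And>K. compact K \<Longrightarrow> K \<subseteq> {a<..b} \<Longrightarrow> (\<integral>t. u t * indicator K t \<partial>lborel) = 0"
  shows "AE t in lborel. t \<in> {a<..b} \<longrightarrow> u t \<le> 0"
proof -
  have um[measurable]: "u \<in> borel_measurable borel"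
    using u by simp
  define A where "A = {t\<in>{a<..b}. 0 < u t}"
  have Am: "A \<in> sets borel"
    unfolding A_def by measurable
  have "emeasure lborel A \<le> 0 + ennreal r" if r: "0 < r" for r
  proof -
    obtain T where T: "closed T" "T \<subseteq> A" "A - T \<in> lmeasurable" "emeasure lebesgue (A - T) < ennreal r"
      using sets_lebesgue_inner_closed[of A r] Am r by auto
    have Tm: "T \<in> sets borel" using T(1) by simp
    have "bounded {a<..b}" by simp
    then have cT: "compact T"
      using T(1) bounded_subset[OF \<open>bounded {a<..b}\<close>, of T] subset_trans[OF T(2), of "{a<..b}"]
      by (auto simp: compact_eq_bounded_closed A_def simp del: greaterThanAtMost_iff)
    have "(\<integral>t. u t * indicator T t \<partial>lborel) = 0"
      using T(2) by (intro K cT) (auto simp: A_def)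
    moreover have ui: "integrable lborel (\<lambda>t. u t * indicator T t)"
      using u Tm by (intro integrable_real_mult_indicator) auto
    moreover have nn: "0 \<le> u t * indicator T t" for t
      using T(2) by (auto simp: A_def indicator_def less_imp_le)
    ultimately have "AE t in lborel. u t * indicator T t = 0"
      using integral_nonneg_eq_0_iff_AE[OF ui AE_I2[OF nn]] by simp
    then have "AE t in lborel. t \<notin> T"
      by eventually_elim (use T(2) in \<open>auto simp: A_def indicator_def split: if_splits\<close>)
    then have "emeasure lborel T = 0"
      using Tm by (subst (asm) AE_iff_measurable[of T]) auto
    moreover have "emeasure lborel A = emeasure lborel T + emeasure lborel (A - T)"
      using T(2) Am Tm by (subst plus_emeasure) (auto simp: Un_absorb1)
    ultimately show ?thesis
      using T(4) Am Tm by simp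
  qed
  then have "emeasure lborel A = 0"
    using ennreal_le_epsilon[of "0" "emeasure lborel A"] by simp
  then have "AE t in lborel. t \<notin> A"
    using Am by (subst AE_iff_measurable[of A]) auto
  then show ?thesis
    by eventually_elim (auto simp: A_def)
qed

lemma inj_on_circle: "inj_on (\<lambda>t. cis (2 * pi * t)) {of_int m<..of_int m + 1}"
proof (rule inj_onI)
  fix s t :: real
  assume st: "s \<in> {of_int m<..of_int m + 1}" "t \<in> {of_int m<..of_int m + 1}"
    and eq: "cis (2 * pi * s) = cis (2 * pi * t)"
  have "cis (2 * pi * s - 2 * pi * t) = 1"
    using eq by (simp flip: cis_divide)
  then have "cos (2 * pi * s - 2 * pi * t) = 1"
    by (simp add: complex_eq_iff)
  then obtain n :: int where "2 * pi * s - 2 * pi * t = of_int n * 2 * pi"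
    by (auto simp: cos_one_2pi_int)
  then have "2 * pi * (s - t - of_int n) = 0"
    by (simp add: algebra_simps)
  then have sn: "s - t = of_int n" by simp
  then have "\<bar>of_int n :: real\<bar> < 1"
    using st by auto
  then have "n = 0" by linarith
  then show "s = t" using sn by simp
qed

text \<open>The circle map is injective on the period and w vanishes outside of it, so the indicator
  of a compact K in the period may be replaced by that of its image, a closed subset of the circle.
  The real and imaginary parts of w and their negatives are then all at most 0 almost
  everywhere.\<close>

lemma fourier_null_imp_AE:
  assumes w: "w \<in> fourier_null" and supp: "\<And>t. t \<notin> {of_int m<..of_int m + 1} \<Longrightarrow> w t = 0"
  shows "AE t in lborel. w t = 0"
proof -
  have wint: "integrable lborel w"
    using w by (simp add: fourier_null_def)
  have K: "(\<integral>t. w t * of_real (indicator K t) \<partial>lborel) = 0"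
    if "compact K" "K \<subseteq> {of_int m<..of_int m + 1}" for K
  proof -
    have "compact ((\<lambda>t. cis (2 * pi * t)) ` K)"
      using that(1) by (intro compact_continuous_image continuous_intros) auto
    then have "(\<integral>t. w t * of_real (indicator ((\<lambda>t. cis (2 * pi * t)) ` K) (cis (2 * pi * t))) \<partial>lborel) = 0"
      by (intro fourier_null_closed w compact_imp_closed)
    also have "(\<lambda>t. w t * of_real (indicator ((\<lambda>t. cis (2 * pi * t)) ` K) (cis (2 * pi * t))))
        = (\<lambda>t. w t * of_real (indicator K t))"
    proof
      fix t
      show "w t * of_real (indicator ((\<lambda>t. cis (2 * pi * t)) ` K) (cis (2 * pi * t))) = w t * of_real (indicator K t)"
      proof (cases "t \<in> {of_int m<..of_int m + 1}")
        case True
        then have "cis (2 * pi * t) \<in> (\<lambda>t. cis (2 * pi * t)) ` K \<longleftrightarrow> t \<in> K"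
          using inj_on_image_mem_iff[OF inj_on_circle True that(2)] by simp
        then show ?thesis by (simp add: indicator_def)
      qed (simp add: supp)
    qed
    finally show ?thesis .
  qed
  have wK: "integrable lborel (\<lambda>t. w t * of_real (indicator K t))" if "compact K" for K
  proof (rule integrable_mult_bounded[OF wint, of _ 1])
    have [measurable]: "K \<in> sets borel" using that by (simp add: compact_imp_closed)
    have "(indicator K :: real \<Rightarrow> real) \<in> borel_measurable borel" by measurable
    then show "(\<lambda>t. complex_of_real (indicator K t)) \<in> borel_measurable lborel" by simp
  qed (auto simp: indicator_def)
  have Re0: "(\<integral>t. Re (w t) * indicator K t \<partial>lborel) = 0"
    and Im0: "(\<integral>t. Im (w t) * indicator K t \<partial>lborel) = 0"
    if "compact K" "K \<subseteq> {of_int m<..of_int m + 1}" for K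
  proof -
    have "(\<integral>t. Re (w t * of_real (indicator K t)) \<partial>lborel) = 0"
      using integral_Re[OF wK[OF that(1)]] K[OF that] by simp
    then show "(\<integral>t. Re (w t) * indicator K t \<partial>lborel) = 0" by simp
    have "(\<integral>t. Im (w t * of_real (indicator K t)) \<partial>lborel) = 0"
      using integral_Im[OF wK[OF that(1)]] K[OF that] by simp
    then show "(\<integral>t. Im (w t) * indicator K t \<partial>lborel) = 0" by simp
  qed
  have Rew: "integrable lborel (\<lambda>t. Re (w t))" and Imw: "integrable lborel (\<lambda>t. Im (w t))"
    using wint by auto
  note zero = compact_integrals_zero_imp_AE[where a = "of_int m" and b = "of_int m + 1"]
  have "AE t in lborel. t \<in> {of_int m<..of_int m + 1} \<longrightarrow> Re (w t) \<le> 0"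
    "AE t in lborel. t \<in> {of_int m<..of_int m + 1} \<longrightarrow> Im (w t) \<le> 0"
    "AE t in lborel. t \<in> {of_int m<..of_int m + 1} \<longrightarrow> - Re (w t) \<le> 0"
    "AE t in lborel. t \<in> {of_int m<..of_int m + 1} \<longrightarrow> - Im (w t) \<le> 0"
    using Rew Imw by (intro zero; simp add: Re0 Im0)+
  then show ?thesis
    by eventually_elim (use supp in \<open>force simp: complex_eq_iff\<close>)
qed

section \<open>Windowed exponentials as an orthonormal basis of the square-integrable functions on
  the line\<close>

definition trig_basis :: "int \<Rightarrow> int \<Rightarrow> real \<Rightarrow> complex" where
  "trig_basis m k t = of_real (indicator {of_int m<..of_int m + 1} t) * cis (2 * pi * of_int k * t)"

lemma trig_basis_measurable: "trig_basis m k \<in> borel_measurable borel"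
  unfolding trig_basis_def[abs_def] by measurable

lemma integral_trig_basis: "(\<integral>t. trig_basis m k t \<partial>lborel) = (if k = 0 then 1 else 0)"
proof (cases "k = 0")
  case True
  have "(\<integral>t. complex_of_real (indicator {of_int m<..of_int m + 1} (t::real)) \<partial>lborel) = 1"
    by (subst integral_complex_of_real) simp
  then show ?thesis using True by (simp add: trig_basis_def)
next
  case False
  define F where "F = (\<lambda>t::real. cis (2 * pi * of_int k * t) / (2 * pi * of_int k * \<i>))"
  have deriv: "(F has_vector_derivative cis (2 * pi * of_int k * t)) (at t within A)" for t A
  proof -
    have "((\<lambda>t. exp (\<i> * of_real (2 * pi * of_int k * t)) / (2 * pi * of_int k * \<i>)) has_vector_derivative
        exp (\<i> * of_real (2 * pi * of_int k * t))) (at t within A)"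
      using False by (auto intro!: derivative_eq_intros has_vector_derivative_real_field[THEN has_vector_derivative_at_within] simp: field_simps)
    then show ?thesis by (simp add: F_def cis_conv_exp)
  qed
  \<comment> \<open>The fundamental theorem of calculus is applied on the closed interval, which
    differs from the window by one point.\<close>
  have "(\<integral>t. trig_basis m k t \<partial>lborel)
      = (\<integral>t. indicator {of_int m..of_int m + 1} t *\<^sub>R cis (2 * pi * of_int k * t) \<partial>lborel)"
  proof (rule integral_cong_AE)
    have "AE t in lborel. t \<noteq> real_of_int m" by (rule AE_lborel_singleton)
    then show "AE t in lborel. trig_basis m k t
        = indicator {of_int m..of_int m + 1} t *\<^sub>R cis (2 * pi * of_int k * t)"
      by eventually_elim (auto simp: trig_basis_def indicator_def)
  qed (auto simp: trig_basis_measurable)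
  also have "\<dots> = F (of_int m + 1) - F (of_int m)"
    by (intro integral_FTC_atLeastAtMost deriv continuous_intros) auto
  also have "\<dots> = 0"
  proof -
    have "cis (2 * pi * of_int k * of_int j) = 1" for j :: int
      using cis_multiple_2pi[of "of_int (k * j)"] by (simp add: mult_ac)
    from this[of "m + 1"] this[of m] show ?thesis
      unfolding F_def by simp
  qed
  finally show ?thesis using False by simp
qed

lemma trig_basis_L2: "trig_basis m k \<in> L2 lborel"
proof -
  have "(\<lambda>t. (cmod (trig_basis m k t))\<^sup>2) = indicator {of_int m<..of_int m + 1}"
    by (auto simp: trig_basis_def indicator_def fun_eq_iff)
  then show ?thesis
    using trig_basis_measurable[of m k] by (auto simp: L2_def intro!: integrable_real_indicator)
qed

lemma trig_basis_orthonormal: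
  "L2_inner lborel (trig_basis m k) (trig_basis m' k') = (if (m, k) = (m', k') then 1 else 0)"
proof (cases "m = m'")
  case True
  have "trig_basis m k t * cnj (trig_basis m' k' t) = trig_basis m (k - k') t" for t
    using True by (auto simp: trig_basis_def indicator_def cis_cnj cis_mult algebra_simps)
  then show ?thesis
    using True by (simp add: L2_inner_def integral_trig_basis)
next
  case False
  have "trig_basis m k t * cnj (trig_basis m' k' t) = 0" for t
  proof -
    have "\<not> (t \<in> {of_int m<..of_int m + 1} \<and> t \<in> {of_int m'<..of_int m' + 1})"
      using False by auto
    then show ?thesis by (auto simp: trig_basis_def indicator_def)
  qed
  then show ?thesis
    using False unfolding L2_inner_def by (simp only: Bochner_Integration.integral_zero) simp
qed

text \<open>Orthogonality to all exponentials of the window (m, m + 1] says that f cut to this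
  window lies in \<open>fourier_null\<close>, and the half-open windows tile the line.\<close>

lemma trig_basis_total:
  assumes f: "f \<in> L2 lborel" and orth: "\<And>m k. L2_inner lborel f (trig_basis m k) = 0"
  shows "AE t in lborel. f t = 0"
proof -
  have "AE t in lborel. f t * of_real (indicator {of_int m<..of_int m + 1} t) = 0" for m :: int
  proof (rule fourier_null_imp_AE[where m = m])
    have eq: "f t * cnj (trig_basis m k t)
        = f t * of_real (indicator {of_int m<..of_int m + 1} t) * cis (2 * pi * of_int (- k) * t)" for t k
      by (simp add: trig_basis_def cis_cnj)
    have "integrable lborel (\<lambda>t. f t * of_real (indicator {of_int m<..of_int m + 1} t))"
      using L2_integrable_mult[OF f trig_basis_L2[of m 0]] unfolding eq by simp
    moreover have "(\<integral>t. f t * of_real (indicator {of_int m<..of_int m + 1} t) * cis (2 * pi * of_int k * t) \<partial>lborel) = 0" for k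
      using orth[of m "- k"] unfolding L2_inner_def eq by simp
    ultimately show "(\<lambda>t. f t * of_real (indicator {of_int m<..of_int m + 1} t)) \<in> fourier_null"
      by (simp add: fourier_null_def)
  qed simp
  then have "AE t in lborel. \<forall>m::int. f t * of_real (indicator {of_int m<..of_int m + 1} t) = 0"
    by (subst AE_all_countable) blast
  then show ?thesis
  proof eventually_elim
    case (elim t)
    have "t \<in> {of_int (\<lceil>t\<rceil> - 1)<..of_int (\<lceil>t\<rceil> - 1) + 1}"
      by (simp add: ceiling_less_iff) linarith
    then show ?case using elim by (metis indicator_simps(1) mult.right_neutral of_real_1)
  qed
qed

definition trig_seq :: "nat \<Rightarrow> real \<Rightarrow> complex" where
  "trig_seq n = (case prod_decode n of (i, j) \<Rightarrow> trig_basis (int_decode i) (int_decode j))"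

lemma trig_seq_encode: "trig_seq (prod_encode (int_encode m, int_encode k)) = trig_basis m k"
  by (simp add: trig_seq_def)

lemma l2_orthonormal_basis_trig_seq: "l2_orthonormal_basis trig_seq"
  unfolding l2_orthonormal_basis_def
proof (intro conjI allI ballI impI)
  show "trig_seq n \<in> L2 lborel" for n
    by (simp add: trig_seq_def trig_basis_L2 split: prod.split)
  show "L2_inner lborel (trig_seq m) (trig_seq n) = (if m = n then 1 else 0)" for m n
  proof -
    obtain i j i' j' where ij: "prod_decode m = (i, j)" "prod_decode n = (i', j')"
      by (metis surj_pair)
    have "m = n \<longleftrightarrow> i = i' \<and> j = j'"
      using ij by (metis prod.inject prod_decode_inverse)
    moreover have "int_decode a = int_decode b \<longleftrightarrow> a = b" for a b
      by (metis int_decode_inverse)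
    ultimately show ?thesis
      by (simp add: trig_seq_def ij trig_basis_orthonormal)
  qed
  show "AE t in lborel. f t = 0" if "f \<in> L2 lborel" "\<forall>n. L2_inner lborel f (trig_seq n) = 0" for f
    using that by (intro trig_basis_total) (auto simp flip: trig_seq_encode)
qed

lemma orthonormal_basis_of_l2:
  assumes "l2_orthonormal_basis e"
  shows "orthonormal_basis (L2 lborel) (\<lambda>c f x. c * f x) (L2_inner lborel) e"
  using assms unfolding l2_orthonormal_basis_def by (intro orthonormal_basis_L2) auto

text \<open>\<open>l2_basis\<close> is a choice, and the trigonometric system witnesses that there
  is something to choose.\<close>

lemma l2_orthonormal_basis_l2_basis: "l2_orthonormal_basis l2_basis"
  unfolding l2_basis_def using l2_orthonormal_basis_trig_seq
  by (rule someI[where P = l2_orthonormal_basis])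

interpretation l2b: orthonormal_basis "L2 lborel" "\<lambda>c f x. c * f x" "L2_inner lborel" l2_basis
  by (rule orthonormal_basis_of_l2[OF l2_orthonormal_basis_l2_basis])

interpretation trig: orthonormal_basis "L2 lborel" "\<lambda>c f x. c * f x" "L2_inner lborel" trig_seq
  by (rule orthonormal_basis_of_l2[OF l2_orthonormal_basis_trig_seq])

text \<open>Parseval for the basis of the whole line: for f supported in (0, 1] the coefficients in
  all other windows vanish, which leaves the row m = 0 of the double series. The sign in the
  exponent comes from conjugating the basis function.\<close>

lemma Fourier_Parseval:
  assumes f: "f \<in> L2 lborel" and supp: "\<And>t. t \<notin> {0<..1} \<Longrightarrow> f t = 0"
  shows "((\<lambda>k::int. (cmod (\<integral>t. f t * cis (- 2 * pi * of_int k * t) \<partial>lborel))\<^sup>2)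
    has_sum (\<integral>t. (cmod (f t))\<^sup>2 \<partial>lborel)) UNIV"
proof -
  define c where "c = (\<lambda>(m, k). (cmod (L2_inner lborel f (trig_basis m k)))\<^sup>2)"
  have "((\<lambda>n. (cmod (L2_inner lborel f (trig_seq n)))\<^sup>2) has_sum (L2_norm lborel f)\<^sup>2) UNIV"
    using trig.Parseval_sums[OF f] unfolding L2sp_nrm
    by (rule sums_nonneg_imp_has_sum) simp
  then have "((\<lambda>n. c (map_prod int_decode int_decode (prod_decode n))) has_sum (L2_norm lborel f)\<^sup>2) UNIV"
    by (simp add: c_def trig_seq_def case_prod_beta)
  moreover have "bij (\<lambda>n. map_prod int_decode int_decode (prod_decode n))"
    by (rule bij_betw_byWitness[of _ "\<lambda>(m, k). prod_encode (int_encode m, int_encode k)"])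
       (auto simp: case_prod_beta map_prod_def)
  ultimately have "(c has_sum (L2_norm lborel f)\<^sup>2) UNIV"
    using has_sum_reindex_bij_betw[of "\<lambda>n. map_prod int_decode int_decode (prod_decode n)" UNIV UNIV c]
    by simp
  moreover have "c mk = 0" if "mk \<notin> range (Pair (0::int))" for mk
  proof -
    obtain m k where mk: "mk = (m, k)" by (cases mk)
    with that have m: "m \<noteq> 0" by auto
    have "f t * cnj (trig_basis m k t) = 0" for t
    proof (cases "t \<in> {0<..1}")
      case True
      then have "t \<notin> {of_int m<..of_int m + 1}" using m by auto
      then show ?thesis by (simp add: trig_basis_def)
    qed (simp add: supp)
    then have "L2_inner lborel f (trig_basis m k) = 0"
      unfolding L2_inner_def by (simp only: Bochner_Integration.integral_zero)
    then show ?thesis by (simp add: c_def mk)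
  qed
  ultimately have "(c has_sum (L2_norm lborel f)\<^sup>2) (range (Pair 0))"
    by (subst has_sum_cong_neutral[where T = UNIV]) auto
  then have "((\<lambda>k. c (0, k)) has_sum (L2_norm lborel f)\<^sup>2) UNIV"
    by (subst (asm) has_sum_reindex) (auto simp: inj_on_def o_def)
  moreover have "f t * cnj (trig_basis 0 k t) = f t * cis (- 2 * pi * of_int k * t)" for t k
    using supp[of t] by (cases "t \<in> {0<..1}") (auto simp: trig_basis_def cis_cnj)
  ultimately show ?thesis
    by (simp add: c_def L2_inner_def L2_norm_sq)
qed

section \<open>Hilbert-Schmidt operators\<close>

lemma sum_fun_apply: "(sum f A) x = (\<Sum>i\<in>A. f i x)"
  by (induction A rule: infinite_finite_induct) auto

lemma l2_operator_mem: "l2_operator T \<Longrightarrow> \<phi> \<in> L2 lborel \<Longrightarrow> T \<phi> \<in> L2 lborel"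
  by (simp add: l2_operator_def)

lemma l2_operator_add:
  assumes "l2_operator T" "\<phi> \<in> L2 lborel" "\<psi> \<in> L2 lborel"
  shows "AE t in lborel. T (\<phi> + \<psi>) t = T \<phi> t + T \<psi> t"
  using assms by (simp add: l2_operator_def plus_fun_def)

lemma l2_operator_scale:
  assumes "l2_operator T" "\<phi> \<in> L2 lborel"
  shows "AE t in lborel. T (\<lambda>s. c * \<phi> s) t = c * T \<phi> t"
  using assms by (simp add: l2_operator_def)

lemma l2_operator_bound:
  assumes "l2_operator T"
  obtains C where "0 \<le> C" "\<And>\<phi>. \<phi> \<in> L2 lborel \<Longrightarrow> L2_norm lborel (T \<phi>) \<le> C * L2_norm lborel \<phi>"
proof -
  obtain C where C: "\<forall>\<phi>\<in>L2 lborel. L2_norm lborel (T \<phi>) \<le> C * L2_norm lborel \<phi>"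
    using assms by (auto simp: l2_operator_def)
  show ?thesis
  proof (rule that[of "max C 0"])
    show "L2_norm lborel (T \<phi>) \<le> max C 0 * L2_norm lborel \<phi>" if "\<phi> \<in> L2 lborel" for \<phi>
      using C that mult_right_mono[of C "max C 0" "L2_norm lborel \<phi>"] by force
  qed simp
qed

lemma l2_operator_cong_AE:
  assumes T: "l2_operator T" and \<phi>: "\<phi> \<in> L2 lborel" and \<psi>: "\<psi> \<in> L2 lborel"
    and eq: "AE t in lborel. \<phi> t = \<psi> t"
  shows "AE t in lborel. T \<phi> t = T \<psi> t"
proof -
  obtain C where C: "0 \<le> C" "\<And>\<phi>. \<phi> \<in> L2 lborel \<Longrightarrow> L2_norm lborel (T \<phi>) \<le> C * L2_norm lborel \<phi>"
    using l2_operator_bound[OF T] by blast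
  have d: "\<phi> - \<psi> \<in> L2 lborel" using \<phi> \<psi> by (rule L2sp.diff_mem)
  have "L2_norm lborel (\<phi> - \<psi>) = L2_norm lborel (0 :: real \<Rightarrow> complex)"
    using eq by (intro L2_norm_cong_AE d L2sp.zero_mem) auto
  then have "L2_norm lborel (\<phi> - \<psi>) = 0" by (simp add: L2_norm_def)
  then have "L2_norm lborel (T (\<phi> - \<psi>)) = 0"
    using C(2)[OF d] L2_norm_nonneg[of lborel "T (\<phi> - \<psi>)"] by simp
  then have "AE t in lborel. T (\<phi> - \<psi>) t = 0"
    by (intro L2_norm_eq_0_imp_AE l2_operator_mem[OF T] d)
  moreover have "AE t in lborel. T (\<psi> + (\<phi> - \<psi>)) t = T \<psi> t + T (\<phi> - \<psi>) t"
    by (rule l2_operator_add[OF T \<psi> d])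
  ultimately show ?thesis by eventually_elim simp
qed

lemma op_add_eq_plus: "op_add S T = S + T"
  by (auto simp: op_add_def fun_eq_iff)

lemma op_zero_eq_0: "op_zero = 0"
  by (auto simp: op_zero_def fun_eq_iff)

lemma op_eq_refl: "op_eq T T"
  by (simp add: op_eq_def)

lemma op_eq_sym: "op_eq S T \<Longrightarrow> op_eq T S"
  by (simp add: op_eq_def eq_commute)

lemma op_eq_trans: "op_eq R S \<Longrightarrow> op_eq S T \<Longrightarrow> op_eq R T"
  unfolding op_eq_def
proof
  fix \<phi> :: "real \<Rightarrow> complex" assume "\<forall>\<phi>\<in>L2 lborel. AE t in lborel. R \<phi> t = S \<phi> t"
    "\<forall>\<phi>\<in>L2 lborel. AE t in lborel. S \<phi> t = T \<phi> t" "\<phi> \<in> L2 lborel"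
  then have "AE t in lborel. R \<phi> t = S \<phi> t" "AE t in lborel. S \<phi> t = T \<phi> t" by auto
  then show "AE t in lborel. R \<phi> t = T \<phi> t" by eventually_elim simp
qed

lemma l2_operator_zero: "l2_operator 0"
  by (auto simp: l2_operator_def zero_fun_def L2_def L2_norm_def intro!: exI[of _ 0])

lemma l2_operator_plus:
  assumes S: "l2_operator S" and T: "l2_operator T"
  shows "l2_operator (S + T)"
  unfolding l2_operator_def
proof (intro conjI ballI allI)
  fix \<phi> \<psi> :: "real \<Rightarrow> complex" assume \<phi>: "\<phi> \<in> L2 lborel" and \<psi>: "\<psi> \<in> L2 lborel"
  show "(S + T) \<phi> \<in> L2 lborel"
    using S T \<phi> by (simp add: L2sp.add_mem l2_operator_mem)
  have "AE t in lborel. S (\<phi> + \<psi>) t = S \<phi> t + S \<psi> t" "AE t in lborel. T (\<phi> + \<psi>) t = T \<phi> t + T \<psi> t"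
    using S T \<phi> \<psi> by (simp_all only: l2_operator_add)
  then show "AE t in lborel. (S + T) (\<lambda>s. \<phi> s + \<psi> s) t = (S + T) \<phi> t + (S + T) \<psi> t"
    by eventually_elim (simp add: plus_fun_def)
next
  fix c and \<phi> :: "real \<Rightarrow> complex" assume \<phi>: "\<phi> \<in> L2 lborel"
  have "AE t in lborel. S (\<lambda>s. c * \<phi> s) t = c * S \<phi> t" "AE t in lborel. T (\<lambda>s. c * \<phi> s) t = c * T \<phi> t"
    using S T \<phi> by (simp_all only: l2_operator_scale)
  then show "AE t in lborel. (S + T) (\<lambda>s. c * \<phi> s) t = c * (S + T) \<phi> t"
    by eventually_elim (simp add: distrib_left)
next
  obtain C D where C: "\<And>\<phi>. \<phi> \<in> L2 lborel \<Longrightarrow> L2_norm lborel (S \<phi>) \<le> C * L2_norm lborel \<phi>"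
    and D: "\<And>\<phi>. \<phi> \<in> L2 lborel \<Longrightarrow> L2_norm lborel (T \<phi>) \<le> D * L2_norm lborel \<phi>"
    using l2_operator_bound[OF S] l2_operator_bound[OF T] by metis
  show "\<exists>C. \<forall>\<phi>\<in>L2 lborel. L2_norm lborel ((S + T) \<phi>) \<le> C * L2_norm lborel \<phi>"
  proof (intro exI[of _ "C + D"] ballI)
    fix \<phi> :: "real \<Rightarrow> complex" assume \<phi>: "\<phi> \<in> L2 lborel"
    show "L2_norm lborel ((S + T) \<phi>) \<le> (C + D) * L2_norm lborel \<phi>"
      using L2sp.nrm_triangle[of "S \<phi>" lborel "T \<phi>"] C[OF \<phi>] D[OF \<phi>] S T \<phi>
      by (simp add: L2sp_nrm l2_operator_mem distrib_right)
  qed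
qed

lemma l2_operator_op_scale:
  assumes S: "l2_operator S"
  shows "l2_operator (op_scale c S)"
  unfolding l2_operator_def
proof (intro conjI ballI allI)
  fix \<phi> \<psi> :: "real \<Rightarrow> complex" assume \<phi>: "\<phi> \<in> L2 lborel" and \<psi>: "\<psi> \<in> L2 lborel"
  show "op_scale c S \<phi> \<in> L2 lborel"
    unfolding op_scale_def by (rule L2_scale[OF l2_operator_mem[OF S \<phi>]])
  have "AE t in lborel. S (\<phi> + \<psi>) t = S \<phi> t + S \<psi> t"
    by (rule l2_operator_add[OF S \<phi> \<psi>])
  then show "AE t in lborel. op_scale c S (\<lambda>s. \<phi> s + \<psi> s) t = op_scale c S \<phi> t + op_scale c S \<psi> t"
    by eventually_elim (simp add: plus_fun_def op_scale_def distrib_left)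
next
  fix d and \<phi> :: "real \<Rightarrow> complex" assume \<phi>: "\<phi> \<in> L2 lborel"
  have "AE t in lborel. S (\<lambda>s. d * \<phi> s) t = d * S \<phi> t"
    by (rule l2_operator_scale[OF S \<phi>])
  then show "AE t in lborel. op_scale c S (\<lambda>s. d * \<phi> s) t = d * op_scale c S \<phi> t"
    by eventually_elim (simp add: op_scale_def)
next
  obtain C where C: "\<And>\<phi>. \<phi> \<in> L2 lborel \<Longrightarrow> L2_norm lborel (S \<phi>) \<le> C * L2_norm lborel \<phi>"
    using l2_operator_bound[OF S] by metis
  show "\<exists>C. \<forall>\<phi>\<in>L2 lborel. L2_norm lborel (op_scale c S \<phi>) \<le> C * L2_norm lborel \<phi>"
  proof (intro exI[of _ "cmod c * C"] ballI)
    fix \<phi> :: "real \<Rightarrow> complex" assume \<phi>: "\<phi> \<in> L2 lborel"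
    show "L2_norm lborel (op_scale c S \<phi>) \<le> cmod c * C * L2_norm lborel \<phi>"
      using L2sp.nrm_sc[of "S \<phi>" lborel c] mult_left_mono[OF C[OF \<phi>], of "cmod c"] S \<phi>
      by (simp add: L2sp_nrm l2_operator_mem op_scale_def mult.assoc)
  qed
qed

lemma l2_basis_L2: "l2_basis n \<in> L2 lborel"
  by (rule l2b.e_mem)

lemma hs_ops_operator: "T \<in> hs_ops \<Longrightarrow> l2_operator T"
  by (simp add: hs_ops_def)

lemma hs_ops_L2: "T \<in> hs_ops \<Longrightarrow> \<phi> \<in> L2 lborel \<Longrightarrow> T \<phi> \<in> L2 lborel"
  by (simp add: hs_ops_operator l2_operator_mem)

lemma hs_ops_summable: "T \<in> hs_ops \<Longrightarrow> summable (\<lambda>n. (L2_norm lborel (T (l2_basis n)))\<^sup>2)"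
  by (simp add: hs_ops_def)

lemma L2_norm_add_sq_le:
  assumes "f \<in> L2 M" "g \<in> L2 M"
  shows "(L2_norm M (f + g))\<^sup>2 \<le> 2 * (L2_norm M f)\<^sup>2 + 2 * (L2_norm M g)\<^sup>2"
proof -
  have "(L2_norm M (f + g))\<^sup>2 \<le> (L2_norm M f + L2_norm M g)\<^sup>2"
    using L2sp.nrm_triangle[OF assms] by (intro power_mono) (simp_all add: L2sp_nrm)
  then show ?thesis
    using sum_squares_bound[of "L2_norm M f" "L2_norm M g"] by (simp add: power2_sum)
qed

lemma hs_ops_plus:
  assumes "S \<in> hs_ops" "T \<in> hs_ops"
  shows "S + T \<in> hs_ops"
proof -
  have "summable (\<lambda>n. (L2_norm lborel ((S + T) (l2_basis n)))\<^sup>2)"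
  proof (rule summable_comparison_test')
    show "summable (\<lambda>n. 2 * (L2_norm lborel (S (l2_basis n)))\<^sup>2 + 2 * (L2_norm lborel (T (l2_basis n)))\<^sup>2)"
      using assms by (intro summable_add summable_mult hs_ops_summable)
    show "norm ((L2_norm lborel ((S + T) (l2_basis n)))\<^sup>2)
        \<le> 2 * (L2_norm lborel (S (l2_basis n)))\<^sup>2 + 2 * (L2_norm lborel (T (l2_basis n)))\<^sup>2" for n
      using L2_norm_add_sq_le[of "S (l2_basis n)" lborel "T (l2_basis n)"] assms
      by (simp add: hs_ops_L2 l2_basis_L2)
  qed
  then show ?thesis
    using assms by (simp add: hs_ops_def l2_operator_plus)
qed

lemma L2_norm_scale: "L2_norm M (\<lambda>x. c * f x) = cmod c * L2_norm M f"
  by (simp add: L2_norm_def norm_mult power_mult_distrib real_sqrt_mult)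

lemma hs_ops_op_scale:
  assumes "S \<in> hs_ops"
  shows "op_scale c S \<in> hs_ops"
proof -
  have "(L2_norm lborel (op_scale c S (l2_basis n)))\<^sup>2
      = (cmod c)\<^sup>2 * (L2_norm lborel (S (l2_basis n)))\<^sup>2" for n
    by (simp add: op_scale_def L2_norm_scale power_mult_distrib)
  then show ?thesis
    using assms summable_mult[OF hs_ops_summable[OF assms], of "(cmod c)\<^sup>2"]
    by (simp add: hs_ops_def l2_operator_op_scale)
qed

lemma hs_inner_summable:
  assumes "S \<in> hs_ops" "T \<in> hs_ops"
  shows "summable (\<lambda>n. L2_inner lborel (S (l2_basis n)) (T (l2_basis n)))"
proof (rule summable_comparison_test')
  show "summable (\<lambda>n. (L2_norm lborel (S (l2_basis n)))\<^sup>2 + (L2_norm lborel (T (l2_basis n)))\<^sup>2)"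
    using assms by (intro summable_add hs_ops_summable)
  fix n
  have "cmod (L2_inner lborel (S (l2_basis n)) (T (l2_basis n)))
      \<le> L2_norm lborel (S (l2_basis n)) * L2_norm lborel (T (l2_basis n))"
    using L2sp.Cauchy_Schwarz[of "S (l2_basis n)" lborel "T (l2_basis n)"] assms
    by (simp add: hs_ops_L2 l2_basis_L2 L2sp_nrm)
  also have "\<dots> \<le> (L2_norm lborel (S (l2_basis n)))\<^sup>2 + (L2_norm lborel (T (l2_basis n)))\<^sup>2"
    using sum_squares_bound[of "L2_norm lborel (S (l2_basis n))" "L2_norm lborel (T (l2_basis n))"]
      mult_nonneg_nonneg[OF L2_norm_nonneg[of lborel "S (l2_basis n)"] L2_norm_nonneg[of lborel "T (l2_basis n)"]]
    by linarith
  finally show "norm (L2_inner lborel (S (l2_basis n)) (T (l2_basis n)))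
      \<le> (L2_norm lborel (S (l2_basis n)))\<^sup>2 + (L2_norm lborel (T (l2_basis n)))\<^sup>2"
    by simp
qed

lemma hs_inner_self:
  assumes "T \<in> hs_ops"
  shows "hs_inner T T = of_real (\<Sum>n. (L2_norm lborel (T (l2_basis n)))\<^sup>2)"
  using suminf_of_real[OF hs_ops_summable[OF assms], where 'a = complex]
  by (simp add: hs_inner_def L2_inner_self L2_norm_sq)

lemma semi_inner_hs: "semi_inner hs_ops op_scale hs_inner"
proof
  fix S T U :: l2_op and c :: complex
  show "(0 :: l2_op) \<in> hs_ops"
    using l2_operator_zero by (simp add: hs_ops_def L2_norm_def)
  show "S + T \<in> hs_ops" if "S \<in> hs_ops" "T \<in> hs_ops"
    using that by (rule hs_ops_plus)
  show "op_scale c S \<in> hs_ops" if "S \<in> hs_ops"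
    using that by (rule hs_ops_op_scale)
  show "op_scale 0 S = 0" "op_scale (- 1) S = - S"
    by (auto simp: op_scale_def fun_eq_iff)
  show "hs_inner (S + T) U = hs_inner S U + hs_inner T U"
    if "S \<in> hs_ops" "T \<in> hs_ops" "U \<in> hs_ops"
  proof -
    have "L2_inner lborel ((S + T) (l2_basis n)) (U (l2_basis n))
        = L2_inner lborel (S (l2_basis n)) (U (l2_basis n)) + L2_inner lborel (T (l2_basis n)) (U (l2_basis n))" for n
      using that by (simp add: L2sp.ip_add_left hs_ops_L2 l2_basis_L2)
    then show ?thesis
      using that by (simp add: hs_inner_def suminf_add hs_inner_summable)
  qed
  show "hs_inner (op_scale c S) U = c * hs_inner S U" if "S \<in> hs_ops" "U \<in> hs_ops"
  proof -
    have "L2_inner lborel (op_scale c S (l2_basis n)) (U (l2_basis n))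
        = c * L2_inner lborel (S (l2_basis n)) (U (l2_basis n))" for n
      using that by (simp add: op_scale_def L2sp.ip_sc_left hs_ops_L2 l2_basis_L2)
    then show ?thesis
      using that by (simp add: hs_inner_def suminf_mult hs_inner_summable)
  qed
  show "cnj (hs_inner S T) = hs_inner T S" if "S \<in> hs_ops" "T \<in> hs_ops"
  proof -
    have "(\<lambda>n. cnj (L2_inner lborel (S (l2_basis n)) (T (l2_basis n)))) sums cnj (hs_inner S T)"
      unfolding sums_cnj hs_inner_def using that by (intro summable_sums hs_inner_summable)
    then have "(\<lambda>n. L2_inner lborel (T (l2_basis n)) (S (l2_basis n))) sums cnj (hs_inner S T)"
      using that by (simp add: L2sp.ip_cnj hs_ops_L2 l2_basis_L2)
    then show ?thesis by (simp add: hs_inner_def sums_iff)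
  qed
  show "0 \<le> Re (hs_inner S S)" if "S \<in> hs_ops"
    using that by (simp add: hs_inner_self suminf_nonneg hs_ops_summable)
qed

interpretation hs: semi_inner hs_ops op_scale hs_inner
  by (rule semi_inner_hs)

lemma hs_nrm: "T \<in> hs_ops \<Longrightarrow> hs.nrm T = hs_norm T"
  by (simp add: hs.nrm_def hs_norm_def hs_inner_self)

lemma hs_norm_sq: "T \<in> hs_ops \<Longrightarrow> (hs_norm T)\<^sup>2 = (\<Sum>n. (L2_norm lborel (T (l2_basis n)))\<^sup>2)"
  by (simp add: hs_norm_def suminf_nonneg hs_ops_summable)

text \<open>Transfers the Hilbert-Schmidt property from the transform of a translate to the
  conjugated operator. The condition that R preserves square-integrable functions is separate
  because almost everywhere equality for \<open>lborel\<close> does not carry Borel measurability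
  along.\<close>

lemma op_eq_hs_ops:
  assumes T: "T \<in> hs_ops" and eq: "op_eq R T" and R: "\<And>\<phi>. \<phi> \<in> L2 lborel \<Longrightarrow> R \<phi> \<in> L2 lborel"
  shows "R \<in> hs_ops"
proof -
  have AE: "AE t in lborel. R \<phi> t = T \<phi> t" if "\<phi> \<in> L2 lborel" for \<phi>
    using eq that by (simp add: op_eq_def)
  have nrm: "L2_norm lborel (R \<phi>) = L2_norm lborel (T \<phi>)" if "\<phi> \<in> L2 lborel" for \<phi>
    using that T by (intro L2_norm_cong_AE R AE) (auto simp: hs_ops_L2)
  have "l2_operator R"
    unfolding l2_operator_def
  proof (intro conjI ballI allI)
    fix \<phi> \<psi> :: "real \<Rightarrow> complex" assume \<phi>: "\<phi> \<in> L2 lborel" and \<psi>: "\<psi> \<in> L2 lborel"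
    show "R \<phi> \<in> L2 lborel" by (rule R[OF \<phi>])
    show "AE t in lborel. R (\<lambda>s. \<phi> s + \<psi> s) t = R \<phi> t + R \<psi> t"
      using AE[OF \<phi>] AE[OF \<psi>] AE[OF L2_add[OF \<phi> \<psi>]] l2_operator_add[OF hs_ops_operator[OF T] \<phi> \<psi>]
      by eventually_elim (simp add: plus_fun_def)
  next
    fix c and \<phi> :: "real \<Rightarrow> complex" assume \<phi>: "\<phi> \<in> L2 lborel"
    show "AE t in lborel. R (\<lambda>s. c * \<phi> s) t = c * R \<phi> t"
      using AE[OF \<phi>] AE[OF L2_scale[OF \<phi>, of c]] l2_operator_scale[OF hs_ops_operator[OF T] \<phi>, of c]
      by eventually_elim simp
  next
    show "\<exists>C. \<forall>\<phi>\<in>L2 lborel. L2_norm lborel (R \<phi>) \<le> C * L2_norm lborel \<phi>"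
      using l2_operator_bound[OF hs_ops_operator[OF T]] nrm by metis
  qed
  then show ?thesis
    using hs_ops_summable[OF T] by (simp add: hs_ops_def nrm l2_basis_L2)
qed

lemma hs_inner_op_eq:
  assumes "S \<in> hs_ops" "S' \<in> hs_ops" "T \<in> hs_ops" "T' \<in> hs_ops" "op_eq S S'" "op_eq T T'"
  shows "hs_inner S T = hs_inner S' T'"
proof -
  have "L2_inner lborel (S (l2_basis n)) (T (l2_basis n)) = L2_inner lborel (S' (l2_basis n)) (T' (l2_basis n))" for n
    using assms by (intro L2_inner_cong_AE) (auto simp: hs_ops_L2 l2_basis_L2 op_eq_def)
  then show ?thesis by (simp add: hs_inner_def)
qed

lemma hs_norm_op_eq:
  assumes "S \<in> hs_ops" "T \<in> hs_ops" "op_eq S T"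
  shows "hs_norm S = hs_norm T"
proof -
  have "L2_norm lborel (S (l2_basis n)) = L2_norm lborel (T (l2_basis n))" for n
    using assms by (intro L2_norm_cong_AE) (auto simp: hs_ops_L2 l2_basis_L2 op_eq_def)
  then show ?thesis by (simp add: hs_norm_def)
qed

lemma l2_operator_lincomb:
  assumes T: "l2_operator T"
  shows "AE t in lborel. T (\<Sum>n<N. (\<lambda>x. c n * l2_basis n x)) t = (\<Sum>n<N. c n * T (l2_basis n) t)"
proof (induction N)
  case 0
  have "AE t in lborel. T (\<lambda>s. 0 * 0) t = 0 * T (\<lambda>_. 0) t"
    by (rule l2_operator_scale[OF T]) (simp add: L2_def)
  then show ?case by (simp add: zero_fun_def)
next
  case (Suc N)
  have "AE t in lborel. T ((\<Sum>n<N. (\<lambda>x. c n * l2_basis n x)) + (\<lambda>x. c N * l2_basis N x)) t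
      = T (\<Sum>n<N. (\<lambda>x. c n * l2_basis n x)) t + T (\<lambda>x. c N * l2_basis N x) t"
    by (intro l2_operator_add[OF T] L2_scale l2_basis_L2 l2b.lincomb_mem)
  moreover have "AE t in lborel. T (\<lambda>x. c N * l2_basis N x) t = c N * T (l2_basis N) t"
    by (rule l2_operator_scale[OF T l2_basis_L2])
  ultimately show ?case
    using Suc by eventually_elim (simp add: plus_fun_def)
qed

text \<open>On a partial sum of the expansion of the argument this is the Cauchy-Schwarz inequality
  between the coefficients and the norms of the images of the basis vectors. The remainder is
  controlled by any operator bound C and tends to 0.\<close>

lemma hs_norm_bound:
  assumes T: "T \<in> hs_ops" and \<phi>: "\<phi> \<in> L2 lborel"
  shows "L2_norm lborel (T \<phi>) \<le> hs_norm T * L2_norm lborel \<phi>"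
proof -
  obtain C where C: "0 \<le> C" "\<And>\<phi>. \<phi> \<in> L2 lborel \<Longrightarrow> L2_norm lborel (T \<phi>) \<le> C * L2_norm lborel \<phi>"
    using l2_operator_bound[OF hs_ops_operator[OF T]] by blast
  have le: "L2_norm lborel (T \<phi>) \<le> hs_norm T * L2_norm lborel \<phi> + C * L2_norm lborel (\<phi> - l2b.psum \<phi> N)" for N
  proof -
    define s where "s = l2b.psum \<phi> N"
    define c where "c = (\<lambda>n. L2_inner lborel \<phi> (l2_basis n))"
    have sL: "s \<in> L2 lborel" unfolding s_def by (rule l2b.psum_mem)
    have ms: "(\<Sum>n<N. (\<lambda>t. c n * T (l2_basis n) t)) \<in> L2 lborel"
      by (intro L2sp.sum_mem L2_scale hs_ops_L2[OF T] l2_basis_L2)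
    have "L2_norm lborel (T s) = L2_norm lborel (\<Sum>n<N. (\<lambda>t. c n * T (l2_basis n) t))"
    proof (rule L2_norm_cong_AE[OF ms hs_ops_L2[OF T sL]])
      show "AE t in lborel. T s t = (\<Sum>n<N. (\<lambda>t. c n * T (l2_basis n) t)) t"
        using l2_operator_lincomb[OF hs_ops_operator[OF T], of c N]
        by (simp add: s_def l2b.psum_def c_def sum_fun_apply)
    qed
    also have "\<dots> \<le> (\<Sum>n<N. L2_norm lborel (\<lambda>t. c n * T (l2_basis n) t))"
      using L2sp.nrm_sum_le[of "{..<N}" "\<lambda>n t. c n * T (l2_basis n) t" lborel]
      by (simp add: L2sp_nrm L2_scale hs_ops_L2[OF T] l2_basis_L2)
    also have "\<dots> = (\<Sum>n<N. \<bar>cmod (c n)\<bar> * \<bar>L2_norm lborel (T (l2_basis n))\<bar>)"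
      by (simp add: L2_norm_scale)
    also have "\<dots> \<le> L2_set (\<lambda>n. cmod (c n)) {..<N} * L2_set (\<lambda>n. L2_norm lborel (T (l2_basis n))) {..<N}"
      by (rule L2_set_mult_ineq)
    also have "\<dots> \<le> L2_norm lborel \<phi> * hs_norm T"
    proof (intro mult_mono)
      show "L2_set (\<lambda>n. cmod (c n)) {..<N} \<le> L2_norm lborel \<phi>"
        unfolding L2_set_def c_def using l2b.Bessel[OF \<phi>, of N]
        by (intro real_le_lsqrt) (auto simp: L2sp_nrm intro: sum_nonneg)
      show "L2_set (\<lambda>n. L2_norm lborel (T (l2_basis n))) {..<N} \<le> hs_norm T"
        unfolding L2_set_def hs_norm_def
        by (intro real_sqrt_le_mono sum_le_suminf hs_ops_summable[OF T]) auto
    qed (auto simp: L2_set_nonneg)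
    finally have 1: "L2_norm lborel (T s) \<le> hs_norm T * L2_norm lborel \<phi>" by (simp add: mult.commute)
    have d: "\<phi> - s \<in> L2 lborel" using \<phi> sL by (rule L2sp.diff_mem)
    have "L2_norm lborel (T \<phi>) = L2_norm lborel (T s + T (\<phi> - s))"
    proof (rule L2_norm_cong_AE)
      show "AE t in lborel. T \<phi> t = (T s + T (\<phi> - s)) t"
        using l2_operator_add[OF hs_ops_operator[OF T] sL d] by simp
    qed (auto intro!: L2sp.add_mem hs_ops_L2[OF T] sL d \<phi>)
    also have "\<dots> \<le> L2_norm lborel (T s) + L2_norm lborel (T (\<phi> - s))"
      using L2sp.nrm_triangle[OF hs_ops_L2[OF T sL] hs_ops_L2[OF T d]] by (simp add: L2sp_nrm)
    finally show ?thesis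
      using 1 C(2)[OF d] by (simp add: s_def)
  qed
  have "(\<lambda>N. hs_norm T * L2_norm lborel \<phi> + C * L2_norm lborel (\<phi> - l2b.psum \<phi> N))
      \<longlonglongrightarrow> hs_norm T * L2_norm lborel \<phi> + C * 0"
    using l2b.psum_tendsto[OF \<phi>] by (intro tendsto_intros) (simp add: L2sp_nrm)
  then have "L2_norm lborel (T \<phi>) \<le> hs_norm T * L2_norm lborel \<phi> + C * 0"
    by (rule LIMSEQ_le_const) (use le in blast)
  then show ?thesis by simp
qed

section \<open>A countable dense set of Hilbert-Schmidt operators\<close>

definition rank_one :: "(real \<Rightarrow> complex) \<Rightarrow> (real \<Rightarrow> complex) \<Rightarrow> l2_op" where
  "rank_one b d = (\<lambda>\<phi> t. L2_inner lborel \<phi> b * d t)"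

lemma rank_one_hs_ops:
  assumes d: "d \<in> L2 lborel"
  shows "rank_one (l2_basis k) d \<in> hs_ops"
proof -
  let ?b = "l2_basis k"
  note b = l2_basis_L2[of k]
  have "l2_operator (rank_one ?b d)"
    unfolding l2_operator_def
  proof (intro conjI ballI allI)
    fix \<phi> \<psi> :: "real \<Rightarrow> complex" assume \<phi>: "\<phi> \<in> L2 lborel" and \<psi>: "\<psi> \<in> L2 lborel"
    show "rank_one ?b d \<phi> \<in> L2 lborel"
      unfolding rank_one_def by (rule L2_scale[OF d])
    show "AE t in lborel. rank_one ?b d (\<lambda>s. \<phi> s + \<psi> s) t = rank_one ?b d \<phi> t + rank_one ?b d \<psi> t"
      using L2sp.ip_add_left[OF \<phi> \<psi> b] by (simp add: rank_one_def plus_fun_def distrib_right)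
  next
    fix c and \<phi> :: "real \<Rightarrow> complex" assume \<phi>: "\<phi> \<in> L2 lborel"
    show "AE t in lborel. rank_one ?b d (\<lambda>s. c * \<phi> s) t = c * rank_one ?b d \<phi> t"
      using L2sp.ip_sc_left[OF \<phi> b] by (simp add: rank_one_def)
  next
    show "\<exists>C. \<forall>\<phi>\<in>L2 lborel. L2_norm lborel (rank_one ?b d \<phi>) \<le> C * L2_norm lborel \<phi>"
    proof (intro exI[of _ "L2_norm lborel ?b * L2_norm lborel d"] ballI)
      fix \<phi> :: "real \<Rightarrow> complex" assume \<phi>: "\<phi> \<in> L2 lborel"
      show "L2_norm lborel (rank_one ?b d \<phi>) \<le> L2_norm lborel ?b * L2_norm lborel d * L2_norm lborel \<phi>"
        using mult_right_mono[OF L2sp.Cauchy_Schwarz[OF \<phi> b] L2_norm_nonneg[of lborel d]]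
        unfolding rank_one_def L2_norm_scale L2sp_nrm by (simp only: mult_ac)
    qed
  qed
  moreover have "summable (\<lambda>n. (L2_norm lborel (rank_one ?b d (l2_basis n)))\<^sup>2)"
    by (rule summable_finite[of "{k}"]) (auto simp: rank_one_def L2_norm_scale l2b.e_ip L2_norm_def)
  ultimately show ?thesis by (simp add: hs_ops_def)
qed

text \<open>A finite sum of \<open>rank_one\<close> operators prescribes the images of finitely many
  basis vectors and kills the others. Taking the images from a countable dense set of functions
  suffices, as the squared norm of the error is the sum of the squared errors on the basis
  vectors.\<close>

lemma hs_ops_countable_dense: "\<exists>D. countable D \<and> hs.nrm_dense D"
proof -
  obtain D0 :: "(real \<Rightarrow> complex) set" where D0: "countable D0" "L2sp.nrm_dense lborel D0"
    using l2b.countable_dense by (elim exE conjE)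
  define FR where "FR = (\<lambda>ds. \<Sum>n<length ds. rank_one (l2_basis n) (ds ! n))"
  define D where "D = FR ` lists D0"
  have D0L: "d \<in> L2 lborel" if "d \<in> D0" for d
    using D0(2) that by (auto simp: L2sp.nrm_dense_def)
  have FR_hs: "FR ds \<in> hs_ops" if "ds \<in> lists D0" for ds
    unfolding FR_def using that D0L
    by (intro hs.sum_mem rank_one_hs_ops) auto
  have FR_basis: "FR ds (l2_basis j) = (if j < length ds then ds ! j else 0)" for ds j
  proof
    fix t
    have "FR ds (l2_basis j) t = (\<Sum>n<length ds. (if j = n then 1 else 0) * (ds ! n) t)"
      by (simp add: FR_def sum_fun_apply rank_one_def l2b.e_ip)
    also have "\<dots> = (\<Sum>n<length ds. if j = n then (ds ! n) t else 0)"
      by (intro sum.cong) auto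
    also have "\<dots> = (if j < length ds then ds ! j else 0) t"
      by simp
    finally show "FR ds (l2_basis j) t = (if j < length ds then ds ! j else 0) t" .
  qed
  have "countable D" unfolding D_def using D0(1) by auto
  moreover have "hs.nrm_dense D"
    unfolding hs.nrm_dense_def
  proof (intro conjI ballI allI impI)
    show "D \<subseteq> hs_ops" using FR_hs by (auto simp: D_def)
    fix T and r :: real assume T: "T \<in> hs_ops" and r: "0 < r"
    define a where "a = (\<lambda>n. (L2_norm lborel (T (l2_basis n)))\<^sup>2)"
    have a: "summable a" unfolding a_def by (rule hs_ops_summable[OF T])
    obtain N where N: "norm (\<Sum>i. a (i + N)) < r\<^sup>2 / 2"
      using suminf_exist_split[OF _ a, of "r\<^sup>2 / 2"] r by auto
    \<comment> \<open>The first N basis vectors contribute at most N times the square of this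
      number, hence at most r^2 / 2; the tail of T accounts for the other half.\<close>
    define \<delta> where "\<delta> = sqrt (r\<^sup>2 / (2 * (real N + 1)))"
    have \<delta>: "0 < \<delta>" using r by (simp add: \<delta>_def)
    have "\<exists>d\<in>D0. L2_norm lborel (T (l2_basis n) - d) < \<delta>" for n
      using D0(2) \<delta> hs_ops_L2[OF T l2_basis_L2[of n]] unfolding L2sp.nrm_dense_def L2sp_nrm by blast
    then obtain d where d: "\<And>n. d n \<in> D0" "\<And>n. L2_norm lborel (T (l2_basis n) - d n) < \<delta>"
      by metis
    define ds where "ds = map d [0..<N]"
    have ds: "ds \<in> lists D0" using d(1) by (auto simp: ds_def)
    have diff: "T - FR ds \<in> hs_ops" by (rule hs.diff_mem[OF T FR_hs[OF ds]])
    define b where "b = (\<lambda>n. (L2_norm lborel ((T - FR ds) (l2_basis n)))\<^sup>2)"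
    have bsum: "summable b" unfolding b_def by (rule hs_ops_summable[OF diff])
    have "(hs_norm (T - FR ds))\<^sup>2 = (\<Sum>i. b i)"
      unfolding b_def by (rule hs_norm_sq[OF diff])
    also have "\<dots> = (\<Sum>i. b (i + N)) + (\<Sum>i<N. b i)"
      by (rule suminf_split_initial_segment[OF bsum])
    also have "(\<lambda>i. b (i + N)) = (\<lambda>i. a (i + N))"
      by (auto simp: a_def b_def FR_basis ds_def)
    also have "(\<Sum>i<N. b i) \<le> (\<Sum>i<N. r\<^sup>2 / (2 * (real N + 1)))"
    proof (rule sum_mono)
      fix i assume i: "i \<in> {..<N}"
      then have "b i = (L2_norm lborel (T (l2_basis i) - d i))\<^sup>2"
        by (simp add: b_def FR_basis ds_def)
      also have "\<dots> \<le> \<delta>\<^sup>2"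
        using d(2)[of i] by (intro power_mono) auto
      finally show "b i \<le> r\<^sup>2 / (2 * (real N + 1))"
        by (simp add: \<delta>_def)
    qed
    also have "\<dots> \<le> r\<^sup>2 / 2"
      using r by (simp add: field_simps)
    finally have "(hs_norm (T - FR ds))\<^sup>2 < r\<^sup>2"
      using N unfolding real_norm_def by linarith
    then have "hs_norm (T - FR ds) < r"
      using r by (intro power2_less_imp_less[of _ r]) auto
    then show "\<exists>d\<in>D. hs.nrm (T - d) < r"
      using ds diff by (intro bexI[of _ "FR ds"]) (auto simp: hs_nrm D_def)
  qed
  ultimately show ?thesis by blast
qed

section \<open>The Heisenberg group and its Haar measure\<close>

lemma heis_mat_in_heis [simp]: "heis_mat x y z \<in> heis"
  by (auto simp: heis_def)

lemma heisE:
  assumes "u \<in> heis"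
  obtains a b c where "u = heis_mat a b c"
  using assms by (auto simp: heis_def)

lemma heis_mat_entries:
  "heis_mat x y z $ 1 $ 2 = x" "heis_mat x y z $ 2 $ 4 = y" "heis_mat x y z $ 1 $ 4 = z"
  by (simp_all add: heis_mat_def vector_4)

lemma heis_mult_closed: "u \<in> heis \<Longrightarrow> v \<in> heis \<Longrightarrow> u ** v \<in> heis"
  by (auto simp: heis_def heis_mat_mult) metis

lemma matrix_inv_eqI:
  fixes A B :: mat4
  assumes "A ** B = mat 1" "B ** A = mat 1"
  shows "matrix_inv A = B"
proof -
  have "A ** matrix_inv A = mat 1 \<and> matrix_inv A ** A = mat 1"
    unfolding matrix_inv_def by (rule someI[of _ B]) (use assms in simp)
  then have 1: "A ** matrix_inv A = mat 1" "matrix_inv A ** A = mat 1" by auto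
  have "matrix_inv A = matrix_inv A ** (A ** B)"
    unfolding assms(1) by simp
  also have "\<dots> = (matrix_inv A ** A) ** B"
    by (rule matrix_mul_assoc)
  also have "\<dots> = B"
    unfolding 1 by simp
  finally show ?thesis .
qed

lemma matrix_inv_heis_mat: "matrix_inv (heis_mat a b c) = heis_mat (- a) (- b) (- c + a * b)"
  by (rule matrix_inv_eqI) (simp_all add: heis_mat_mult flip: heis_mat_0)

lemma matrix_inv_heis:
  assumes "u \<in> heis"
  shows "matrix_inv u \<in> heis" "u ** matrix_inv u = mat 1" "matrix_inv u ** u = mat 1"
    "matrix_inv (matrix_inv u) = u"
  using assms by (auto elim!: heisE simp: matrix_inv_heis_mat heis_mat_mult simp flip: heis_mat_0)

lemma space_haar: "space haar = heis"
  by (simp add: haar_def space_restrict_space)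

lemma sets_haar: "sets haar = sets (restrict_space borel heis)"
  by (simp add: haar_def)

lemma heis_mult_measurable:
  assumes "u \<in> heis" "v \<in> heis"
  shows "(\<lambda>n. u ** n ** v) \<in> haar \<rightarrow>\<^sub>M haar"
proof -
  have "(\<lambda>n. u ** n ** v) \<in> restrict_space borel heis \<rightarrow>\<^sub>M restrict_space borel heis"
  proof (rule measurable_restrict_space3)
    have "continuous_on UNIV (\<lambda>n :: mat4. u ** n ** v)"
      unfolding matrix_matrix_mult_def
      by (intro continuous_on_vec_lambda continuous_intros)
    then show "(\<lambda>n. u ** n ** v) \<in> borel \<rightarrow>\<^sub>M borel"
      by (rule borel_measurable_continuous_onI)
    show "(\<lambda>n. u ** n ** v) \<in> heis \<rightarrow> heis"
      using assms by (auto intro!: heis_mult_closed)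
  qed
  then show ?thesis
    using measurable_cong_sets[OF sets_haar sets_haar] by blast
qed

lemma nn_integral_lborel_shift:
  fixes c :: real
  assumes "f \<in> borel_measurable borel"
  shows "(\<integral>\<^sup>+x. f (x + c) \<partial>lborel) = (\<integral>\<^sup>+x. f x \<partial>lborel)"
  using nn_integral_real_affine[OF assms, of 1 c] by (simp add: add.commute)

text \<open>In coordinates, left and right multiplications of the group are maps of this form.\<close>

lemma lborel_shear:
  fixes p q r \<alpha> \<beta> :: real
  shows "distr lborel lborel (\<lambda>(x, y, z). (x + p, y + q, z + (r + \<alpha> * x + \<beta> * y)))
    = (lborel :: (real \<times> real \<times> real) measure)" (is "distr _ _ ?\<sigma> = _")
proof (rule measure_eqI)
  fix A assume "A \<in> sets (distr lborel lborel ?\<sigma>)"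
  then have A[measurable]: "A \<in> sets (borel :: (real \<times> real \<times> real) measure)" by simp
  have "continuous_on UNIV ?\<sigma>"
    by (auto simp: case_prod_beta intro!: continuous_intros)
  then have \<sigma>[measurable]: "?\<sigma> \<in> borel \<rightarrow>\<^sub>M borel"
    by (rule borel_measurable_continuous_onI)
  define g where "g = (indicator A :: real \<times> real \<times> real \<Rightarrow> ennreal)"
  have g[measurable]: "g \<in> borel_measurable borel" unfolding g_def by measurable
  have iter: "(\<integral>\<^sup>+v. h v \<partial>lborel) = (\<integral>\<^sup>+x. \<integral>\<^sup>+y. \<integral>\<^sup>+z. h (x, y, z) \<partial>lborel \<partial>lborel \<partial>lborel)"
    if h: "h \<in> borel_measurable borel" for h :: "real \<times> real \<times> real \<Rightarrow> ennreal"
  proof -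
    have hm: "h \<in> borel_measurable (lborel \<Otimes>\<^sub>M lborel)"
      using h by (simp add: lborel_prod)
    have "(\<integral>\<^sup>+v. h v \<partial>lborel) = (\<integral>\<^sup>+v. h v \<partial>(lborel \<Otimes>\<^sub>M lborel))"
      by (simp add: lborel_prod)
    also have "\<dots> = (\<integral>\<^sup>+x. \<integral>\<^sup>+w. h (x, w) \<partial>lborel \<partial>lborel)"
      by (rule lborel.nn_integral_fst[OF hm, symmetric])
    also have "\<dots> = (\<integral>\<^sup>+x. \<integral>\<^sup>+y. \<integral>\<^sup>+z. h (x, y, z) \<partial>lborel \<partial>lborel \<partial>lborel)"
    proof (intro nn_integral_cong)
      fix x
      have hx: "(\<lambda>w. h (x, w)) \<in> borel_measurable (lborel \<Otimes>\<^sub>M lborel)"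
      proof -
        have "(\<lambda>w. h (x, w)) \<in> borel_measurable borel"
          using h by (rule measurable_compose[rotated]) (auto intro!: borel_measurable_continuous_onI continuous_intros)
        then show ?thesis by (simp add: lborel_prod)
      qed
      have "(\<integral>\<^sup>+w. h (x, w) \<partial>lborel) = (\<integral>\<^sup>+w. h (x, w) \<partial>(lborel \<Otimes>\<^sub>M lborel))"
        by (simp add: lborel_prod)
      also have "\<dots> = (\<integral>\<^sup>+y. \<integral>\<^sup>+z. h (x, y, z) \<partial>lborel \<partial>lborel)"
        by (rule lborel.nn_integral_fst[OF hx, symmetric])
      finally show "(\<integral>\<^sup>+w. h (x, w) \<partial>lborel) = (\<integral>\<^sup>+y. \<integral>\<^sup>+z. h (x, y, z) \<partial>lborel \<partial>lborel)" .
    qed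
    finally show ?thesis .
  qed
  have gz: "(\<lambda>z. g (x, y, z)) \<in> borel_measurable borel" for x y
    using g by (rule measurable_compose[rotated]) (auto intro!: borel_measurable_continuous_onI continuous_intros)
  have "g \<in> borel_measurable (lborel \<Otimes>\<^sub>M (lborel \<Otimes>\<^sub>M lborel))"
    using g by (simp add: lborel_prod)
  then have gyz: "(\<lambda>(x, y). \<integral>\<^sup>+z. g (x, y, z) \<partial>lborel) \<in> borel_measurable (lborel \<Otimes>\<^sub>M lborel)"
    by measurable
  have gy: "(\<lambda>y. \<integral>\<^sup>+z. g (x, y, z) \<partial>lborel) \<in> borel_measurable borel" for x
    using measurable_compose[OF measurable_Pair1'[of x lborel lborel] gyz] by simp
  have gx: "(\<lambda>x. \<integral>\<^sup>+y. \<integral>\<^sup>+z. g (x, y, z) \<partial>lborel \<partial>lborel) \<in> borel_measurable borel"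
    using lborel.borel_measurable_nn_integral_fst[OF gyz] by simp
  have "emeasure (distr lborel lborel ?\<sigma>) A = (\<integral>\<^sup>+v. g (?\<sigma> v) \<partial>lborel)"
  proof -
    have "emeasure (distr lborel lborel ?\<sigma>) A = (\<integral>\<^sup>+v. g v \<partial>(distr lborel lborel ?\<sigma>))"
      by (simp add: g_def)
    also have "\<dots> = (\<integral>\<^sup>+v. g (?\<sigma> v) \<partial>lborel)"
      by (rule nn_integral_distr) (use \<sigma> g in simp_all)
    finally show ?thesis .
  qed
  also have "\<dots> = (\<integral>\<^sup>+x. \<integral>\<^sup>+y. \<integral>\<^sup>+z. g (x + p, y + q, z + (r + \<alpha> * x + \<beta> * y)) \<partial>lborel \<partial>lborel \<partial>lborel)"
    by (subst iter) (auto intro: measurable_compose[OF \<sigma> g])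
  \<comment> \<open>The innermost integral runs over z, and for fixed x and y the shear is a
    translation of z. Only after it has been removed can y and x be shifted.\<close>
  also have "\<dots> = (\<integral>\<^sup>+x. \<integral>\<^sup>+y. \<integral>\<^sup>+z. g (x + p, y + q, z) \<partial>lborel \<partial>lborel \<partial>lborel)"
    by (subst nn_integral_lborel_shift[OF gz]) simp
  also have "\<dots> = (\<integral>\<^sup>+x. \<integral>\<^sup>+y. \<integral>\<^sup>+z. g (x + p, y, z) \<partial>lborel \<partial>lborel \<partial>lborel)"
    by (subst nn_integral_lborel_shift[OF gy]) simp
  also have "\<dots> = (\<integral>\<^sup>+x. \<integral>\<^sup>+y. \<integral>\<^sup>+z. g (x, y, z) \<partial>lborel \<partial>lborel \<partial>lborel)"
    by (subst nn_integral_lborel_shift[OF gx]) simp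
  also have "\<dots> = (\<integral>\<^sup>+v. g v \<partial>lborel)"
    by (rule iter[OF g, symmetric])
  also have "\<dots> = emeasure lborel A"
    by (simp add: g_def)
  finally show "emeasure (distr lborel lborel ?\<sigma>) A = emeasure lborel A" .
qed simp

text \<open>Left and right invariance in one computation: the third coordinate of
  \<open>u ** n ** v\<close> is that of n plus a constant plus \<open>b' * x + a * y\<close>, which
  is the shape of \<open>lborel_shear\<close>.\<close>

lemma haar_invariant:
  assumes "u \<in> heis" "v \<in> heis"
  shows "distr haar haar (\<lambda>n. u ** n ** v) = haar"
proof -
  obtain a b c where u: "u = heis_mat a b c" using assms(1) by (rule heisE)
  obtain a' b' c' where v: "v = heis_mat a' b' c'" using assms(2) by (rule heisE)
  define hm where "hm = (\<lambda>(x, y, z). heis_mat x y z)"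
  define R where "R = restrict_space borel heis"
  define \<sigma> :: "real \<times> real \<times> real \<Rightarrow> real \<times> real \<times> real"
    where "\<sigma> = (\<lambda>(x, y, z). (x + (a + a'), y + (b + b'), z + ((c + c' + a * b') + b' * x + a * y)))"
  have hm: "hm \<in> (lborel :: (real \<times> real \<times> real) measure) \<rightarrow>\<^sub>M R"
    unfolding hm_def R_def by (rule heis_mat_measurable)
  have haar: "haar = distr lborel R hm"
    by (simp add: haar_def R_def hm_def)
  have "continuous_on UNIV \<sigma>"
    by (auto simp: \<sigma>_def case_prod_beta intro!: continuous_intros)
  then have \<sigma>: "\<sigma> \<in> lborel \<rightarrow>\<^sub>M lborel"
    by (simp add: borel_measurable_continuous_onI)
  have m: "(\<lambda>n. u ** n ** v) \<in> R \<rightarrow>\<^sub>M R"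
    using heis_mult_measurable[OF assms] measurable_cong_sets[OF sets_haar sets_haar]
    by (simp add: R_def)
  have comp: "(\<lambda>n. u ** n ** v) \<circ> hm = hm \<circ> \<sigma>"
    by (auto simp: hm_def \<sigma>_def u v heis_mat_mult fun_eq_iff algebra_simps)
  have "distr haar haar (\<lambda>n. u ** n ** v) = distr haar R (\<lambda>n. u ** n ** v)"
    by (intro distr_cong) (auto simp: R_def sets_haar)
  also have "\<dots> = distr lborel R (hm \<circ> \<sigma>)"
    unfolding haar comp[symmetric] by (rule distr_distr[OF m hm])
  also have "\<dots> = distr (distr lborel lborel \<sigma>) R hm"
    by (rule distr_distr[OF hm \<sigma>, symmetric])
  also have "distr lborel lborel \<sigma> = lborel"
    unfolding \<sigma>_def by (rule lborel_shear)
  finally show ?thesis by (simp add: haar)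
qed

text \<open>For a non-measurable integrand both sides are the junk value 0, because the translation is
  invertible.\<close>

lemma haar_integral_invariant:
  fixes F :: "mat4 \<Rightarrow> complex"
  assumes "u \<in> heis" "v \<in> heis"
  shows "(\<integral>n. F (u ** n ** v) \<partial>haar) = (\<integral>n. F n \<partial>haar)"
proof (cases "F \<in> borel_measurable haar")
  case True
  have "(\<integral>n. F n \<partial>haar) = (\<integral>n. F n \<partial>(distr haar haar (\<lambda>n. u ** n ** v)))"
    by (simp add: haar_invariant[OF assms])
  also have "\<dots> = (\<integral>n. F (u ** n ** v) \<partial>haar)"
    by (rule integral_distr[OF heis_mult_measurable[OF assms] True])
  finally show ?thesis by simp
next
  case False
  have "(\<lambda>n. F (u ** n ** v)) \<notin> borel_measurable haar"
  proof
    assume *: "(\<lambda>n. F (u ** n ** v)) \<in> borel_measurable haar"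
    have "(\<lambda>n. F (u ** (matrix_inv u ** n ** matrix_inv v) ** v)) \<in> borel_measurable haar"
      by (rule measurable_compose[OF heis_mult_measurable *]) (simp_all add: assms matrix_inv_heis)
    moreover have "u ** (matrix_inv u ** n ** matrix_inv v) ** v = n" for n
      using assms by (simp add: matrix_mul_assoc matrix_inv_heis)
        (simp add: matrix_mul_assoc[symmetric] matrix_inv_heis)
    ultimately show False using False by simp
  qed
  then have "\<not> integrable haar (\<lambda>n. F (u ** n ** v))" by auto
  moreover have "\<not> integrable haar F" using False by auto
  ultimately show ?thesis by (simp add: not_integrable_integral_eq)
qed

lemma biregular_eq: "biregular u v f = (\<lambda>n. f (matrix_inv u ** n ** v))"
  by (simp add: biregular_def left_reg_def right_reg_def)

lemma biregular_L2:
  assumes f: "f \<in> L2 haar" and uv: "u \<in> heis" "v \<in> heis"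
  shows "biregular u v f \<in> L2 haar" "L2_norm haar (biregular u v f) = L2_norm haar f"
proof -
  note m = heis_mult_measurable[OF matrix_inv_heis(1)[OF uv(1)] uv(2)]
  note inv = haar_invariant[OF matrix_inv_heis(1)[OF uv(1)] uv(2)]
  have fm: "f \<in> borel_measurable haar" and fi: "integrable haar (\<lambda>n. (cmod (f n))\<^sup>2)"
    using f by (auto simp: L2_def)
  have "integrable haar (\<lambda>n. (cmod (f (matrix_inv u ** n ** v)))\<^sup>2)"
    using integrable_distr[OF m, of "\<lambda>n. (cmod (f n))\<^sup>2"] fi by (simp add: inv)
  then show "biregular u v f \<in> L2 haar"
    using measurable_compose[OF m fm] by (simp add: L2_def biregular_eq)
  have "(\<integral>n. (cmod (f n))\<^sup>2 \<partial>haar) = (\<integral>n. (cmod (f n))\<^sup>2 \<partial>(distr haar haar (\<lambda>n. matrix_inv u ** n ** v)))"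
    by (simp add: inv)
  also have "\<dots> = (\<integral>n. (cmod (biregular u v f n))\<^sup>2 \<partial>haar)"
    unfolding biregular_eq using fm by (intro integral_distr[OF m]) auto
  finally show "L2_norm haar (biregular u v f) = L2_norm haar f"
    by (simp add: L2_norm_def)
qed

lemma biregular_integrable:
  assumes f: "integrable haar f" and uv: "u \<in> heis" "v \<in> heis"
  shows "integrable haar (biregular u v f)"
  using integrable_distr[OF heis_mult_measurable[OF matrix_inv_heis(1)[OF uv(1)] uv(2)], of f] f
    haar_invariant[OF matrix_inv_heis(1)[OF uv(1)] uv(2)]
  by (simp add: biregular_eq)

section \<open>The representations on the line\<close>

lemma heis_rep_mult:
  assumes "u \<in> heis" "v \<in> heis"
  shows "heis_rep l (u ** v) \<phi> = heis_rep l u (heis_rep l v \<phi>)"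
proof
  fix t
  obtain a b c where u: "u = heis_mat a b c" using assms(1) by (rule heisE)
  obtain a' b' c' where v: "v = heis_mat a' b' c'" using assms(2) by (rule heisE)
  \<comment> \<open>The cross term \<open>a * b'\<close> of the group law supplies the phase that
    arises because the inner operator is evaluated at \<open>t - a\<close>.\<close>
  have "cis (2 * pi * l * (c + c' + a * b')) * cis (- 2 * pi * l * (b + b') * t)
      = cis (2 * pi * l * c) * cis (- 2 * pi * l * b * t) * (cis (2 * pi * l * c') * cis (- 2 * pi * l * b' * (t - a)))"
    by (simp add: cis_mult algebra_simps)
  then show "heis_rep l (u ** v) \<phi> t = heis_rep l u (heis_rep l v \<phi>) t"
    by (simp add: u v heis_mat_mult heis_rep_heis_mat diff_diff_eq mult.assoc)
qed

lemma heis_rep_mat_1: "heis_rep l (mat 1) \<phi> = \<phi>"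
  by (simp add: heis_mat_0[symmetric] heis_rep_heis_mat fun_eq_iff)

lemma heis_rep_inv:
  assumes "u \<in> heis"
  shows "heis_rep l u (heis_rep l (matrix_inv u) \<phi>) = \<phi>" "heis_rep l (matrix_inv u) (heis_rep l u \<phi>) = \<phi>"
  using assms by (simp_all add: heis_rep_mult[symmetric] matrix_inv_heis heis_rep_mat_1)

lemma lborel_integral_shift:
  fixes f :: "real \<Rightarrow> complex"
  shows "(\<integral>t. f (t - x) \<partial>lborel) = (\<integral>t. f t \<partial>lborel)"
  using lborel_integral_real_affine[of 1 f "- x"] by simp

lemma heis_rep_L2:
  assumes "u \<in> heis" and \<phi>: "\<phi> \<in> L2 lborel"
  shows "heis_rep l u \<phi> \<in> L2 lborel"
proof -
  obtain a b c where u: "u = heis_mat a b c" using assms(1) by (rule heisE)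
  have [measurable]: "\<phi> \<in> borel_measurable borel" and i: "integrable lborel (\<lambda>t. (cmod (\<phi> t))\<^sup>2)"
    using \<phi> by (auto simp: L2_def)
  have "heis_rep l u \<phi> \<in> borel_measurable lborel"
    unfolding u heis_rep_heis_mat[abs_def] by measurable
  moreover have "integrable lborel (\<lambda>t. (cmod (heis_rep l u \<phi> t))\<^sup>2)"
    using lborel_integrable_real_affine[OF i, of 1 "- a"] by (simp add: u heis_rep_heis_mat norm_mult)
  ultimately show ?thesis by (simp add: L2_def)
qed

lemma heis_rep_unitary:
  assumes "u \<in> heis"
  shows "L2_inner lborel (heis_rep l u \<phi>) (heis_rep l u \<psi>) = L2_inner lborel \<phi> \<psi>"
proof -
  obtain a b c where u: "u = heis_mat a b c" using assms by (rule heisE)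
  have cc: "cis s * cnj (cis s) = 1" for s
    by (simp add: cis_cnj cis_mult)
  have "heis_rep l u \<phi> t * cnj (heis_rep l u \<psi> t)
      = (cis (2 * pi * l * c) * cnj (cis (2 * pi * l * c))) * (cis (- 2 * pi * l * b * t) * cnj (cis (- 2 * pi * l * b * t)))
        * (\<phi> (t - a) * cnj (\<psi> (t - a)))" for t
    by (simp add: u heis_rep_heis_mat mult_ac)
  then have "heis_rep l u \<phi> t * cnj (heis_rep l u \<psi> t) = \<phi> (t - a) * cnj (\<psi> (t - a))" for t
    unfolding cc by simp
  then show ?thesis
    using lborel_integral_shift[of "\<lambda>t. \<phi> t * cnj (\<psi> t)" a] by (simp add: L2_inner_def)
qed

lemma heis_rep_norm:
  assumes "u \<in> heis"
  shows "L2_norm lborel (heis_rep l u \<phi>) = L2_norm lborel \<phi>"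
  using heis_rep_unitary[OF assms, of l \<phi> \<phi>] by (simp add: L2sp_nrm[symmetric] L2sp.nrm_def)

lemma heis_rep_plus: "heis_rep l u (\<phi> + \<psi>) = heis_rep l u \<phi> + heis_rep l u \<psi>"
  by (auto simp: heis_rep_def fun_eq_iff distrib_left)

lemma l2_operator_heis_rep:
  assumes "u \<in> heis"
  shows "l2_operator (heis_rep l u)"
  unfolding l2_operator_def
proof (intro conjI ballI allI exI)
  show "L2_norm lborel (heis_rep l u \<phi>) \<le> 1 * L2_norm lborel \<phi>" for \<phi>
    by (simp add: heis_rep_norm[OF assms])
qed (use heis_rep_L2[OF assms] in \<open>auto simp: heis_rep_def distrib_left\<close>)

lemma heis_rep_adjoint:
  assumes u: "u \<in> heis"
  shows "L2_inner lborel (heis_rep l u \<phi>) \<psi> = L2_inner lborel \<phi> (heis_rep l (matrix_inv u) \<psi>)"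
  using heis_rep_unitary[OF u, of l \<phi> "heis_rep l (matrix_inv u) \<psi>"] by (simp add: heis_rep_inv[OF u])

lemma L2_inner_ext:
  assumes \<phi>: "\<phi> \<in> L2 M" and \<psi>: "\<psi> \<in> L2 M"
    and eq: "\<And>\<xi>. \<xi> \<in> L2 M \<Longrightarrow> L2_inner M \<phi> \<xi> = L2_inner M \<psi> \<xi>"
  shows "AE x in M. \<phi> x = \<psi> x"
proof -
  have d: "\<phi> - \<psi> \<in> L2 M" using \<phi> \<psi> by (rule L2sp.diff_mem)
  have "L2_inner M (\<phi> - \<psi>) (\<phi> - \<psi>) = 0"
    using eq[OF d] L2sp.ip_diff_left[OF \<phi> \<psi> d] by simp
  then have "L2_norm M (\<phi> - \<psi>) = 0"
    using L2sp_nrm[of M "\<phi> - \<psi>"] by (simp add: L2sp.nrm_def)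
  then have "AE x in M. (\<phi> - \<psi>) x = 0"
    by (rule L2_norm_eq_0_imp_AE[OF d])
  then show ?thesis by eventually_elim simp
qed

text \<open>\<open>l2_adjoint\<close> is a choice among operators that agree only up to
  \<open>op_eq\<close>. The operator of the inverse element shows that an adjoint exists, and
  testing against all square-integrable functions identifies the chosen one with it.\<close>

lemma l2_adjoint_heis_rep:
  assumes u: "u \<in> heis"
  shows "l2_operator (l2_adjoint (heis_rep l u))"
    and "op_eq (l2_adjoint (heis_rep l u)) (heis_rep l (matrix_inv u))"
proof -
  let ?adj = "\<lambda>S. l2_operator S \<and> (\<forall>\<phi>\<in>L2 lborel. \<forall>\<psi>\<in>L2 lborel.
      L2_inner lborel (heis_rep l u \<phi>) \<psi> = L2_inner lborel \<phi> (S \<psi>))"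
  have "?adj (heis_rep l (matrix_inv u))"
    using l2_operator_heis_rep matrix_inv_heis(1)[OF u] heis_rep_adjoint[OF u] by blast
  then have adj: "?adj (l2_adjoint (heis_rep l u))"
    unfolding l2_adjoint_def by (rule someI[where P = ?adj])
  then show op: "l2_operator (l2_adjoint (heis_rep l u))" by blast
  show "op_eq (l2_adjoint (heis_rep l u)) (heis_rep l (matrix_inv u))"
    unfolding op_eq_def
  proof
    fix \<psi> :: "real \<Rightarrow> complex" assume \<psi>: "\<psi> \<in> L2 lborel"
    have m: "l2_adjoint (heis_rep l u) \<psi> \<in> L2 lborel" "heis_rep l (matrix_inv u) \<psi> \<in> L2 lborel"
      using op \<psi> u by (auto intro: l2_operator_mem heis_rep_L2 matrix_inv_heis)
    show "AE t in lborel. l2_adjoint (heis_rep l u) \<psi> t = heis_rep l (matrix_inv u) \<psi> t"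
    proof (rule L2_inner_ext[OF m])
      fix \<xi> :: "real \<Rightarrow> complex" assume \<xi>: "\<xi> \<in> L2 lborel"
      have "L2_inner lborel \<xi> (l2_adjoint (heis_rep l u) \<psi>) = L2_inner lborel \<xi> (heis_rep l (matrix_inv u) \<psi>)"
        using adj \<psi> \<xi> heis_rep_adjoint[OF u, of l \<xi> \<psi>] by simp
      then show "L2_inner lborel (l2_adjoint (heis_rep l u) \<psi>) \<xi> = L2_inner lborel (heis_rep l (matrix_inv u) \<psi>) \<xi>"
        using L2sp.ip_cnj[OF \<xi> m(1)] L2sp.ip_cnj[OF \<xi> m(2)] by simp
    qed
  qed
qed

lemma rep_tensor_apply: "rep_tensor l u v T \<phi> = heis_rep l u (T (l2_adjoint (heis_rep l v) \<phi>))"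
  by (simp add: rep_tensor_def)

lemma rep_tensor_L2:
  assumes "u \<in> heis" "v \<in> heis" "l2_operator T" "\<phi> \<in> L2 lborel"
  shows "rep_tensor l u v T \<phi> \<in> L2 lborel"
  unfolding rep_tensor_apply using assms
  by (intro heis_rep_L2[OF assms(1)] l2_operator_mem[OF assms(3)] l2_operator_mem[OF l2_adjoint_heis_rep(1)])

lemma rep_tensor_op_eq_inv:
  assumes u: "u \<in> heis" and v: "v \<in> heis" and T: "l2_operator T"
  shows "op_eq (rep_tensor l u v T) (\<lambda>\<phi>. heis_rep l u (T (heis_rep l (matrix_inv v) \<phi>)))"
  unfolding op_eq_def rep_tensor_apply
proof
  fix \<phi> :: "real \<Rightarrow> complex" assume \<phi>: "\<phi> \<in> L2 lborel"
  have m: "l2_adjoint (heis_rep l v) \<phi> \<in> L2 lborel" "heis_rep l (matrix_inv v) \<phi> \<in> L2 lborel"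
    using \<phi> v by (auto intro: l2_operator_mem l2_adjoint_heis_rep heis_rep_L2 matrix_inv_heis)
  have "AE t in lborel. l2_adjoint (heis_rep l v) \<phi> t = heis_rep l (matrix_inv v) \<phi> t"
    using l2_adjoint_heis_rep(2)[OF v] \<phi> by (simp add: op_eq_def)
  then have "AE t in lborel. T (l2_adjoint (heis_rep l v) \<phi>) t = T (heis_rep l (matrix_inv v) \<phi>) t"
    by (rule l2_operator_cong_AE[OF T m])
  then show "AE t in lborel. heis_rep l u (T (l2_adjoint (heis_rep l v) \<phi>)) t
      = heis_rep l u (T (heis_rep l (matrix_inv v) \<phi>)) t"
    by (rule l2_operator_cong_AE[OF l2_operator_heis_rep[OF u] l2_operator_mem[OF T m(1)] l2_operator_mem[OF T m(2)]])
qed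

lemma rep_tensor_op_eq:
  assumes u: "u \<in> heis" and v: "v \<in> heis" and S: "l2_operator S" and T: "l2_operator T" and eq: "op_eq S T"
  shows "op_eq (rep_tensor l u v S) (rep_tensor l u v T)"
  unfolding op_eq_def rep_tensor_apply
proof
  fix \<phi> :: "real \<Rightarrow> complex" assume \<phi>: "\<phi> \<in> L2 lborel"
  have m: "l2_adjoint (heis_rep l v) \<phi> \<in> L2 lborel"
    using \<phi> v by (auto intro: l2_operator_mem l2_adjoint_heis_rep)
  then have "AE t in lborel. S (l2_adjoint (heis_rep l v) \<phi>) t = T (l2_adjoint (heis_rep l v) \<phi>) t"
    using eq by (simp add: op_eq_def)
  then show "AE t in lborel. heis_rep l u (S (l2_adjoint (heis_rep l v) \<phi>)) t
      = heis_rep l u (T (l2_adjoint (heis_rep l v) \<phi>)) t"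
    by (rule l2_operator_cong_AE[OF l2_operator_heis_rep[OF u] l2_operator_mem[OF S m] l2_operator_mem[OF T m]])
qed

lemma rep_tensor_plus: "rep_tensor l u v (S + T) = rep_tensor l u v S + rep_tensor l u v T"
  by (rule ext) (simp add: rep_tensor_apply heis_rep_plus)

lemma rep_tensor_zero: "rep_tensor l u v 0 = 0"
  by (intro ext) (simp add: rep_tensor_apply heis_rep_def)

text \<open>An estimate on single vectors: it follows from the norm preservation of
  \<open>heis_rep\<close>, whereas the Hilbert-Schmidt norm of the conjugated operator would involve
  a change of basis.\<close>

lemma rep_tensor_norm_le:
  assumes u: "u \<in> heis" and v: "v \<in> heis" and T: "T \<in> hs_ops" and \<phi>: "\<phi> \<in> L2 lborel"
  shows "L2_norm lborel (rep_tensor l u v T \<phi>) \<le> hs_norm T * L2_norm lborel \<phi>"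
proof -
  have m: "l2_adjoint (heis_rep l v) \<phi> \<in> L2 lborel" "heis_rep l (matrix_inv v) \<phi> \<in> L2 lborel"
    using \<phi> v by (auto intro: l2_operator_mem l2_adjoint_heis_rep heis_rep_L2 matrix_inv_heis)
  have "L2_norm lborel (rep_tensor l u v T \<phi>) \<le> hs_norm T * L2_norm lborel (l2_adjoint (heis_rep l v) \<phi>)"
    unfolding rep_tensor_apply heis_rep_norm[OF u] by (rule hs_norm_bound[OF T m(1)])
  also have "L2_norm lborel (l2_adjoint (heis_rep l v) \<phi>) = L2_norm lborel (heis_rep l (matrix_inv v) \<phi>)"
    using l2_adjoint_heis_rep(2)[OF v] \<phi> by (intro L2_norm_cong_AE m) (simp add: op_eq_def)
  also have "\<dots> = L2_norm lborel \<phi>"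
    by (rule heis_rep_norm[OF matrix_inv_heis(1)[OF v]])
  finally show ?thesis .
qed

text \<open>The substitution of \<open>u ** n ** matrix_inv v\<close> for n undoes the translation
  of f and puts u and the inverse of v into the representation. The operator of u is then moved to
  the second argument as an adjoint, and that of the inverse of v is applied to the first.\<close>

lemma has_heis_fourier_biregular:
  assumes u: "u \<in> heis" and v: "v \<in> heis"
    and T: "has_heis_fourier f l T" and T': "has_heis_fourier (biregular u v f) l T'"
  shows "op_eq T' (rep_tensor l u v T)"
proof -
  have opT: "l2_operator T" and opT': "l2_operator T'"
    using T T' by (auto simp: has_heis_fourier_def)
  note ui = matrix_inv_heis(1)[OF u] and vi = matrix_inv_heis(1)[OF v]
  define R where "R = (\<lambda>\<phi>. heis_rep l u (T (heis_rep l (matrix_inv v) \<phi>)))"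
  have "op_eq T' R"
    unfolding op_eq_def
  proof
    fix \<phi> :: "real \<Rightarrow> complex" assume \<phi>: "\<phi> \<in> L2 lborel"
    have v\<phi>: "heis_rep l (matrix_inv v) \<phi> \<in> L2 lborel" by (rule heis_rep_L2[OF vi \<phi>])
    show "AE t in lborel. T' \<phi> t = R \<phi> t"
    proof (rule L2_inner_ext)
      show "T' \<phi> \<in> L2 lborel" by (rule l2_operator_mem[OF opT' \<phi>])
      show "R \<phi> \<in> L2 lborel"
        unfolding R_def by (intro heis_rep_L2[OF u] l2_operator_mem[OF opT v\<phi>])
      fix \<psi> :: "real \<Rightarrow> complex" assume \<psi>: "\<psi> \<in> L2 lborel"
      have u\<psi>: "heis_rep l (matrix_inv u) \<psi> \<in> L2 lborel" by (rule heis_rep_L2[OF ui \<psi>])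
      have "L2_inner lborel (T' \<phi>) \<psi> = (\<integral>n. biregular u v f n * L2_inner lborel (heis_rep l n \<phi>) \<psi> \<partial>haar)"
        using T' \<phi> \<psi> by (simp add: has_heis_fourier_def)
      also have "\<dots> = (\<integral>n. biregular u v f (u ** n ** matrix_inv v)
          * L2_inner lborel (heis_rep l (u ** n ** matrix_inv v) \<phi>) \<psi> \<partial>haar)"
        by (rule haar_integral_invariant[OF u vi, symmetric])
      also have "\<dots> = (\<integral>n. f n * L2_inner lborel (heis_rep l n (heis_rep l (matrix_inv v) \<phi>))
          (heis_rep l (matrix_inv u) \<psi>) \<partial>haar)"
      proof (rule Bochner_Integration.integral_cong[OF refl])
        fix n assume "n \<in> space haar"
        then have n: "n \<in> heis" by (simp add: space_haar)
        have "matrix_inv u ** (u ** n ** matrix_inv v) ** v = n"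
          using matrix_inv_heis[OF u] matrix_inv_heis[OF v]
          by (simp add: matrix_mul_assoc) (simp add: matrix_mul_assoc[symmetric])
        then have "biregular u v f (u ** n ** matrix_inv v) = f n"
          by (simp add: biregular_eq)
        moreover have "heis_rep l (u ** n ** matrix_inv v) \<phi> = heis_rep l u (heis_rep l n (heis_rep l (matrix_inv v) \<phi>))"
          using u n vi by (simp add: heis_rep_mult heis_mult_closed)
        ultimately show "biregular u v f (u ** n ** matrix_inv v) * L2_inner lborel (heis_rep l (u ** n ** matrix_inv v) \<phi>) \<psi>
            = f n * L2_inner lborel (heis_rep l n (heis_rep l (matrix_inv v) \<phi>)) (heis_rep l (matrix_inv u) \<psi>)"
          by (simp add: heis_rep_adjoint[OF u])
      qed
      also have "\<dots> = L2_inner lborel (T (heis_rep l (matrix_inv v) \<phi>)) (heis_rep l (matrix_inv u) \<psi>)"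
        using T v\<phi> u\<psi> by (simp add: has_heis_fourier_def)
      also have "\<dots> = L2_inner lborel (R \<phi>) \<psi>"
        by (simp add: R_def heis_rep_adjoint[OF u])
      finally show "L2_inner lborel (T' \<phi>) \<psi> = L2_inner lborel (R \<phi>) \<psi>" .
    qed
  qed
  then show ?thesis
    using rep_tensor_op_eq_inv[OF u v opT, of l] op_eq_trans op_eq_sym unfolding R_def by blast
qed

section \<open>Covariance of the Plancherel transform\<close>

text \<open>The weight vanishes only at 0, which is a null point.\<close>

lemma AE_plancherel_measure: "(AE l in plancherel_measure. Q l) \<longleftrightarrow> (AE l in lborel. Q l)"
proof -
  have "(AE l in plancherel_measure. Q l) \<longleftrightarrow> (AE l in lborel. 0 < \<bar>l::real\<bar> \<longrightarrow> Q l)"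
    unfolding plancherel_measure_def by (subst AE_density) auto
  also have "\<dots> \<longleftrightarrow> (AE l in lborel. Q l)"
  proof
    assume *: "AE l in lborel. 0 < \<bar>l\<bar> \<longrightarrow> Q l"
    show "AE l in lborel. Q l"
      using * AE_lborel_singleton[of 0] by eventually_elim auto
  qed (auto elim: eventually_mono)
  finally show ?thesis .
qed

lemma sets_plancherel_measure [measurable_cong]: "sets plancherel_measure = sets borel"
  by (simp add: plancherel_measure_def)

section \<open>Truncation of square-integrable functions to boxes in the group\<close>

definition heis_box :: "nat \<Rightarrow> mat4 set" where
  "heis_box k = {n \<in> heis. \<bar>n $ 1 $ 2\<bar> \<le> real k \<and> \<bar>n $ 2 $ 4\<bar> \<le> real k \<and> \<bar>n $ 1 $ 4\<bar> \<le> real k}"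

lemma heis_box_sets: "heis_box k \<in> sets haar"
proof -
  have "(\<lambda>n :: mat4. n $ i $ j) \<in> borel_measurable borel" for i j
    by (intro borel_measurable_continuous_onI continuous_intros)
  then have [measurable]: "(\<lambda>n :: mat4. n $ i $ j) \<in> borel_measurable haar" for i j
    unfolding measurable_cong_sets[OF sets_haar refl] by (rule measurable_restrict_space1)
  have "{n \<in> space haar. \<bar>n $ 1 $ 2\<bar> \<le> real k \<and> \<bar>n $ 2 $ 4\<bar> \<le> real k \<and> \<bar>n $ 1 $ 4\<bar> \<le> real k} \<in> sets haar"
    by measurable
  then show ?thesis by (simp add: heis_box_def space_haar)
qed

lemma heis_box_finite: "emeasure haar (heis_box k) < \<infinity>"
proof -
  have "heis_box k \<in> sets (restrict_space borel heis)"
    using heis_box_sets sets_haar by blast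
  then have "emeasure haar (heis_box k) = emeasure lborel ((\<lambda>(x, y, z). heis_mat x y z) -` heis_box k \<inter> space lborel)"
    unfolding haar_def by (rule emeasure_distr[OF heis_mat_measurable])
  also have "(\<lambda>(x, y, z). heis_mat x y z) -` heis_box k \<inter> space lborel
      = cbox (- real k, - real k, - real k) (real k, real k, real k)"
    by (auto simp: heis_box_def heis_mat_entries cbox_Pair_eq)
  also have "emeasure lborel \<dots> < \<infinity>"
    by (simp add: emeasure_lborel_cbox_eq)
  finally show ?thesis .
qed

lemma heis_box_exhausts: "n \<in> heis \<Longrightarrow> \<forall>\<^sub>F k in sequentially. n \<in> heis_box k"
proof -
  assume n: "n \<in> heis"
  define m where "m = max \<bar>n $ 1 $ 2\<bar> (max \<bar>n $ 2 $ 4\<bar> \<bar>n $ 1 $ 4\<bar>)"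
  obtain N :: nat where "m \<le> real N"
    using real_arch_simple by blast
  then have "\<forall>\<^sub>F k in sequentially. m \<le> real k"
    unfolding eventually_sequentially by (intro exI[of _ N]) auto
  then show ?thesis
    by eventually_elim (use n in \<open>auto simp: heis_box_def m_def\<close>)
qed

text \<open>The Fourier integral is given for integrable functions only. On a box, which has finite
  measure, square-integrability gives integrability by \<open>x \<le> 1 + x\<^sup>2\<close>, and
  dominated convergence removes the box.\<close>

lemma L2_haar_truncate:
  assumes f: "f \<in> L2 haar"
  defines "g \<equiv> \<lambda>k n. indicator (heis_box k) n * f n"
  shows "g k \<in> L2 haar" "integrable haar (g k)" "f - g k \<in> L2 haar"
    and "(\<lambda>k. (L2_norm haar (f - g k))\<^sup>2) \<longlonglongrightarrow> 0"
proof -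
  have fm[measurable]: "f \<in> borel_measurable haar" and fi: "integrable haar (\<lambda>n. (cmod (f n))\<^sup>2)"
    using f by (auto simp: L2_def)
  note [measurable] = heis_box_sets
  have gm[measurable]: "g k \<in> borel_measurable haar" for k
    unfolding g_def by measurable
  have "integrable haar (\<lambda>n. (cmod (g k n))\<^sup>2)" for k
    by (rule Bochner_Integration.integrable_bound[OF fi])
       (auto simp: g_def indicator_def)
  then show gL: "g k \<in> L2 haar" for k
    by (simp add: L2_def)
  show "integrable haar (g k)"
  proof (rule Bochner_Integration.integrable_bound)
    show "integrable haar (\<lambda>n. indicator (heis_box k) n + (cmod (f n))\<^sup>2)"
      using heis_box_finite fi by (intro Bochner_Integration.integrable_add integrable_real_indicator heis_box_sets) auto
    have "x \<le> 1 + x\<^sup>2" for x :: real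
      using sum_squares_bound[of 1 x] zero_le_power2[of x] unfolding power_one mult_1_right by linarith
    then show "AE n in haar. norm (g k n) \<le> norm (indicat_real (heis_box k) n + (cmod (f n))\<^sup>2)"
      by (auto simp: g_def indicator_def)
  qed simp
  show fg: "f - g k \<in> L2 haar" for k
    by (rule L2sp.diff_mem[OF f gL])
  have "(\<lambda>k. \<integral>n. (cmod ((f - g k) n))\<^sup>2 \<partial>haar) \<longlonglongrightarrow> (\<integral>n. 0 \<partial>haar)"
  proof (rule integral_dominated_convergence[OF _ _ fi])
    show "(\<lambda>n. (cmod ((f - g k) n))\<^sup>2) \<in> borel_measurable haar" for k by simp
    show "AE n in haar. (\<lambda>k. (cmod ((f - g k) n))\<^sup>2) \<longlonglongrightarrow> 0"
    proof (rule AE_I2)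
      fix n assume "n \<in> space haar"
      then have "\<forall>\<^sub>F k in sequentially. n \<in> heis_box k"
        by (simp add: space_haar heis_box_exhausts)
      then have "\<forall>\<^sub>F k in sequentially. (cmod ((f - g k) n))\<^sup>2 = 0"
        by eventually_elim (simp add: g_def)
      then show "(\<lambda>k. (cmod ((f - g k) n))\<^sup>2) \<longlonglongrightarrow> 0"
        by (rule tendsto_eventually)
    qed
    show "AE n in haar. norm ((cmod ((f - g k) n))\<^sup>2) \<le> (cmod (f n))\<^sup>2" for k
      by (auto simp: g_def indicator_def)
  qed simp
  then show "(\<lambda>k. (L2_norm haar (f - g k))\<^sup>2) \<longlonglongrightarrow> 0"
    by (simp add: L2_norm_sq)
qed

locale plancherel =
  fixes P :: "(mat4 \<Rightarrow> complex) \<Rightarrow> real \<Rightarrow> l2_op"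
  assumes P: "plancherel_transform P"
begin

lemma P_direct_integral: "f \<in> L2 haar \<Longrightarrow> P f \<in> hs_direct_integral"
  using P by (simp add: plancherel_transform_def)

lemma P_hs_ops: "f \<in> L2 haar \<Longrightarrow> l \<noteq> 0 \<Longrightarrow> P f l \<in> hs_ops"
  using P_direct_integral by (auto simp: hs_direct_integral_def)

lemma AE_P_hs_ops: "f \<in> L2 haar \<Longrightarrow> AE l in lborel. P f l \<in> hs_ops"
  using AE_lborel_singleton[of 0] by eventually_elim (simp add: P_hs_ops)

lemma P_inner_measurable: "f \<in> L2 haar \<Longrightarrow> T \<in> hs_ops \<Longrightarrow> (\<lambda>l. hs_inner (P f l) T) \<in> borel_measurable borel"
  using P_direct_integral by (auto simp: hs_direct_integral_def)

lemma P_norm_integrable: "f \<in> L2 haar \<Longrightarrow> integrable plancherel_measure (\<lambda>l. (hs_norm (P f l))\<^sup>2)"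
  using P_direct_integral by (auto simp: hs_direct_integral_def)

lemma P_norm_measurable: "f \<in> L2 haar \<Longrightarrow> (\<lambda>l. (hs_norm (P f l))\<^sup>2) \<in> borel_measurable borel"
  using borel_measurable_integrable[OF P_norm_integrable]
  by (simp add: measurable_cong_sets[OF sets_plancherel_measure refl])

lemma P_add: "f \<in> L2 haar \<Longrightarrow> g \<in> L2 haar \<Longrightarrow> AE l in lborel. op_eq (P (f + g) l) (P f l + P g l)"
  using P by (simp add: plancherel_transform_def op_add_eq_plus plus_fun_def[of f])

lemma P_scale: "f \<in> L2 haar \<Longrightarrow> AE l in lborel. op_eq (P (\<lambda>n. c * f n) l) (op_scale c (P f l))"
  using P by (simp add: plancherel_transform_def)

lemma P_isometry: "f \<in> L2 haar \<Longrightarrow> (L2_norm haar f)\<^sup>2 = (\<integral>l. (hs_norm (P f l))\<^sup>2 \<partial>plancherel_measure)"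
  using P by (simp add: plancherel_transform_def)

lemma P_isometry_nn:
  assumes "f \<in> L2 haar"
  shows "(\<integral>\<^sup>+l. ennreal ((hs_norm (P f l))\<^sup>2) \<partial>plancherel_measure) = ennreal ((L2_norm haar f)\<^sup>2)"
  using nn_integral_eq_integral[OF P_norm_integrable[OF assms]] P_isometry[OF assms] by simp

lemma P_surj:
  assumes "G \<in> hs_direct_integral"
  obtains f where "f \<in> L2 haar" "AE l in lborel. op_eq (P f l) (G l)"
  using P assms by (auto simp: plancherel_transform_def)

lemma P_fourier: "f \<in> L2 haar \<Longrightarrow> integrable haar f \<Longrightarrow> AE l in lborel. has_heis_fourier f l (P f l)"
  using P by (simp add: plancherel_transform_def)

lemma P_biregular_L1:
  assumes f: "f \<in> L2 haar" "integrable haar f" and uv: "u \<in> heis" "v \<in> heis"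
  shows "AE l in lborel. op_eq (P (biregular u v f) l) (rep_tensor l u v (P f l))"
  using P_fourier[OF f] P_fourier[OF biregular_L2(1)[OF f(1) uv] biregular_integrable[OF f(2) uv]]
  by eventually_elim (rule has_heis_fourier_biregular[OF uv])

text \<open>The general case follows by truncation; only the infimum over the truncation parameter of the
  errors has to vanish almost everywhere, so no subsequence is needed.\<close>

lemma P_biregular:
  assumes f: "f \<in> L2 haar" and uv: "u \<in> heis" "v \<in> heis"
  shows "AE l in lborel. op_eq (P (biregular u v f) l) (rep_tensor l u v (P f l))"
proof -
  define g where "g = (\<lambda>k n. indicator (heis_box k) n * f n)"
  define r where "r = (\<lambda>k. f - g k)"
  define \<tau> where "\<tau> = biregular u v"
  note trunc = L2_haar_truncate[OF f]
  have gL: "g k \<in> L2 haar" and gi: "integrable haar (g k)" and rL: "r k \<in> L2 haar" for k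
    unfolding r_def g_def by (rule trunc)+
  have \<tau>L: "\<tau> h \<in> L2 haar" "L2_norm haar (\<tau> h) = L2_norm haar h" if "h \<in> L2 haar" for h
    using biregular_L2[OF that uv] by (simp_all add: \<tau>_def)
  have fgr: "f = g k + r k" "\<tau> f = \<tau> (g k) + \<tau> (r k)" for k
    by (auto simp: r_def \<tau>_def biregular_eq)
  \<comment> \<open>Both remainders enter the estimate: that of f, which gets conjugated by
    \<open>rep_tensor\<close>, and that of the translated function.\<close>
  define a where "a = (\<lambda>k l. ennreal ((hs_norm (P (r k) l))\<^sup>2) + ennreal ((hs_norm (P (\<tau> (r k)) l))\<^sup>2))"
  have am: "a k \<in> borel_measurable plancherel_measure" for k
    using P_norm_integrable[OF rL] P_norm_integrable[OF \<tau>L(1)[OF rL]]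
    unfolding a_def by (intro borel_measurable_add measurable_compose[OF _ measurable_ennreal]) auto
  have aint: "(\<integral>\<^sup>+l. a k l \<partial>plancherel_measure) = ennreal (2 * (L2_norm haar (r k))\<^sup>2)" for k
  proof -
    have "(\<integral>\<^sup>+l. a k l \<partial>plancherel_measure)
        = ennreal ((L2_norm haar (r k))\<^sup>2) + ennreal ((L2_norm haar (\<tau> (r k)))\<^sup>2)"
      unfolding a_def using P_norm_integrable[OF rL] P_norm_integrable[OF \<tau>L(1)[OF rL]]
      by (subst nn_integral_add) (auto simp: P_isometry_nn rL \<tau>L)
    then show ?thesis
      using \<tau>L(2)[OF rL, of k] by (simp flip: ennreal_plus)
  qed
  have "(\<integral>\<^sup>+l. (INF k. a k l) \<partial>plancherel_measure) \<le> ennreal (2 * (L2_norm haar (r k))\<^sup>2)" for k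
    unfolding aint[symmetric] by (intro nn_integral_mono INF_lower) simp
  moreover have "(\<lambda>k. ennreal (2 * (L2_norm haar (r k))\<^sup>2)) \<longlonglongrightarrow> ennreal (2 * 0)"
    unfolding r_def g_def by (intro tendsto_ennrealI tendsto_mult tendsto_const trunc(4))
  ultimately have "(\<integral>\<^sup>+l. (INF k. a k l) \<partial>plancherel_measure) \<le> ennreal (2 * 0)"
    by (intro LIMSEQ_le_const) auto
  then have "(\<integral>\<^sup>+l. (INF k. a k l) \<partial>plancherel_measure) = 0" by simp
  then have "AE l in plancherel_measure. (INF k. a k l) = 0"
    using am by (subst (asm) nn_integral_0_iff_AE) auto
  then have inf0: "AE l in lborel. (INF k. a k l) = 0"
    by (simp add: AE_plancherel_measure)
  have "AE l in lborel. \<forall>k. op_eq (P f l) (P (g k) l + P (r k) l)"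
    unfolding AE_all_countable using P_add[OF gL rL, of k k for k] fgr(1) by metis
  moreover have "AE l in lborel. \<forall>k. op_eq (P (\<tau> f) l) (P (\<tau> (g k)) l + P (\<tau> (r k)) l)"
    unfolding AE_all_countable using P_add[OF \<tau>L(1)[OF gL] \<tau>L(1)[OF rL], of k k for k] fgr(2) by metis
  moreover have "AE l in lborel. \<forall>k. op_eq (P (\<tau> (g k)) l) (rep_tensor l u v (P (g k) l))"
    unfolding \<tau>_def using P_biregular_L1[OF gL gi uv] by (subst AE_all_countable) blast
  ultimately show ?thesis
    using inf0 AE_lborel_singleton[of 0]
  proof eventually_elim
    case (elim l)
    have hsr: "P (r k) l \<in> hs_ops" "P (\<tau> (r k)) l \<in> hs_ops" "P (g k) l \<in> hs_ops" "P (\<tau> (g k)) l \<in> hs_ops" for k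
      using elim(5) by (auto intro!: P_hs_ops \<tau>L rL gL)
    have hsf: "P f l \<in> hs_ops" "P (\<tau> f) l \<in> hs_ops"
      using elim(5) by (auto intro!: P_hs_ops \<tau>L f)
    show ?case
      unfolding op_eq_def \<tau>_def[symmetric]
    proof
      fix \<phi> :: "real \<Rightarrow> complex" assume \<phi>: "\<phi> \<in> L2 lborel"
      \<comment> \<open>D does not involve k, whereas the bound below holds for every k: the
        contributions of g k cancel by the integrable case and leave only the two
        remainders.\<close>
      define D where "D = P (\<tau> f) l \<phi> - rep_tensor l u v (P f l) \<phi>"
      have RL: "rep_tensor l u v T \<phi> \<in> L2 lborel" if "T \<in> hs_ops" for T
        using uv hs_ops_operator[OF that] \<phi> by (rule rep_tensor_L2)
      have DL: "D \<in> L2 lborel"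
        unfolding D_def by (intro L2sp.diff_mem hs_ops_L2[OF hsf(2) \<phi>] RL hsf)
      have bound: "L2_norm lborel D \<le> (hs_norm (P (\<tau> (r k)) l) + hs_norm (P (r k) l)) * L2_norm lborel \<phi>" for k
      proof -
        have "op_eq (rep_tensor l u v (P f l)) (rep_tensor l u v (P (g k) l) + rep_tensor l u v (P (r k) l))"
          unfolding rep_tensor_plus[symmetric] using elim(1) uv hsf hsr
          by (intro rep_tensor_op_eq hs_ops_operator hs_ops_plus) auto
        then have "AE t in lborel. rep_tensor l u v (P f l) \<phi> t
            = rep_tensor l u v (P (g k) l) \<phi> t + rep_tensor l u v (P (r k) l) \<phi> t"
          using \<phi> by (simp add: op_eq_def)
        moreover have "AE t in lborel. P (\<tau> f) l \<phi> t = P (\<tau> (g k)) l \<phi> t + P (\<tau> (r k)) l \<phi> t"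
          using elim(2) \<phi> by (simp add: op_eq_def)
        moreover have "AE t in lborel. P (\<tau> (g k)) l \<phi> t = rep_tensor l u v (P (g k) l) \<phi> t"
          using elim(3) \<phi> by (simp add: op_eq_def)
        ultimately have AE: "AE t in lborel. D t = (P (\<tau> (r k)) l \<phi> - rep_tensor l u v (P (r k) l) \<phi>) t"
          by eventually_elim (simp add: D_def)
        have m: "P (\<tau> (r k)) l \<phi> \<in> L2 lborel" "rep_tensor l u v (P (r k) l) \<phi> \<in> L2 lborel"
          by (intro hs_ops_L2[OF hsr(2) \<phi>] RL hsr)+
        have "L2_norm lborel D = L2_norm lborel (P (\<tau> (r k)) l \<phi> - rep_tensor l u v (P (r k) l) \<phi>)"
          by (intro L2_norm_cong_AE AE DL L2sp.diff_mem m)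
        also have "\<dots> \<le> L2_norm lborel (P (\<tau> (r k)) l \<phi>) + L2_norm lborel (rep_tensor l u v (P (r k) l) \<phi>)"
          using L2sp.nrm_triangle[OF m(1) L2sp.minus_mem[OF m(2)]] L2sp.nrm_minus[OF m(2)]
          by (simp add: L2sp_nrm)
        also have "\<dots> \<le> hs_norm (P (\<tau> (r k)) l) * L2_norm lborel \<phi> + hs_norm (P (r k) l) * L2_norm lborel \<phi>"
          by (intro add_mono hs_norm_bound rep_tensor_norm_le hsr uv \<phi>)
        finally show ?thesis by (simp add: distrib_right)
      qed
      have "L2_norm lborel D \<le> 0 + \<epsilon> * (2 * L2_norm lborel \<phi>)" if "0 < \<epsilon>" for \<epsilon>
      proof -
        have "(INF k. a k l) < ennreal (\<epsilon>\<^sup>2)"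
          unfolding elim(4) using that by simp
        then obtain k where k: "a k l < ennreal (\<epsilon>\<^sup>2)"
          by (auto simp: INF_less_iff)
        have "(hs_norm (P (r k) l))\<^sup>2 + (hs_norm (P (\<tau> (r k)) l))\<^sup>2 < \<epsilon>\<^sup>2"
          using k by (simp add: a_def ennreal_less_iff flip: ennreal_plus)
        then have "(hs_norm (P (r k) l))\<^sup>2 < \<epsilon>\<^sup>2" "(hs_norm (P (\<tau> (r k)) l))\<^sup>2 < \<epsilon>\<^sup>2"
          using zero_le_power2[of "hs_norm (P (r k) l)"] zero_le_power2[of "hs_norm (P (\<tau> (r k)) l)"]
          by linarith+
        then have "hs_norm (P (r k) l) < \<epsilon>" "hs_norm (P (\<tau> (r k)) l) < \<epsilon>"
          using that power2_less_imp_less[of _ \<epsilon>] by auto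
        then have "(hs_norm (P (\<tau> (r k)) l) + hs_norm (P (r k) l)) * L2_norm lborel \<phi> \<le> (2 * \<epsilon>) * L2_norm lborel \<phi>"
          by (intro mult_right_mono) auto
        then show ?thesis using bound[of k] by (simp add: mult_ac)
      qed
      note le = this
      have "L2_norm lborel D \<le> 0"
      proof (cases "L2_norm lborel \<phi> = 0")
        case False
        then have pos: "0 < 2 * L2_norm lborel \<phi>"
          using L2_norm_nonneg[of lborel \<phi>] by linarith
        show ?thesis
        proof (rule field_le_epsilon)
          fix s :: real assume "0 < s"
          then show "L2_norm lborel D \<le> 0 + s"
            using le[of "s / (2 * L2_norm lborel \<phi>)"] pos by simp
        qed
      qed (use le[of 1] in simp)
      then have "L2_norm lborel D = 0"
        using L2_norm_nonneg[of lborel D] by linarith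
      then have "AE t in lborel. D t = 0"
        by (rule L2_norm_eq_0_imp_AE[OF DL])
      then show "AE t in lborel. P (\<tau> f) l \<phi> t = rep_tensor l u v (P f l) \<phi> t"
        by eventually_elim (simp add: D_def)
    qed
  qed
qed

text \<open>Together with surjectivity this realises the part of \<open>P f\<close> over E as the
  transform of a function, so that an identity of global norms can be localised in l.\<close>

lemma P_restrict:
  assumes f: "f \<in> L2 haar" and E: "E \<in> sets borel"
  shows "(\<lambda>l. if l \<in> E then P f l else 0) \<in> hs_direct_integral"
  unfolding hs_direct_integral_def
proof (intro CollectI conjI allI impI ballI)
  show "(if l \<in> E then P f l else 0) \<in> hs_ops" if "l \<noteq> 0" for l
    using P_hs_ops[OF f that] hs.zero_mem by simp
  fix T assume T: "T \<in> hs_ops"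
  have "(\<lambda>l. hs_inner (if l \<in> E then P f l else 0) T) = (\<lambda>l. if l \<in> E then hs_inner (P f l) T else 0)"
    using hs.ip_zero_left[OF T] by (auto simp: fun_eq_iff)
  moreover have "\<dots> \<in> borel_measurable borel"
    using P_inner_measurable[OF f T] E by (intro measurable_If_set) auto
  ultimately show "(\<lambda>l. hs_inner (if l \<in> E then P f l else 0) T) \<in> borel_measurable borel" by simp
next
  have "(\<lambda>l. (hs_norm (if l \<in> E then P f l else 0))\<^sup>2) = (\<lambda>l. indicator E l * (hs_norm (P f l))\<^sup>2)"
    using hs.zero_mem hs.nrm_zero hs_nrm[OF hs.zero_mem] by (auto simp: fun_eq_iff)
  moreover have "integrable plancherel_measure \<dots>"
    using E integrable_real_mult_indicator[OF _ P_norm_integrable[OF f], of E]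
    by (simp add: sets_plancherel_measure mult.commute)
  ultimately show "integrable plancherel_measure (\<lambda>l. (hs_norm (if l \<in> E then P f l else 0))\<^sup>2)" by simp
qed

text \<open>The biregular representation preserves the norm of \<open>P\<^sup>-\<^sup>1 (1\<^sub>E P f)\<close> for every Borel
  set \<open>E\<close>, so the fibre norms agree almost everywhere.\<close>

lemma P_biregular_norm:
  assumes f: "f \<in> L2 haar" and uv: "u \<in> heis" "v \<in> heis"
  shows "AE l in lborel. (hs_norm (P (biregular u v f) l))\<^sup>2 = (hs_norm (P f l))\<^sup>2"
proof -
  define \<tau> where "\<tau> = biregular u v"
  have \<tau>L: "\<tau> h \<in> L2 haar" "L2_norm haar (\<tau> h) = L2_norm haar h" if "h \<in> L2 haar" for h
    using biregular_L2[OF that uv] by (simp_all add: \<tau>_def)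
  define p where "p = (\<lambda>h l. ennreal ((hs_norm (P h l))\<^sup>2))"
  have pm: "p h \<in> borel_measurable plancherel_measure" if "h \<in> L2 haar" for h
    using P_norm_integrable[OF that] unfolding p_def by auto
  have "density plancherel_measure (p (\<tau> f)) = density plancherel_measure (p f)"
  proof (rule measure_eqI)
    fix E assume "E \<in> sets (density plancherel_measure (p (\<tau> f)))"
    then have E: "E \<in> sets borel" by (simp add: sets_plancherel_measure)
    obtain g where g: "g \<in> L2 haar" and Pg: "AE l in lborel. op_eq (P g l) (if l \<in> E then P f l else 0)"
      using P_surj[OF P_restrict[OF f E]] by blast
    have zero: "hs_norm 0 = 0"
      using hs_nrm[OF hs.zero_mem] hs.nrm_zero by simp
    have 1: "AE l in lborel. p g l = p f l * indicator E l"
      using Pg AE_P_hs_ops[OF g] AE_P_hs_ops[OF f]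
    proof eventually_elim
      case (elim l)
      have "hs_norm (P g l) = hs_norm (if l \<in> E then P f l else 0)"
        using elim hs.zero_mem by (intro hs_norm_op_eq) auto
      then show ?case by (simp add: p_def zero)
    qed
    \<comment> \<open>\<open>rep_tensor\<close> acts on each fibre separately, so cutting to E
      commutes with it.\<close>
    have 2: "AE l in lborel. p (\<tau> g) l = p (\<tau> f) l * indicator E l"
      using Pg AE_P_hs_ops[OF g] AE_P_hs_ops[OF f] AE_P_hs_ops[OF \<tau>L(1)[OF g]] AE_P_hs_ops[OF \<tau>L(1)[OF f]]
        P_biregular[OF f uv] P_biregular[OF g uv]
    proof eventually_elim
      case (elim l)
      have "op_eq (P (\<tau> g) l) (rep_tensor l u v (if l \<in> E then P f l else 0))"
      proof (rule op_eq_trans)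
        show "op_eq (P (\<tau> g) l) (rep_tensor l u v (P g l))"
          using elim(7) by (simp add: \<tau>_def)
        show "op_eq (rep_tensor l u v (P g l)) (rep_tensor l u v (if l \<in> E then P f l else 0))"
          using elim(1,2,3) hs.zero_mem by (intro rep_tensor_op_eq uv hs_ops_operator) auto
      qed
      moreover have "op_eq (rep_tensor l u v (if l \<in> E then P f l else 0)) (if l \<in> E then P (\<tau> f) l else 0)"
        using elim(6) by (auto simp: \<tau>_def rep_tensor_zero op_eq_refl intro: op_eq_sym)
      ultimately have "op_eq (P (\<tau> g) l) (if l \<in> E then P (\<tau> f) l else 0)"
        by (rule op_eq_trans)
      then have "hs_norm (P (\<tau> g) l) = hs_norm (if l \<in> E then P (\<tau> f) l else 0)"
        using elim hs.zero_mem by (intro hs_norm_op_eq) auto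
      then show ?case by (simp add: p_def zero)
    qed
    have "emeasure (density plancherel_measure (p (\<tau> f))) E = (\<integral>\<^sup>+l. p (\<tau> g) l \<partial>plancherel_measure)"
      using 2 E pm[OF \<tau>L(1)[OF f]]
      by (subst emeasure_density) (auto simp: sets_plancherel_measure AE_plancherel_measure intro!: nn_integral_cong_AE)
    also have "\<dots> = (\<integral>\<^sup>+l. p g l \<partial>plancherel_measure)"
      unfolding p_def by (simp add: P_isometry_nn g \<tau>L)
    also have "\<dots> = emeasure (density plancherel_measure (p f)) E"
      using 1 E pm[OF f]
      by (subst emeasure_density) (auto simp: sets_plancherel_measure AE_plancherel_measure intro!: nn_integral_cong_AE)
    finally show "emeasure (density plancherel_measure (p (\<tau> f))) E = emeasure (density plancherel_measure (p f)) E" .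
  qed simp
  moreover have "(\<integral>\<^sup>+l. p (\<tau> f) l \<partial>plancherel_measure) \<noteq> \<infinity>"
    unfolding p_def by (simp add: P_isometry_nn f \<tau>L)
  ultimately have "AE l in plancherel_measure. p (\<tau> f) l = p f l"
    using pm f \<tau>L(1) by (subst (asm) finite_density_unique) auto
  then show ?thesis
    by (simp add: AE_plancherel_measure p_def \<tau>_def)
qed

end

section \<open>Parseval's identity on sets with disjoint integer translates\<close>

text \<open>Equivalently, the integer translates of E are pairwise disjoint, or E maps injectively
  to the circle.\<close>

definition integer_packing :: "real set \<Rightarrow> bool" where
  "integer_packing E \<longleftrightarrow> (\<forall>s\<in>E. \<forall>t\<in>E. \<forall>m::int. s - t = of_int m \<longrightarrow> s = t)"

lemma integer_packing_subset: "integer_packing E \<Longrightarrow> A \<subseteq> E \<Longrightarrow> integer_packing A"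
  unfolding integer_packing_def by blast

text \<open>F folded onto one period. The windows (j, j + 1] with j from -N to N - 1 tile (-N, N],
  so for F supported there the finite sum meets every point of the support exactly once.\<close>

definition periodize :: "nat \<Rightarrow> (real \<Rightarrow> complex) \<Rightarrow> real \<Rightarrow> complex" where
  "periodize N F x = (\<Sum>j\<in>{- int N..<int N}. of_real (indicator {0<..1} x) * F (x + of_int j))"

lemma integrable_periodize_summand:
  fixes F :: "real \<Rightarrow> complex"
  assumes "integrable lborel F"
  shows "integrable lborel (\<lambda>x. of_real (indicator {0<..1} x) * F (x + c))"
proof -
  have "integrable lborel (\<lambda>x. F (x + c))"
    using lborel_integrable_real_affine[OF assms, of 1 c] by (simp add: add.commute)
  then have "integrable lborel (\<lambda>x. F (x + c) * of_real (indicator {0<..1} x))"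
    by (rule integrable_mult_bounded[where C = 1]) (auto simp: indicator_def)
  then show ?thesis by (simp add: mult.commute)
qed

lemma periodize_integral:
  assumes F: "integrable lborel F" and supp: "\<And>t. F t \<noteq> 0 \<Longrightarrow> t \<in> {- real N<..real N}"
  shows "integrable lborel (periodize N F)" "(\<integral>x. periodize N F x \<partial>lborel) = (\<integral>t. F t \<partial>lborel)"
proof -
  let ?A = "{- int N..<int N}"
  let ?I = "\<lambda>x :: real. complex_of_real (indicator {0<..1} x)"
  have shift: "(\<integral>x. ?I x * F (x + of_int j) \<partial>lborel) = (\<integral>t. ?I (t - of_int j) * F t \<partial>lborel)" for j :: int
    using lborel_integral_shift[of "\<lambda>t. ?I t * F (t + of_int j)" "of_int j"] by simp
  have int: "integrable lborel (\<lambda>x. ?I x * F (x + of_int j))" for j :: int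
    by (rule integrable_periodize_summand[OF F])
  have int': "integrable lborel (\<lambda>t. ?I (t - of_int j) * F t)" for j :: int
    using lborel_integrable_real_affine[OF int[of j], of 1 "- of_int j"] by simp
  have decomp: "(\<Sum>j\<in>?A. ?I (t - of_int j) * F t) = F t" for t
  proof (cases "F t = 0")
    case False
    \<comment> \<open>The only j with t in (j, j + 1], also when t is an integer.\<close>
    define j0 where "j0 = \<lceil>t\<rceil> - 1"
    have ind: "?I (t - of_int j) = (if j = j0 then 1 else 0)" for j
      unfolding j0_def indicator_def by (auto simp: ceiling_unique) linarith+
    have "j0 \<in> ?A"
      using supp[OF False] unfolding j0_def by (auto simp: le_ceiling_iff ceiling_le_iff) linarith+
    then show ?thesis
      by (simp add: ind if_distrib[of "\<lambda>x. x * F t"] cong: if_cong)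
  qed simp
  show "integrable lborel (periodize N F)"
    unfolding periodize_def[abs_def] by (intro Bochner_Integration.integrable_sum int)
  have "(\<integral>x. periodize N F x \<partial>lborel) = (\<Sum>j\<in>?A. \<integral>x. ?I x * F (x + of_int j) \<partial>lborel)"
    unfolding periodize_def by (intro Bochner_Integration.integral_sum int)
  also have "\<dots> = (\<integral>t. (\<Sum>j\<in>?A. ?I (t - of_int j) * F t) \<partial>lborel)"
    unfolding shift by (intro Bochner_Integration.integral_sum[symmetric] int')
  finally show "(\<integral>x. periodize N F x \<partial>lborel) = (\<integral>t. F t \<partial>lborel)"
    by (simp add: decomp)
qed

lemma cmod_sum_single_sq:
  assumes "finite A" "\<And>i j. i \<in> A \<Longrightarrow> j \<in> A \<Longrightarrow> a i \<noteq> 0 \<Longrightarrow> a j \<noteq> 0 \<Longrightarrow> i = j"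
  shows "(cmod (\<Sum>i\<in>A. a i))\<^sup>2 = (\<Sum>i\<in>A. (cmod (a i))\<^sup>2)"
proof (cases "\<exists>i\<in>A. a i \<noteq> 0")
  case True
  then obtain i where i: "i \<in> A" "a i \<noteq> 0" by blast
  have "(\<Sum>j\<in>A. a j) = (\<Sum>j\<in>{i}. a j)" "(\<Sum>j\<in>A. (cmod (a j))\<^sup>2) = (\<Sum>j\<in>{i}. (cmod (a j))\<^sup>2)"
    using assms i by (intro sum.mono_neutral_right; auto)+
  then show ?thesis by simp
qed simp

text \<open>Folding g onto (0, 1] keeps its Fourier coefficients because the exponentials have
  period 1. By the packing property at most one translate contributes at each point, so the squared
  modulus of the fold is the fold of the squared modulus, and Parseval on (0, 1] applies.\<close>

lemma Fourier_Parseval_packing: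
  fixes g :: "real \<Rightarrow> complex"
  assumes g: "g \<in> L2 lborel" and supp: "\<And>t. g t \<noteq> 0 \<Longrightarrow> t \<in> E"
    and E: "E \<subseteq> {- real N<..real N}"
    and packing: "integer_packing E"
  shows "((\<lambda>k::int. (cmod (\<integral>t. g t * cis (- 2 * pi * of_int k * t) \<partial>lborel))\<^sup>2)
    has_sum (\<integral>t. (cmod (g t))\<^sup>2 \<partial>lborel)) UNIV"
proof -
  have g2: "integrable lborel (\<lambda>t. (cmod (g t))\<^sup>2)"
    using g by (simp add: L2_def)
  \<comment> \<open>On a bounded set square-integrability gives integrability: g is its own product
    with this indicator.\<close>
  have "(\<lambda>t. complex_of_real (indicator {- real N<..real N} t)) \<in> L2 lborel"
  proof -
    have "(\<lambda>t. (cmod (complex_of_real (indicator {- real N<..real N} t)))\<^sup>2) = indicator {- real N<..real N}"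
      by (auto simp: indicator_def)
    then show ?thesis by (auto simp: L2_def intro!: integrable_real_indicator)
  qed
  then have "integrable lborel (\<lambda>t. g t * cnj (complex_of_real (indicator {- real N<..real N} t)))"
    by (rule L2_integrable_mult[OF g])
  moreover have "g t * cnj (complex_of_real (indicator {- real N<..real N} t)) = g t" for t
    using supp[of t] E by (cases "g t = 0") (auto simp: indicator_def)
  ultimately have gi: "integrable lborel g" by (simp only:)
  have suppN: "t \<in> {- real N<..real N}" if "g t \<noteq> 0" for t
    using supp[OF that] E by blast
  define G where "G = periodize N g"
  have cisper: "periodize N (\<lambda>t. g t * cis (- 2 * pi * of_int k * t)) x = G x * cis (- 2 * pi * of_int k * x)"
    for k :: int and x
  proof -
    have "cis (- 2 * pi * of_int k * (x + of_int j)) = cis (- 2 * pi * of_int k * x)" for j :: int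
    proof -
      have "cis (- 2 * pi * of_int k * (x + of_int j)) = cis (- 2 * pi * of_int k * x) * cis (2 * pi * of_int (- k * j))"
        by (simp add: cis_mult algebra_simps)
      also have "cis (2 * pi * of_int (- k * j)) = 1"
        by (rule cis_multiple_2pi) (rule Ints_of_int)
      finally show ?thesis by simp
    qed
    then show ?thesis
      by (simp add: periodize_def G_def sum_distrib_right mult.assoc)
  qed
  have coeff: "(\<integral>x. G x * cis (- 2 * pi * of_int k * x) \<partial>lborel)
      = (\<integral>t. g t * cis (- 2 * pi * of_int k * t) \<partial>lborel)" for k :: int
    unfolding cisper[symmetric]
  proof (rule periodize_integral(2))
    show "integrable lborel (\<lambda>t. g t * cis (- 2 * pi * of_int k * t))"
      by (intro integrable_mult_cis gi) simp
    show "t \<in> {- real N<..real N}" if "g t * cis (- 2 * pi * of_int k * t) \<noteq> 0" for t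
      using that by (intro suppN) simp
  qed
  have sq: "complex_of_real ((cmod (G x))\<^sup>2) = periodize N (\<lambda>t. of_real ((cmod (g t))\<^sup>2)) x" for x
  proof -
    have "(cmod (G x))\<^sup>2 = (\<Sum>j\<in>{- int N..<int N}. (cmod (of_real (indicator {0<..1} x) * g (x + of_int j)))\<^sup>2)"
      unfolding G_def periodize_def
    proof (rule cmod_sum_single_sq)
      fix i j :: int
      assume "of_real (indicator {0<..1} x) * g (x + of_int i) \<noteq> 0"
        "of_real (indicator {0<..1} x) * g (x + of_int j) \<noteq> 0"
      then have "x + of_int i \<in> E" "x + of_int j \<in> E"
        by (auto intro: supp)
      moreover have "(x + of_int i) - (x + of_int j) = of_int (i - j)" by simp
      ultimately have "x + of_int i = x + of_int j"
        using packing unfolding integer_packing_def by blast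
      then show "i = j" by simp
    qed simp
    also have "\<dots> = (\<Sum>j\<in>{- int N..<int N}. indicator {0<..1} x * (cmod (g (x + of_int j)))\<^sup>2)"
      by (intro sum.cong) (auto simp: indicator_def)
    finally have "(cmod (G x))\<^sup>2 = (\<Sum>j\<in>{- int N..<int N}. indicator {0<..1} x * (cmod (g (x + of_int j)))\<^sup>2)" .
    then have "complex_of_real ((cmod (G x))\<^sup>2)
        = of_real (\<Sum>j\<in>{- int N..<int N}. indicator {0<..1} x * (cmod (g (x + of_int j)))\<^sup>2)"
      by (rule arg_cong)
    also have "\<dots> = periodize N (\<lambda>t. of_real ((cmod (g t))\<^sup>2)) x"
      unfolding periodize_def of_real_sum of_real_mult ..
    finally show ?thesis .
  qed
  have sqint: "integrable lborel (\<lambda>x. complex_of_real ((cmod (G x))\<^sup>2))"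
    and sqval: "(\<integral>x. complex_of_real ((cmod (G x))\<^sup>2) \<partial>lborel) = (\<integral>t. complex_of_real ((cmod (g t))\<^sup>2) \<partial>lborel)"
    unfolding sq using g2 suppN by (intro periodize_integral integrable_of_real; simp)+
  have "integrable lborel G"
    unfolding G_def by (rule periodize_integral(1)[OF gi suppN])
  moreover have "integrable lborel (\<lambda>x. (cmod (G x))\<^sup>2)"
    using integrable_Re[OF sqint] by simp
  ultimately have GL: "G \<in> L2 lborel"
    by (simp add: L2_def)
  have "(\<integral>x. (cmod (G x))\<^sup>2 \<partial>lborel) = (\<integral>t. (cmod (g t))\<^sup>2 \<partial>lborel)"
    using sqval unfolding integral_complex_of_real of_real_eq_iff .
  moreover have "G t = 0" if "t \<notin> {0<..1}" for t
    using that by (simp add: G_def periodize_def)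
  ultimately show ?thesis
    using Fourier_Parseval[OF GL, unfolded coeff] by auto
qed

text \<open>If two points of S' differ by an integer, so do their images under
  \<open>\<rho>\<close>; both images lie in the half-open unit interval, hence coincide, and
  injectivity of \<open>\<rho>\<close> finishes. The rest of the work is to pass to a Borel set and
  to discard the null sets up to which the congruence is given.\<close>

lemma translation_congruent_packing:
  assumes S: "S \<in> sets lebesgue" and tc: "translation_congruent S {0<..1}"
  obtains S' where "S' \<in> sets borel" "S' \<subseteq> S" "AE l in lborel. l \<in> S \<longrightarrow> l \<in> S'" "integer_packing S'"
proof -
  obtain I' J' \<rho> and k :: "real \<Rightarrow> int" where I': "I' \<in> sets lebesgue"
    and SI: "(S - I') \<union> (I' - S) \<in> null_sets lebesgue"
    and J: "({0<..1} - J') \<union> (J' - {0<..1}) \<in> null_sets lebesgue"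
    and bij: "bij_betw \<rho> I' J'" and \<rho>: "\<And>l. l \<in> I' \<Longrightarrow> \<rho> l = l + of_int (k l)"
    using tc unfolding translation_congruent_def by metis
  obtain N where N: "N \<in> null_sets lborel" "J' - {0<..1} \<subseteq> N"
    using J unfolding null_sets_completion_iff2 by auto
  have "S \<inter> I' \<in> sets lebesgue" using S I' by auto
  then obtain C M M' where C: "S \<inter> I' = C \<union> M" "M \<subseteq> M'" "M' \<in> null_sets lborel" "C \<in> sets lborel"
    by (rule sets_completionE)
  have Nb[measurable]: "N \<in> sets borel" using N(1) by (auto simp: null_sets_def)
  have Cb[measurable]: "C \<in> sets borel" using C(4) by simp
  \<comment> \<open>N covers the part of J' outside (0, 1]. The shift \<open>k l\<close> may be any
    integer, so the points with some integer translate in N are removed, a countable union of null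
    sets.\<close>
  define S' where "S' = {l \<in> C. \<forall>j::int. l + of_int j \<notin> N}"
  show ?thesis
  proof (rule that[of S'])
    have "S' = {l \<in> space borel. l \<in> C \<and> (\<forall>j::int. l + of_int j \<notin> N)}"
      by (auto simp: S'_def)
    also have "\<dots> \<in> sets borel" by measurable
    finally show "S' \<in> sets borel" .
    show "S' \<subseteq> S" using C(1) by (auto simp: S'_def)
    have "AE l in lborel. l \<notin> N" using N(1) by (rule AE_not_in)
    then have "AE l in lborel. of_int j + 1 * l \<notin> N" for j :: int
      by (intro AE_borel_affine) auto
    then have "AE l in lborel. \<forall>j::int. of_int j + 1 * l \<notin> N"
      unfolding AE_all_countable by blast
    moreover have "AE l in lborel. l \<notin> M'" using C(3) by (rule AE_not_in)
    moreover have "AE l in lborel. l \<notin> (S - I') \<union> (I' - S)"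
      using AE_not_in[OF SI] unfolding AE_completion_iff .
    ultimately show "AE l in lborel. l \<in> S \<longrightarrow> l \<in> S'"
      by eventually_elim (use C(1,2) in \<open>auto simp: S'_def add.commute\<close>)
    have unit: "\<rho> l \<in> {0<..1}" "l \<in> I'" if "l \<in> S'" for l
    proof -
      show l: "l \<in> I'" using that C(1) by (auto simp: S'_def)
      have "\<rho> l \<in> J'" using bij l by (auto simp: bij_betw_def)
      moreover have "\<rho> l \<notin> N" using that unfolding \<rho>[OF l] by (simp add: S'_def)
      ultimately show "\<rho> l \<in> {0<..1}" using N(2) by blast
    qed
    show "integer_packing S'"
      unfolding integer_packing_def
    proof (intro ballI allI impI)
      fix s t and m :: int assume s: "s \<in> S'" and t: "t \<in> S'" and st: "s - t = of_int m"
      have diff: "\<rho> s - \<rho> t = of_int (m + k s - k t)"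
        using st unit s t by (simp add: \<rho>)
      have "\<bar>\<rho> s - \<rho> t\<bar> < 1"
        using unit(1)[OF s] unit(1)[OF t] by auto
      then have "m + k s - k t = 0"
        unfolding diff by linarith
      then have "\<rho> s = \<rho> t" using diff by simp
      then show "s = t"
        using bij unit(2)[OF s] unit(2)[OF t] by (auto simp: bij_betw_def inj_on_def)
    qed
  qed
qed

section \<open>The index sets\<close>

lemma Lambda1_in_heis: "(\<kappa>, \<eta>) \<in> Lambda1 \<Longrightarrow> \<kappa> \<in> heis \<and> \<eta> \<in> heis"
  by (auto simp: Lambda1_def)

lemma heis_mat_inj: "heis_mat a b c = heis_mat a' b' c' \<longleftrightarrow> a = a' \<and> b = b' \<and> c = c'"
  by (metis heis_mat_entries)

text \<open>Multiplication by \<open>heis_mat 0 0 k\<close> changes only the central coordinate,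
  since the cross term of the group law has a factor 0. Hence the integer component becomes the
  third coordinate of the first group element.\<close>

definition central_shift :: "(mat4 \<times> mat4) \<times> int \<Rightarrow> mat4 \<times> mat4" where
  "central_shift x = (heis_mat 0 0 (of_int (snd x)) ** fst (fst x), snd (fst x))"

lemma bij_betw_central_shift: "bij_betw central_shift (Lambda1 \<times> UNIV) Lambda"
proof (rule bij_betwI')
  fix x y assume xy: "x \<in> Lambda1 \<times> (UNIV :: int set)" "y \<in> Lambda1 \<times> (UNIV :: int set)"
  obtain k3 k2 m3 m2 k where x: "x = ((heis_mat (of_int k3) (of_int k2) 0, heis_mat (of_int m3) (of_int m2) 0), k)"
    using xy(1) by (auto simp: Lambda1_def)
  obtain k3' k2' m3' m2' k' where y: "y = ((heis_mat (of_int k3') (of_int k2') 0, heis_mat (of_int m3') (of_int m2') 0), k')"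
    using xy(2) by (auto simp: Lambda1_def)
  show "central_shift x = central_shift y \<longleftrightarrow> x = y"
    unfolding x y by (auto simp: central_shift_def heis_mat_mult heis_mat_inj)
next
  fix x assume "x \<in> Lambda1 \<times> (UNIV :: int set)"
  then show "central_shift x \<in> Lambda"
    by (auto simp: central_shift_def Lambda1_def Lambda_def heis_mat_mult heis_mat_inj)
next
  fix y assume "y \<in> Lambda"
  then obtain k1 k2 k3 m2 m3 where
    y: "y = (heis_mat (of_int k3) (of_int k2) (of_int k1), heis_mat (of_int m3) (of_int m2) 0)"
    by (auto simp: Lambda_def)
  show "\<exists>x\<in>Lambda1 \<times> UNIV. y = central_shift x"
    by (rule bexI[of _ "((heis_mat (of_int k3) (of_int k2) 0, heis_mat (of_int m3) (of_int m2) 0), k1)"])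
       (auto simp: y central_shift_def heis_mat_mult Lambda1_def heis_mat_inj)
qed

lemma countable_Lambda1: "countable Lambda1"
proof -
  have "Lambda1 = range (\<lambda>(k2::int, k3::int, m2::int, m3::int).
      (heis_mat (of_int k3) (of_int k2) 0, heis_mat (of_int m3) (of_int m2) 0))"
    by (auto simp: Lambda1_def image_iff heis_mat_inj)
  then show ?thesis
    by (elim ssubst) (rule countable_image[OF countableI_type])
qed

text \<open>Allows an enumeration of \<open>Lambda1\<close> by all natural numbers, so that sums
  over it become series.\<close>

lemma infinite_Lambda1: "infinite Lambda1"
proof
  assume fin: "finite Lambda1"
  have "range (\<lambda>k::int. (heis_mat (of_int k) (of_int 0) 0, heis_mat (of_int 0) (of_int 0) 0)) \<subseteq> Lambda1"
    unfolding Lambda1_def by blast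
  moreover have "inj (\<lambda>k::int. (heis_mat (of_int k) (of_int 0) 0, heis_mat (of_int 0) (of_int 0) 0))"
    by (rule injI) (metis heis_mat_entries(1) of_int_eq_iff prod.inject)
  ultimately have "finite (UNIV :: int set)"
    using finite_imageD[OF finite_subset[OF _ fin]] by blast
  then show False by (simp add: infinite_UNIV_int)
qed

lemma heis_rep_central: "heis_rep l (heis_mat 0 0 c ** \<kappa>) \<phi> t = cis (2 * pi * l * c) * heis_rep l \<kappa> \<phi> t"
  if "\<kappa> \<in> heis"
proof -
  obtain a b d where \<kappa>: "\<kappa> = heis_mat a b d" using \<open>\<kappa> \<in> heis\<close> by (rule heisE)
  have "cis (2 * pi * l * (c + d)) = cis (2 * pi * l * c) * cis (2 * pi * l * d)"
    by (simp add: cis_mult distrib_left)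
  then show ?thesis
    by (simp add: \<kappa> heis_mat_mult heis_rep_heis_mat add.commute)
qed

lemma rep_tensor_central:
  assumes "\<kappa> \<in> heis"
  shows "rep_tensor l (heis_mat 0 0 c ** \<kappa>) \<eta> T = op_scale (cis (2 * pi * l * c)) (rep_tensor l \<kappa> \<eta> T)"
  by (intro ext) (simp add: rep_tensor_apply op_scale_def heis_rep_central[OF assms])

section \<open>Frames on the fibres\<close>

context plancherel
begin

text \<open>By polarization, once on the group and once on each fibre, from the isometry for norms.
  The function q stands for the fibrewise inner products because the definition of the direct
  integral gives measurability only against a fixed operator.\<close>

lemma P_inner:
  assumes h: "h \<in> L2 haar" and g: "g \<in> L2 haar" and q: "q \<in> borel_measurable borel"
    and eq: "AE l in lborel. hs_inner (P h l) (P g l) = q l"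
  shows "L2_inner haar h g = (\<integral>l. q l \<partial>plancherel_measure)"
proof -
  define n where "n = (\<lambda>f l. (hs_norm (P f l))\<^sup>2)"
  have int: "integrable plancherel_measure (n f)" if "f \<in> L2 haar" for f
    unfolding n_def by (rule P_norm_integrable[OF that])
  have qm: "q \<in> borel_measurable plancherel_measure"
    using q by (simp add: measurable_cong_sets[OF sets_plancherel_measure refl])
  have ig: "(\<lambda>x. \<i> * g x) \<in> L2 haar" by (rule L2_scale[OF g])
  have hg: "h + g \<in> L2 haar" and hig: "h + (\<lambda>x. \<i> * g x) \<in> L2 haar"
    by (intro L2sp.add_mem h g ig)+
  have norm_int: "(L2_norm haar f)\<^sup>2 = (\<integral>l. n f l \<partial>plancherel_measure)" if "f \<in> L2 haar" for f
    unfolding n_def by (rule P_isometry[OF that])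
  have "AE l in lborel. Re (q l) = (n (h + g) l - n h l - n g l) / 2
      \<and> Im (q l) = (n (h + (\<lambda>x. \<i> * g x)) l - n h l - n g l) / 2"
    using eq P_add[OF h g] P_add[OF h ig] P_scale[OF g, of \<i>]
      AE_P_hs_ops[OF h] AE_P_hs_ops[OF g] AE_P_hs_ops[OF hg] AE_P_hs_ops[OF hig] AE_P_hs_ops[OF ig]
  proof eventually_elim
    case (elim l)
    have 1: "n (h + g) l = (hs.nrm (P h l + P g l))\<^sup>2"
      unfolding n_def using elim hs_ops_plus by (simp add: hs_nrm hs_norm_op_eq[of "P (h + g) l" "P h l + P g l"])
    have "op_eq (P h l + P (\<lambda>x. \<i> * g x) l) (P h l + op_scale \<i> (P g l))"
      using elim(4) by (auto simp: op_eq_def)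
    then have "op_eq (P (h + (\<lambda>x. \<i> * g x)) l) (P h l + op_scale \<i> (P g l))"
      by (rule op_eq_trans[OF elim(3)])
    then have 2: "n (h + (\<lambda>x. \<i> * g x)) l = (hs.nrm (P h l + op_scale \<i> (P g l)))\<^sup>2"
      unfolding n_def using elim hs_ops_plus hs_ops_op_scale
      by (simp add: hs_nrm hs_norm_op_eq[of "P (h + (\<lambda>x. \<i> * g x)) l" "P h l + op_scale \<i> (P g l)"])
    show ?case
      unfolding elim(1)[symmetric] 1 2
      using hs.Re_ip_polarization[OF elim(5,6)] hs.Im_ip_polarization[OF elim(5,6)] elim(5,6)
      by (simp add: n_def hs_nrm)
  qed
  then have AE: "AE l in plancherel_measure. Re (q l) = (n (h + g) l - n h l - n g l) / 2"
    "AE l in plancherel_measure. Im (q l) = (n (h + (\<lambda>x. \<i> * g x)) l - n h l - n g l) / 2"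
    unfolding AE_plancherel_measure by (auto elim: eventually_mono)
  have Rei: "integrable plancherel_measure (\<lambda>l. (n (h + g) l - n h l - n g l) / 2)"
    and Imi: "integrable plancherel_measure (\<lambda>l. (n (h + (\<lambda>x. \<i> * g x)) l - n h l - n g l) / 2)"
    using int h g hg hig by auto
  \<comment> \<open>The real and imaginary parts of q agree almost everywhere with combinations of
    integrable squared norms.\<close>
  have Req: "integrable plancherel_measure (\<lambda>l. Re (q l))" and Imq: "integrable plancherel_measure (\<lambda>l. Im (q l))"
    using integrable_cong_AE[OF _ _ AE(1)] integrable_cong_AE[OF _ _ AE(2)] Rei Imi qm by auto
  have "integrable plancherel_measure (\<lambda>l. complex_of_real (Re (q l)) + \<i> * complex_of_real (Im (q l)))"
    using Req Imq by (intro Bochner_Integration.integrable_add integrable_mult_right integrable_of_real)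
  then have qi: "integrable plancherel_measure q"
    by (simp flip: complex_eq)
  have "Re (L2_inner haar h g) = (\<integral>l. (n (h + g) l - n h l - n g l) / 2 \<partial>plancherel_measure)"
    using int h g hg by (simp add: L2sp.Re_ip_polarization L2sp_nrm norm_int)
  also have "\<dots> = (\<integral>l. Re (q l) \<partial>plancherel_measure)"
    using AE(1) qm Rei by (intro integral_cong_AE) (auto elim: eventually_mono)
  finally have Re: "Re (L2_inner haar h g) = Re (\<integral>l. q l \<partial>plancherel_measure)"
    by (simp add: integral_Re[OF qi])
  have "Im (L2_inner haar h g) = (\<integral>l. (n (h + (\<lambda>x. \<i> * g x)) l - n h l - n g l) / 2 \<partial>plancherel_measure)"
    using int h g hig by (simp add: L2sp.Im_ip_polarization L2sp_nrm norm_int)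
  also have "\<dots> = (\<integral>l. Im (q l) \<partial>plancherel_measure)"
    using AE(2) qm Imi by (intro integral_cong_AE) (auto elim: eventually_mono)
  finally have "Im (L2_inner haar h g) = Im (\<integral>l. q l \<partial>plancherel_measure)"
    by (simp add: integral_Im[OF qi])
  with Re show ?thesis by (rule complex_eqI)
qed

lemma integral_plancherel_measure:
  fixes q :: "real \<Rightarrow> 'b::{banach, second_countable_topology}"
  assumes "q \<in> borel_measurable borel"
  shows "(\<integral>l. q l \<partial>plancherel_measure) = (\<integral>l. \<bar>l\<bar> *\<^sub>R q l \<partial>lborel)"
  unfolding plancherel_measure_def using assms by (intro integral_density) auto

text \<open>On a bounded A the Plancherel weight is at most N, so a constant field cut to A has
  finite norm.\<close>

lemma constant_field_direct_integral:
  assumes T: "T \<in> hs_ops" and A: "A \<in> sets borel" "A \<subseteq> {- real N<..real N}"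
  shows "(\<lambda>l. if l \<in> A then T else 0) \<in> hs_direct_integral"
  unfolding hs_direct_integral_def
proof (intro CollectI conjI allI impI ballI)
  show "(if l \<in> A then T else 0) \<in> hs_ops" for l
    using T hs.zero_mem by simp
  fix U assume U: "U \<in> hs_ops"
  have "(\<lambda>l. hs_inner (if l \<in> A then T else 0) U) = (\<lambda>l. if l \<in> A then hs_inner T U else 0)"
    using hs.ip_zero_left[OF U] by (auto simp: fun_eq_iff)
  moreover have "\<dots> \<in> borel_measurable borel"
    using A(1) by (intro measurable_If_set) auto
  ultimately show "(\<lambda>l. hs_inner (if l \<in> A then T else 0) U) \<in> borel_measurable borel" by simp
next
  have eq: "(\<lambda>l. (hs_norm (if l \<in> A then T else 0))\<^sup>2) = (\<lambda>l. (hs_norm T)\<^sup>2 * indicator A l)"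
    using hs.nrm_zero hs_nrm[OF hs.zero_mem] by (auto simp: fun_eq_iff)
  have "integrable lborel (\<lambda>l. \<bar>l\<bar> *\<^sub>R ((hs_norm T)\<^sup>2 * indicator A l))"
  proof (rule Bochner_Integration.integrable_bound)
    show "integrable lborel (\<lambda>l. real N * (hs_norm T)\<^sup>2 * indicator {- real N<..real N} l)"
      by (intro integrable_mult_right integrable_real_indicator) auto
    show "(\<lambda>l. \<bar>l\<bar> *\<^sub>R ((hs_norm T)\<^sup>2 * indicator A l)) \<in> borel_measurable lborel"
      using A(1) by measurable
    have "norm (\<bar>l\<bar> *\<^sub>R ((hs_norm T)\<^sup>2 * indicator A l)) \<le> norm (real N * (hs_norm T)\<^sup>2 * indicator {- real N<..real N} l)" for l
    proof (cases "l \<in> A")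
      case True
      then have lN: "l \<in> {- real N<..real N}" using A(2) by blast
      then have "\<bar>l\<bar> \<le> real N" by auto
      note this lN
      then show ?thesis using True by (simp add: mult_right_mono)
    qed simp
    then show "AE l in lborel. norm (\<bar>l\<bar> *\<^sub>R ((hs_norm T)\<^sup>2 * indicator A l))
        \<le> norm (real N * (hs_norm T)\<^sup>2 * indicator {- real N<..real N} l)" by simp
  qed
  then show "integrable plancherel_measure (\<lambda>l. (hs_norm (if l \<in> A then T else 0))\<^sup>2)"
    unfolding eq plancherel_measure_def using A(1) by (subst integrable_density) auto
qed

text \<open>Testing the frame identity on \<open>P\<^sup>-\<^sup>1 (1\<^sub>A T)\<close>: the sum over the centre is evaluated by
  Parseval's identity on \<open>A\<close>.\<close>

lemma fibre_identity_integrated: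
  assumes f: "f \<in> spectral_subspace P S"
    and frame: "parseval_frame (spectral_subspace P S) (L2_inner haar) Lambda (\<lambda>(\<gamma>, \<eta>). biregular \<gamma> \<eta> f)"
    and T: "T \<in> hs_ops"
    and A: "A \<in> sets borel" "A \<subseteq> S" "A \<subseteq> {- real N<..real N}"
    and bounded: "\<forall>l\<in>A. (hs_norm (P f l))\<^sup>2 \<le> C"
    and packing: "integer_packing A"
  shows "((\<lambda>(\<kappa>, \<eta>). \<integral>l. indicator A l * (\<bar>l\<bar> * cmod (hs_inner (P (biregular \<kappa> \<eta> f) l) T))\<^sup>2 \<partial>lborel)
    has_sum (\<integral>l. indicator A l * (\<bar>l\<bar> * (hs_norm T)\<^sup>2) \<partial>lborel)) Lambda1"
    and "(\<kappa>, \<eta>) \<in> Lambda1 \<Longrightarrow>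
      integrable lborel (\<lambda>l. indicator A l * (\<bar>l\<bar> * cmod (hs_inner (P (biregular \<kappa> \<eta> f) l) T))\<^sup>2)"
proof -
  have fL: "f \<in> L2 haar" using f by (simp add: spectral_subspace_def)
  note [measurable] = A(1)
  obtain h where h: "h \<in> L2 haar" and Ph: "AE l in lborel. op_eq (P h l) (if l \<in> A then T else 0)"
    using P_surj[OF constant_field_direct_integral[OF T A(1,3)]] by blast
  have hS: "h \<in> spectral_subspace P S"
    unfolding spectral_subspace_def op_zero_eq_0
  proof (intro CollectI conjI h)
    show "AE l in lborel. l \<notin> S \<longrightarrow> op_eq (P h l) 0"
      using Ph
    proof eventually_elim
      case (elim l)
      then show ?case using A(2) by (cases "l \<in> A") auto
    qed
  qed
  define p where "p = (\<lambda>\<kappa> \<eta> l. hs_inner (P (biregular \<kappa> \<eta> f) l) T)"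
  have pm: "p \<kappa> \<eta> \<in> borel_measurable borel" if "\<kappa> \<in> heis" "\<eta> \<in> heis" for \<kappa> \<eta>
    unfolding p_def by (rule P_inner_measurable[OF biregular_L2(1)[OF fL that] T])
  \<comment> \<open>The Plancherel density |l| is absorbed into the function to be expanded. The
    conjugate appears because \<open>f\<close> enters the second, conjugate-linear argument.\<close>
  define g where "g = (\<lambda>\<kappa> \<eta> l. of_real (indicator A l * \<bar>l\<bar>) * cnj (p \<kappa> \<eta> l))"
  have gm: "g \<kappa> \<eta> \<in> borel_measurable borel" if "\<kappa> \<in> heis" "\<eta> \<in> heis" for \<kappa> \<eta>
    using pm[OF that] unfolding g_def by measurable
  have gsq: "(cmod (g \<kappa> \<eta> l))\<^sup>2 = indicator A l * (\<bar>l\<bar> * cmod (p \<kappa> \<eta> l))\<^sup>2" for \<kappa> \<eta> l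
    by (simp add: g_def norm_mult indicator_def)
  have gL: "g \<kappa> \<eta> \<in> L2 lborel" if \<kappa>\<eta>: "\<kappa> \<in> heis" "\<eta> \<in> heis" for \<kappa> \<eta>
  proof -
    \<comment> \<open>By Cauchy-Schwarz and \<open>P_biregular_norm\<close> the bound C on the fibre
      norms of f serves for its translates as well.\<close>
    have "integrable lborel (\<lambda>l. (cmod (g \<kappa> \<eta> l))\<^sup>2)"
    proof (rule Bochner_Integration.integrable_bound)
      show "integrable lborel (\<lambda>l. (real N)\<^sup>2 * (C * (hs_norm T)\<^sup>2) * indicator {- real N<..real N} l)"
        by (intro integrable_mult_right integrable_real_indicator) auto
      show "(\<lambda>l. (cmod (g \<kappa> \<eta> l))\<^sup>2) \<in> borel_measurable lborel"
        using gm[OF \<kappa>\<eta>] by measurable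
      show "AE l in lborel. norm ((cmod (g \<kappa> \<eta> l))\<^sup>2)
          \<le> norm ((real N)\<^sup>2 * (C * (hs_norm T)\<^sup>2) * indicator {- real N<..real N} l)"
        using P_biregular_norm[OF fL \<kappa>\<eta>] AE_P_hs_ops[OF biregular_L2(1)[OF fL \<kappa>\<eta>]]
      proof eventually_elim
        case (elim l)
        show ?case
        proof (cases "l \<in> A")
          case True
          have lN: "l \<in> {- real N<..real N}" using A(3) True by blast
          then have labs: "\<bar>l\<bar> \<le> real N" by auto
          have "(cmod (p \<kappa> \<eta> l))\<^sup>2 \<le> (hs_norm (P (biregular \<kappa> \<eta> f) l) * hs_norm T)\<^sup>2"
            using hs.Cauchy_Schwarz[OF elim(2) T] elim(2) T
            unfolding p_def by (intro power_mono) (simp_all add: hs_nrm)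
          also have "\<dots> = (hs_norm (P f l))\<^sup>2 * (hs_norm T)\<^sup>2"
            using elim(1) by (simp add: power_mult_distrib)
          also have "\<dots> \<le> C * (hs_norm T)\<^sup>2"
            using bounded True by (intro mult_right_mono) auto
          finally have pC: "(cmod (p \<kappa> \<eta> l))\<^sup>2 \<le> C * (hs_norm T)\<^sup>2" .
          moreover have "\<bar>l\<bar>\<^sup>2 \<le> (real N)\<^sup>2"
            using labs by (intro power_mono) auto
          ultimately have "\<bar>l\<bar>\<^sup>2 * (cmod (p \<kappa> \<eta> l))\<^sup>2 \<le> (real N)\<^sup>2 * (C * (hs_norm T)\<^sup>2)"
            by (intro mult_mono) auto
          then show ?thesis
            using True lN unfolding gsq by (simp add: power_mult_distrib)
        qed (simp add: gsq)
      qed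
    qed
    then show ?thesis using gm[OF \<kappa>\<eta>] by (simp add: L2_def)
  qed
  have inner: "L2_inner haar h (biregular (heis_mat 0 0 (of_int k) ** \<kappa>) \<eta> f)
      = (\<integral>l. g \<kappa> \<eta> l * cis (- 2 * pi * of_int k * l) \<partial>lborel)"
    if \<kappa>\<eta>: "\<kappa> \<in> heis" "\<eta> \<in> heis" for \<kappa> \<eta> and k :: int
  proof -
    define \<gamma> where "\<gamma> = heis_mat 0 0 (of_int k) ** \<kappa>"
    have \<gamma>: "\<gamma> \<in> heis" unfolding \<gamma>_def by (intro heis_mult_closed \<kappa>\<eta> heis_mat_in_heis)
    \<comment> \<open>The measurable expression required by \<open>P_inner\<close>; its phase is the
      conjugate of the scalar by which the central element acts.\<close>
    define q where "q = (\<lambda>l. of_real (indicator A l) * (cis (- 2 * pi * of_int k * l) * cnj (p \<kappa> \<eta> l)))"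
    have qm: "q \<in> borel_measurable borel"
      using pm[OF \<kappa>\<eta>] unfolding q_def by measurable
    have "AE l in lborel. hs_inner (P h l) (P (biregular \<gamma> \<eta> f) l) = q l"
      using Ph P_biregular[OF fL \<gamma> \<kappa>\<eta>(2)] P_biregular[OF fL \<kappa>\<eta>] AE_P_hs_ops[OF h] AE_P_hs_ops[OF fL]
        AE_P_hs_ops[OF biregular_L2(1)[OF fL \<gamma> \<kappa>\<eta>(2)]] AE_P_hs_ops[OF biregular_L2(1)[OF fL \<kappa>\<eta>]]
    proof eventually_elim
      case (elim l)
      let ?c = "cis (2 * pi * l * of_int k)"
      have "op_eq (P (biregular \<gamma> \<eta> f) l) (op_scale ?c (P (biregular \<kappa> \<eta> f) l))"
        using elim(2,3) unfolding \<gamma>_def rep_tensor_central[OF \<kappa>\<eta>(1)]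
        unfolding op_eq_def op_scale_def
      proof (intro ballI)
        fix \<phi> :: "real \<Rightarrow> complex"
        assume "\<forall>\<phi>\<in>L2 lborel. AE t in lborel. P (biregular (heis_mat 0 0 (of_int k) ** \<kappa>) \<eta> f) l \<phi> t
            = ?c * rep_tensor l \<kappa> \<eta> (P f l) \<phi> t"
          "\<forall>\<phi>\<in>L2 lborel. AE t in lborel. P (biregular \<kappa> \<eta> f) l \<phi> t = rep_tensor l \<kappa> \<eta> (P f l) \<phi> t"
          and \<phi>: "\<phi> \<in> L2 lborel"
        from this(1)[THEN bspec, OF \<phi>] this(2)[THEN bspec, OF \<phi>]
        show "AE t in lborel. P (biregular (heis_mat 0 0 (of_int k) ** \<kappa>) \<eta> f) l \<phi> t
            = ?c * P (biregular \<kappa> \<eta> f) l \<phi> t"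
          by eventually_elim simp
      qed
      then have "hs_inner (P h l) (P (biregular \<gamma> \<eta> f) l)
          = hs_inner (if l \<in> A then T else 0) (op_scale ?c (P (biregular \<kappa> \<eta> f) l))"
        using elim T hs.zero_mem by (intro hs_inner_op_eq hs_ops_op_scale) auto
      also have "\<dots> = of_real (indicator A l) * (cnj ?c * hs_inner T (P (biregular \<kappa> \<eta> f) l))"
        using elim(7) T by (simp add: hs.ip_sc_right hs.ip_zero_left hs_ops_op_scale)
      also have "cnj ?c = cis (- 2 * pi * of_int k * l)"
        by (simp add: cis_cnj mult_ac)
      also have "hs_inner T (P (biregular \<kappa> \<eta> f) l) = cnj (p \<kappa> \<eta> l)"
        unfolding p_def using elim(7) T by (simp add: hs.ip_cnj)
      finally show ?case by (simp add: q_def)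
    qed
    then have "L2_inner haar h (biregular \<gamma> \<eta> f) = (\<integral>l. q l \<partial>plancherel_measure)"
      by (rule P_inner[OF h biregular_L2(1)[OF fL \<gamma> \<kappa>\<eta>(2)] qm])
    also have "\<dots> = (\<integral>l. \<bar>l\<bar> *\<^sub>R q l \<partial>lborel)"
      by (rule integral_plancherel_measure[OF qm])
    also have "\<dots> = (\<integral>l. g \<kappa> \<eta> l * cis (- 2 * pi * of_int k * l) \<partial>lborel)"
      by (intro Bochner_Integration.integral_cong refl) (simp add: q_def g_def scaleR_conv_of_real mult_ac)
    finally show ?thesis by (simp add: \<gamma>_def)
  qed
  have central: "((\<lambda>k::int. (cmod (L2_inner haar h (biregular (heis_mat 0 0 (of_int k) ** \<kappa>) \<eta> f)))\<^sup>2)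
      has_sum (\<integral>l. indicator A l * (\<bar>l\<bar> * cmod (p \<kappa> \<eta> l))\<^sup>2 \<partial>lborel)) UNIV"
    if \<kappa>\<eta>: "\<kappa> \<in> heis" "\<eta> \<in> heis" for \<kappa> \<eta>
    unfolding inner[OF \<kappa>\<eta>] gsq[symmetric]
  proof (rule Fourier_Parseval_packing[OF gL[OF \<kappa>\<eta>] _ A(3) packing])
    show "l \<in> A" if "g \<kappa> \<eta> l \<noteq> 0" for l
      using that by (cases "l \<in> A") (auto simp: g_def)
  qed
  have normh: "Re (L2_inner haar h h) = (\<integral>l. indicator A l * (\<bar>l\<bar> * (hs_norm T)\<^sup>2) \<partial>lborel)"
  proof -
    define q where "q = (\<lambda>l. indicator A l * (hs_norm T)\<^sup>2 :: real)"
    have qm: "q \<in> borel_measurable borel" unfolding q_def by measurable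
    have zero: "hs_norm 0 = 0"
      using hs_nrm[OF hs.zero_mem] hs.nrm_zero by simp
    have AE: "AE l in lborel. (hs_norm (P h l))\<^sup>2 = q l"
      using Ph AE_P_hs_ops[OF h]
    proof eventually_elim
      case (elim l)
      have "hs_norm (P h l) = hs_norm (if l \<in> A then T else 0)"
        using elim T hs.zero_mem by (intro hs_norm_op_eq) auto
      then show ?case by (simp add: q_def zero)
    qed
    have "Re (L2_inner haar h h) = (L2_norm haar h)\<^sup>2"
      by (simp add: L2_inner_self L2_norm_sq)
    also have "\<dots> = (\<integral>l. q l \<partial>plancherel_measure)"
      unfolding P_isometry[OF h] using AE qm P_norm_integrable[OF h]
      by (intro integral_cong_AE) (auto simp: AE_plancherel_measure measurable_cong_sets[OF sets_plancherel_measure refl])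
    also have "\<dots> = (\<integral>l. \<bar>l\<bar> *\<^sub>R q l \<partial>lborel)"
      by (rule integral_plancherel_measure[OF qm])
    also have "\<dots> = (\<integral>l. indicator A l * (\<bar>l\<bar> * (hs_norm T)\<^sup>2) \<partial>lborel)"
      by (intro Bochner_Integration.integral_cong refl) (simp add: q_def mult_ac)
    finally show ?thesis .
  qed
  define F where "F = (\<lambda>i. (cmod (L2_inner haar h (biregular (fst i) (snd i) f)))\<^sup>2)"
  have "(F has_sum Re (L2_inner haar h h)) Lambda"
    using frame hS unfolding parseval_frame_def case_prod_unfold F_def by blast
  then have "((\<lambda>x. F (central_shift x)) has_sum Re (L2_inner haar h h)) (Lambda1 \<times> UNIV)"
    by (simp only: has_sum_reindex_bij_betw[OF bij_betw_central_shift])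
  then have "((\<lambda>(\<kappa>, \<eta>). \<integral>l. indicator A l * (\<bar>l\<bar> * cmod (p \<kappa> \<eta> l))\<^sup>2 \<partial>lborel)
    has_sum Re (L2_inner haar h h)) Lambda1"
  proof (rule has_sum_SigmaD)
    fix i assume "i \<in> Lambda1"
    then have i: "fst i \<in> heis" "snd i \<in> heis"
      using Lambda1_in_heis[of "fst i" "snd i"] by auto
    show "((\<lambda>k. F (central_shift (i, k))) has_sum
        (case i of (\<kappa>, \<eta>) \<Rightarrow> \<integral>l. indicator A l * (\<bar>l\<bar> * cmod (p \<kappa> \<eta> l))\<^sup>2 \<partial>lborel)) UNIV"
      using central[OF i] by (simp only: F_def central_shift_def fst_conv snd_conv case_prod_unfold)
  qed
  then show "((\<lambda>(\<kappa>, \<eta>). \<integral>l. indicator A l * (\<bar>l\<bar> * cmod (hs_inner (P (biregular \<kappa> \<eta> f) l) T))\<^sup>2 \<partial>lborel)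
    has_sum (\<integral>l. indicator A l * (\<bar>l\<bar> * (hs_norm T)\<^sup>2) \<partial>lborel)) Lambda1"
    by (simp add: normh p_def)
  show "integrable lborel (\<lambda>l. indicator A l * (\<bar>l\<bar> * cmod (hs_inner (P (biregular \<kappa> \<eta> f) l) T))\<^sup>2)"
    if "(\<kappa>, \<eta>) \<in> Lambda1"
    using gL[of \<kappa> \<eta>] Lambda1_in_heis[OF that] by (simp add: L2_def gsq p_def)
qed

text \<open>The integrated identity over all Borel subsets of a set where l and the fibre norms of f
  are bounded determines the integrands there almost everywhere. Countably many such sets exhaust
  S'.\<close>

lemma fibre_identity:
  assumes f: "f \<in> spectral_subspace P S"
    and frame: "parseval_frame (spectral_subspace P S) (L2_inner haar) Lambda (\<lambda>(\<gamma>, \<eta>). biregular \<gamma> \<eta> f)"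
    and T: "T \<in> hs_ops"
    and S': "S' \<in> sets borel" "S' \<subseteq> S"
    and packing: "integer_packing S'"
  shows "AE l in lborel. l \<in> S' \<longrightarrow>
    ((\<lambda>(\<kappa>, \<eta>). \<bar>l\<bar> * (cmod (hs_inner (P (biregular \<kappa> \<eta> f) l) T))\<^sup>2) has_sum (hs_norm T)\<^sup>2) Lambda1"
proof -
  have fL: "f \<in> L2 haar" using f by (simp add: spectral_subspace_def)
  define e where "e = from_nat_into Lambda1"
  have e: "bij_betw e UNIV Lambda1"
    unfolding e_def by (rule bij_betw_from_nat_into[OF countable_Lambda1 infinite_Lambda1])
  define p where "p = (\<lambda>i l. cmod (hs_inner (P (biregular (fst (e i)) (snd (e i)) f) l) T))"
  have eL: "(fst (e i), snd (e i)) \<in> Lambda1" for i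
    using e by (auto simp: bij_betw_def)
  have pm[measurable]: "p i \<in> borel_measurable borel" for i
    unfolding p_def using P_inner_measurable[OF biregular_L2(1)[OF fL] T] Lambda1_in_heis[OF eL] by auto
  \<comment> \<open>With extended nonnegative values the series and the integral can be exchanged
    before the series is known to converge.\<close>
  define u where "u = (\<lambda>l. \<Sum>i. ennreal ((\<bar>l\<bar> * p i l)\<^sup>2))"
  define v where "v = (\<lambda>l. ennreal (\<bar>l\<bar> * (hs_norm T)\<^sup>2))"
  have um[measurable]: "u \<in> borel_measurable borel" unfolding u_def by measurable
  have vm[measurable]: "v \<in> borel_measurable borel" unfolding v_def by measurable
  define E where "E = (\<lambda>N::nat. {l \<in> S'. l \<in> {- real N<..real N} \<and> (hs_norm (P f l))\<^sup>2 \<le> real N})"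
  have Em: "E N \<in> sets borel" for N
  proof -
    have [measurable]: "(\<lambda>l. (hs_norm (P f l))\<^sup>2) \<in> borel_measurable borel" "S' \<in> sets borel"
      using P_norm_measurable[OF fL] S'(1) by auto
    have "E N = {l \<in> space borel. l \<in> S' \<and> l \<in> {- real N<..real N} \<and> (hs_norm (P f l))\<^sup>2 \<le> real N}"
      by (auto simp: E_def)
    also have "\<dots> \<in> sets borel" by measurable
    finally show ?thesis .
  qed
  have vfin: "integrable lborel (\<lambda>l. indicator A l * (\<bar>l\<bar> * (hs_norm T)\<^sup>2))"
    if "A \<in> sets borel" "A \<subseteq> E N" for A N
  proof (rule Bochner_Integration.integrable_bound)
    show "integrable lborel (\<lambda>l. real N * (hs_norm T)\<^sup>2 * indicator {- real N<..real N} l)"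
      by (intro integrable_mult_right integrable_real_indicator) auto
    show "(\<lambda>l. indicator A l * (\<bar>l\<bar> * (hs_norm T)\<^sup>2)) \<in> borel_measurable lborel"
      using that(1) by measurable
    have "norm (indicator A l * (\<bar>l\<bar> * (hs_norm T)\<^sup>2)) \<le> norm (real N * (hs_norm T)\<^sup>2 * indicator {- real N<..real N} l)" for l
    proof (cases "l \<in> A")
      case True
      then have "l \<in> {- real N<..real N}" "\<bar>l\<bar> \<le> real N" using that(2) by (auto simp: E_def)
      then show ?thesis using True by (simp add: mult_right_mono)
    qed simp
    then show "AE l in lborel. norm (indicator A l * (\<bar>l\<bar> * (hs_norm T)\<^sup>2))
        \<le> norm (real N * (hs_norm T)\<^sup>2 * indicator {- real N<..real N} l)" by simp
  qed
  have eq: "(\<integral>\<^sup>+l. u l * indicator A l \<partial>lborel) = (\<integral>\<^sup>+l. v l * indicator A l \<partial>lborel)"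
    and fin: "(\<integral>\<^sup>+l. v l * indicator A l \<partial>lborel) < \<infinity>"
    if A: "A \<in> sets borel" "A \<subseteq> E N" for A N
  proof -
    note [measurable] = A(1)
    have hyps: "A \<subseteq> S" "A \<subseteq> {- real N<..real N}" "\<forall>l\<in>A. (hs_norm (P f l))\<^sup>2 \<le> real N"
      using A(2) S'(2) by (auto simp: E_def)
    have pack: "integer_packing A"
      using packing A(2) by (auto simp: E_def intro: integer_packing_subset)
    note id = fibre_identity_integrated[OF f frame T A(1) hyps pack]
    define I where "I = (\<lambda>i. \<integral>l. indicator A l * (\<bar>l\<bar> * p i l)\<^sup>2 \<partial>lborel)"
    have int: "integrable lborel (\<lambda>l. indicator A l * (\<bar>l\<bar> * p i l)\<^sup>2)" for i
      unfolding p_def by (rule id(2)[OF eL])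
    have "(I has_sum (\<integral>l. indicator A l * (\<bar>l\<bar> * (hs_norm T)\<^sup>2) \<partial>lborel)) UNIV"
      using has_sum_reindex_bij_betw[OF e, of "\<lambda>(\<kappa>, \<eta>). \<integral>l. indicator A l * (\<bar>l\<bar> * cmod (hs_inner (P (biregular \<kappa> \<eta> f) l) T))\<^sup>2 \<partial>lborel"]
        id(1) by (simp add: I_def p_def case_prod_beta)
    then have sums: "I sums (\<integral>l. indicator A l * (\<bar>l\<bar> * (hs_norm T)\<^sup>2) \<partial>lborel)"
      by (rule has_sum_imp_sums)
    have "(\<integral>\<^sup>+l. u l * indicator A l \<partial>lborel) = (\<integral>\<^sup>+l. (\<Sum>i. ennreal (indicator A l * (\<bar>l\<bar> * p i l)\<^sup>2)) \<partial>lborel)"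
    proof (rule nn_integral_cong)
      show "u l * indicator A l = (\<Sum>i. ennreal (indicator A l * (\<bar>l\<bar> * p i l)\<^sup>2))" for l
        by (cases "l \<in> A") (simp_all only: u_def indicator_simps mult_1 mult_1_right mult_zero_left
            mult_zero_right ennreal_0 suminf_zero not_False_eq_True)
    qed
    also have "\<dots> = (\<Sum>i. \<integral>\<^sup>+l. ennreal (indicator A l * (\<bar>l\<bar> * p i l)\<^sup>2) \<partial>lborel)"
      by (rule nn_integral_suminf) measurable
    also have "\<dots> = (\<Sum>i. ennreal (I i))"
      unfolding I_def by (intro suminf_cong nn_integral_eq_integral int) simp
    also have "\<dots> = ennreal (\<Sum>i. I i)"
      using sums by (intro suminf_ennreal2) (auto simp: I_def sums_iff)
    also have "(\<Sum>i. I i) = (\<integral>l. indicator A l * (\<bar>l\<bar> * (hs_norm T)\<^sup>2) \<partial>lborel)"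
      using sums by (simp add: sums_iff)
    also have "ennreal \<dots> = (\<integral>\<^sup>+l. ennreal (indicator A l * (\<bar>l\<bar> * (hs_norm T)\<^sup>2)) \<partial>lborel)"
      by (intro nn_integral_eq_integral[symmetric] vfin[OF A]) simp
    finally have *: "(\<integral>\<^sup>+l. u l * indicator A l \<partial>lborel) = \<dots>" .
    have v: "(\<integral>\<^sup>+l. ennreal (indicator A l * (\<bar>l\<bar> * (hs_norm T)\<^sup>2)) \<partial>lborel) = (\<integral>\<^sup>+l. v l * indicator A l \<partial>lborel)"
      by (intro nn_integral_cong) (simp add: v_def split: split_indicator)
    show "(\<integral>\<^sup>+l. u l * indicator A l \<partial>lborel) = (\<integral>\<^sup>+l. v l * indicator A l \<partial>lborel)"
      using * v by simp
    show "(\<integral>\<^sup>+l. v l * indicator A l \<partial>lborel) < \<infinity>"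
      unfolding v[symmetric] by (subst nn_integral_eq_integral[OF vfin[OF A]]) auto
  qed
  \<comment> \<open>Equal integrals over all Borel subsets of E N mean that u and v, cut to E N, are
    densities of one measure; its total mass is finite, so densities are unique.\<close>
  have "AE l in lborel. l \<in> E N \<longrightarrow> u l = v l" for N
  proof -
    note [measurable] = Em[of N]
    have "density lborel (\<lambda>l. u l * indicator (E N) l) = density lborel (\<lambda>l. v l * indicator (E N) l)"
    proof (rule measure_eqI)
      fix B assume "B \<in> sets (density lborel (\<lambda>l. u l * indicator (E N) l))"
      then have B[measurable]: "B \<in> sets borel" by simp
      have "(\<integral>\<^sup>+l. u l * indicator (E N) l * indicator B l \<partial>lborel) = (\<integral>\<^sup>+l. u l * indicator (E N \<inter> B) l \<partial>lborel)"
        by (intro nn_integral_cong) (simp split: split_indicator)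
      also have "\<dots> = (\<integral>\<^sup>+l. v l * indicator (E N \<inter> B) l \<partial>lborel)"
        by (rule eq[of _ N]) auto
      also have "\<dots> = (\<integral>\<^sup>+l. v l * indicator (E N) l * indicator B l \<partial>lborel)"
        by (intro nn_integral_cong) (simp split: split_indicator)
      finally show "emeasure (density lborel (\<lambda>l. u l * indicator (E N) l)) B
          = emeasure (density lborel (\<lambda>l. v l * indicator (E N) l)) B"
        by (subst (1 2) emeasure_density) auto
    qed simp
    moreover have "(\<integral>\<^sup>+l. u l * indicator (E N) l \<partial>lborel) \<noteq> \<infinity>"
      using eq[OF Em order_refl, of N] fin[OF Em order_refl, of N] by simp
    ultimately have "AE l in lborel. u l * indicator (E N) l = v l * indicator (E N) l"
      by (subst (asm) finite_density_unique) auto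
    then show ?thesis
      by eventually_elim (auto simp: indicator_def split: if_splits)
  qed
  then have "AE l in lborel. \<forall>N. l \<in> E N \<longrightarrow> u l = v l"
    unfolding AE_all_countable by blast
  then show ?thesis
    using AE_lborel_singleton[of 0]
  proof eventually_elim
    case (elim l)
    show ?case
    proof
      assume l: "l \<in> S'"
      \<comment> \<open>E N excludes its left end point -N, so N has to exceed |l| strictly; the
        summand 1 ensures this.\<close>
      obtain N :: nat where N: "\<bar>l\<bar> + (hs_norm (P f l))\<^sup>2 + 1 \<le> real N"
        using real_arch_simple by blast
      then have "\<bar>l\<bar> < real N" "(hs_norm (P f l))\<^sup>2 \<le> real N"
        using zero_le_power2[of "hs_norm (P f l)"] abs_ge_zero[of l] by linarith+
      then have "l \<in> E N"
        using l unfolding E_def by (auto simp: abs_less_iff)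
      then have uv: "u l = v l" using elim(1) by blast
      have s: "summable (\<lambda>i. (\<bar>l\<bar> * p i l)\<^sup>2)"
        using uv unfolding u_def v_def by (intro summable_suminf_not_top) auto
      have "(\<Sum>i. ennreal ((\<bar>l\<bar> * p i l)\<^sup>2)) = ennreal (\<Sum>i. (\<bar>l\<bar> * p i l)\<^sup>2)"
        by (rule suminf_ennreal2[OF _ s]) simp
      then have "ennreal (\<Sum>i. (\<bar>l\<bar> * p i l)\<^sup>2) = ennreal (\<bar>l\<bar> * (hs_norm T)\<^sup>2)"
        using uv unfolding u_def v_def by (simp only:)
      then have "(\<Sum>i. (\<bar>l\<bar> * p i l)\<^sup>2) = \<bar>l\<bar> * (hs_norm T)\<^sup>2"
        by (subst (asm) ennreal_inj) (auto intro: suminf_nonneg s)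
      then have "(\<lambda>i. (\<bar>l\<bar> * p i l)\<^sup>2) sums (\<bar>l\<bar> * (hs_norm T)\<^sup>2)"
        using s by (simp add: sums_iff)
      \<comment> \<open>As l is nonzero, one of the two powers of |l| on the left can be cancelled
        against the one on the right.\<close>
      then have "(\<lambda>i. (1 / \<bar>l\<bar>) * (\<bar>l\<bar> * p i l)\<^sup>2) sums ((1 / \<bar>l\<bar>) * (\<bar>l\<bar> * (hs_norm T)\<^sup>2))"
        by (rule sums_mult)
      then have "(\<lambda>i. \<bar>l\<bar> * (p i l)\<^sup>2) sums (hs_norm T)\<^sup>2"
        using elim(2) by (simp add: power2_eq_square field_simps)
      then have "((\<lambda>i. \<bar>l\<bar> * (p i l)\<^sup>2) has_sum (hs_norm T)\<^sup>2) UNIV"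
        by (rule sums_nonneg_imp_has_sum) simp
      then show "((\<lambda>(\<kappa>, \<eta>). \<bar>l\<bar> * (cmod (hs_inner (P (biregular \<kappa> \<eta> f) l) T))\<^sup>2) has_sum (hs_norm T)\<^sup>2) Lambda1"
        using has_sum_reindex_bij_betw[OF e, of "\<lambda>(\<kappa>, \<eta>). \<bar>l\<bar> * (cmod (hs_inner (P (biregular \<kappa> \<eta> f) l) T))\<^sup>2"]
        by (simp add: p_def case_prod_beta)
    qed
  qed
qed

end

theorem theorem2:
  fixes P :: "(mat4 \<Rightarrow> complex) \<Rightarrow> real \<Rightarrow> l2_op"
    and S :: "real set"
    and f :: "mat4 \<Rightarrow> complex"
  assumes "plancherel_transform P"
    and "S \<in> sets lebesgue"
    and "S \<subseteq> - {0}"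
    and "translation_congruent S {0<..1}"
    and "f \<in> spectral_subspace P S"
    and "parseval_frame (spectral_subspace P S) (L2_inner haar) Lambda
           (\<lambda>(\<gamma>, \<eta>). biregular \<gamma> \<eta> f)"
  shows "AE l in lborel. l \<in> S \<longrightarrow>
    parseval_frame hs_ops hs_inner Lambda1
      (\<lambda>(\<kappa>, \<eta>). op_scale (of_real (\<bar>l\<bar> powr (1/2))) (rep_tensor l \<kappa> \<eta> (P f l)))"
proof -
  interpret plancherel P by unfold_locales fact
  have fL: "f \<in> L2 haar" using assms(5) by (simp add: spectral_subspace_def)
  obtain S' where S': "S' \<in> sets borel" "S' \<subseteq> S" "AE l in lborel. l \<in> S \<longrightarrow> l \<in> S'"
    and packing: "integer_packing S'"
    using translation_congruent_packing[OF assms(2,4)] by blast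
  obtain D where D: "countable D" "hs.nrm_dense D"
    using hs_ops_countable_dense by blast
  have DH: "T \<in> hs_ops" if "T \<in> D" for T
    using D(2) that by (auto simp: hs.nrm_dense_def)
  \<comment> \<open>The exceptional null set depends on T, and countability of D merges these sets
    into one. The same is done next for the pairs in \<open>Lambda1\<close>.\<close>
  have "AE l in lborel. \<forall>T\<in>D. l \<in> S' \<longrightarrow>
      ((\<lambda>(\<kappa>, \<eta>). \<bar>l\<bar> * (cmod (hs_inner (P (biregular \<kappa> \<eta> f) l) T))\<^sup>2) has_sum (hs_norm T)\<^sup>2) Lambda1"
    unfolding AE_ball_countable[OF D(1)]
    using fibre_identity[OF assms(5,6) DH S'(1,2) packing] by blast
  moreover have "AE l in lborel. \<forall>i\<in>Lambda1.
      op_eq (P (biregular (fst i) (snd i) f) l) (rep_tensor l (fst i) (snd i) (P f l))"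
    unfolding AE_ball_countable[OF countable_Lambda1]
  proof
    fix i assume "i \<in> Lambda1"
    then have "fst i \<in> heis" "snd i \<in> heis"
      using Lambda1_in_heis[of "fst i" "snd i"] by auto
    then show "AE l in lborel. op_eq (P (biregular (fst i) (snd i) f) l) (rep_tensor l (fst i) (snd i) (P f l))"
      by (rule P_biregular[OF fL])
  qed
  ultimately show ?thesis
    using S'(3) AE_lborel_singleton[of 0]
  proof eventually_elim
    case (elim l)
    show ?case
    proof
      assume "l \<in> S"
      then have l: "l \<in> S'" using elim(3) by blast
      define c where "c = complex_of_real (\<bar>l\<bar> powr (1/2))"
      have c: "(cmod c)\<^sup>2 = \<bar>l\<bar>"
        by (simp add: c_def powr_half_sqrt)
      define R where "R = (\<lambda>(\<kappa>, \<eta>). rep_tensor l \<kappa> \<eta> (P f l))"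
      have Phs: "P (biregular \<kappa> \<eta> f) l \<in> hs_ops" if "(\<kappa>, \<eta>) \<in> Lambda1" for \<kappa> \<eta>
        using Lambda1_in_heis[OF that] elim(4) by (intro P_hs_ops biregular_L2 fL) auto
      have Peq: "op_eq (P (biregular \<kappa> \<eta> f) l) (R (\<kappa>, \<eta>))" if "(\<kappa>, \<eta>) \<in> Lambda1" for \<kappa> \<eta>
        using elim(2) that by (force simp: R_def)
      \<comment> \<open>The conjugated operator inherits the Hilbert-Schmidt property from the
        transform of the translate, with which it agrees on this fibre.\<close>
      have Rhs: "R (\<kappa>, \<eta>) \<in> hs_ops" if "(\<kappa>, \<eta>) \<in> Lambda1" for \<kappa> \<eta>
      proof (rule op_eq_hs_ops[OF Phs[OF that] op_eq_sym[OF Peq[OF that]]])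
        show "R (\<kappa>, \<eta>) \<phi> \<in> L2 lborel" if "\<phi> \<in> L2 lborel" for \<phi>
          unfolding R_def using Lambda1_in_heis[OF \<open>(\<kappa>, \<eta>) \<in> Lambda1\<close>] elim(4) that
          by (auto intro!: rep_tensor_L2 hs_ops_operator P_hs_ops fL)
      qed
      have "parseval_frame hs_ops hs_inner Lambda1 (\<lambda>(\<kappa>, \<eta>). op_scale c (R (\<kappa>, \<eta>)))"
      proof (rule hs.parseval_frame_dense[OF D(2) _ countable_Lambda1])
        show "(case i of (\<kappa>, \<eta>) \<Rightarrow> op_scale c (R (\<kappa>, \<eta>))) \<in> hs_ops" if "i \<in> Lambda1" for i
          using Rhs[of "fst i" "snd i"] that by (simp add: case_prod_beta hs_ops_op_scale)
        fix T assume T: "T \<in> D"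
        have "((\<lambda>(\<kappa>, \<eta>). \<bar>l\<bar> * (cmod (hs_inner (P (biregular \<kappa> \<eta> f) l) T))\<^sup>2) has_sum (hs_norm T)\<^sup>2) Lambda1"
          using elim(1) T l by blast
        moreover have "(cmod (hs_inner T (case i of (\<kappa>, \<eta>) \<Rightarrow> op_scale c (R (\<kappa>, \<eta>)))))\<^sup>2
            = (case i of (\<kappa>, \<eta>) \<Rightarrow> \<bar>l\<bar> * (cmod (hs_inner (P (biregular \<kappa> \<eta> f) l) T))\<^sup>2)" if "i \<in> Lambda1" for i
        proof -
          obtain \<kappa> \<eta> where i: "i = (\<kappa>, \<eta>)" by (cases i)
          have ke: "(\<kappa>, \<eta>) \<in> Lambda1" using that by (simp add: i)
          have "hs_inner T (op_scale c (R (\<kappa>, \<eta>))) = cnj c * hs_inner T (R (\<kappa>, \<eta>))"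
            by (rule hs.ip_sc_right[OF Rhs[OF ke] DH[OF T]])
          also have "hs_inner T (R (\<kappa>, \<eta>)) = hs_inner T (P (biregular \<kappa> \<eta> f) l)"
            by (intro hs_inner_op_eq DH T Rhs Phs ke op_eq_refl op_eq_sym[OF Peq])
          also have "\<dots> = cnj (hs_inner (P (biregular \<kappa> \<eta> f) l) T)"
            by (rule hs.ip_cnj[OF Phs[OF ke] DH[OF T], symmetric])
          finally show ?thesis
            by (simp add: i norm_mult power_mult_distrib c)
        qed
        moreover have "Re (hs_inner T T) = (hs_norm T)\<^sup>2"
          using hs.nrm_sq[OF DH[OF T]] by (simp add: hs_nrm DH T)
        ultimately show "((\<lambda>i. (cmod (hs_inner T (case i of (\<kappa>, \<eta>) \<Rightarrow> op_scale c (R (\<kappa>, \<eta>)))))\<^sup>2) has_sum Re (hs_inner T T)) Lambda1"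
          using has_sum_cong[of Lambda1 "\<lambda>i. (cmod (hs_inner T (case i of (\<kappa>, \<eta>) \<Rightarrow> op_scale c (R (\<kappa>, \<eta>)))))\<^sup>2"
            "\<lambda>i. case i of (\<kappa>, \<eta>) \<Rightarrow> \<bar>l\<bar> * (cmod (hs_inner (P (biregular \<kappa> \<eta> f) l) T))\<^sup>2"]
          by (simp only:)
      qed
      then show "parseval_frame hs_ops hs_inner Lambda1
          (\<lambda>(\<kappa>, \<eta>). op_scale (of_real (\<bar>l\<bar> powr (1/2))) (rep_tensor l \<kappa> \<eta> (P f l)))"
        by (simp add: R_def c_def)
    qed
  qed
qed

end
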